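(* Assume that for every countable discrete group $G$ of finite asymptotic dimension one has $\mathrm{hd}_{\mathbb{Q}}(G)<\infty$, and that for every countable discrete group $G$ of finite asymptotic dimension and every $g\in G$ the quotient $C_g/\langle g\rangle$ has finite asymptotic dimension, where $C_g<G$ is the centralizer of $g$. Then every group $G$ of finite asymptotic dimension satisfies the Burghelea conjecture, i.e. $\bigoplus_{[g]\in\langle G\rangle^{\infty}}T^G_\ast(g;\mathbb{C})=0$.
   Context: Asymptotic dimension of a countable group is taken with respect to any proper left-invariant metric (all such metrics are coarsely equivalent). $\mathrm{hd}_{\mathbb{Q}}(G)$ is the flat dimension of the trivial $\mathbb{Q}G$-module $\mathbb{Q}$. $\langle G\rangle^{\infty}$ is the set of conjugacy classes of infinite order elements. For $g$ of infinite order, $T^G_\ast(g;\mathbb{C}):=\varprojlim\big(\cdots\xrightarrow{S}H_{\ast+2n}(C_g/\langle g\rangle;\mathbb{C})\xrightarrow{S}H_{\ast+2n-2}(C_g/\langle g\rangle;\mathbb{C})\xrightarrow{S}\cdots\big)$, $\ast\in\{0,1\}$, where $S$ is the Gysin homomorphism of the fibration $S^1=B\langle g\rangle\to BC_g\to B(C_g/\langle g\rangle)$, i.e. cap product with the Euler class in $H^2(C_g/\langle g\rangle;\mathbb{Z})$ of the central extension $1\to\langle g\rangle\to C_g\to C_g/\langle g\rangle\to1$. *)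

theory Defs
  imports "HOL-Algebra.Algebra" "HOL-Analysis.Abstract_Metric_Spaces" "HOL-Library.Extended_Nat"
begin

section \<open>Asymptotic dimension\<close>

definition asdim_le :: "'a set \<Rightarrow> ('a \<Rightarrow> 'a \<Rightarrow> real) \<Rightarrow> nat \<Rightarrow> bool" where
  "asdim_le M d n \<longleftrightarrow>
     (\<forall>r>0. \<exists>(\<U> :: nat \<Rightarrow> 'a set set) D.
        M = (\<Union>i\<le>n. \<Union>(\<U> i)) \<and>
        (\<forall>i\<le>n. \<forall>U\<in>\<U> i. \<forall>x\<in>U. \<forall>y\<in>U. d x y \<le> D) \<and>
        (\<forall>i\<le>n. \<forall>U\<in>\<U> i. \<forall>V\<in>\<U> i. U \<noteq> V \<longrightarrow> (\<forall>x\<in>U. \<forall>y\<in>V. d x y > r)))"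

text \<open>On a discrete group, a left-invariant metric is proper when its balls are finite.\<close>

definition proper_left_invariant_metric ::
    "('a, 'b) monoid_scheme \<Rightarrow> ('a \<Rightarrow> 'a \<Rightarrow> real) \<Rightarrow> bool" where
  "proper_left_invariant_metric G d \<longleftrightarrow>
     Metric_space (carrier G) d \<and>
     (\<forall>x\<in>carrier G. \<forall>r. finite (Metric_space.mcball (carrier G) d x r)) \<and>
     (\<forall>g\<in>carrier G. \<forall>x\<in>carrier G. \<forall>y\<in>carrier G. d (g \<otimes>\<^bsub>G\<^esub> x) (g \<otimes>\<^bsub>G\<^esub> y) = d x y)"

text \<open>All proper left-invariant metrics on a countable group are coarsely equivalent, so every
  one of them computes the infimum. A group carries such a metric iff it is countable; for an
  uncountable group the infimum is over the empty set, hence \<open>\<infinity>\<close>.\<close>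

definition asdim :: "('a, 'b) monoid_scheme \<Rightarrow> enat" where
  "asdim G = Inf {enat n | n. \<exists>d. proper_left_invariant_metric G d \<and> asdim_le (carrier G) d n}"


section \<open>Modules over a not necessarily commutative ring, and flat dimension\<close>

text \<open>The library locale for modules requires a commutative ring, so only its record is used;
  the ring multiplication and unit inherited by that record are irrelevant here.
  A right module is encoded by writing \<open>x r\<close> as \<open>r \<odot> x\<close>.\<close>

definition left_module :: "('r, 'x) ring_scheme \<Rightarrow> ('r, 'm, 'y) module_scheme \<Rightarrow> bool" where
  "left_module R M \<longleftrightarrow>
     ring R \<and> abelian_group M \<and>
     (\<forall>r\<in>carrier R. \<forall>x\<in>carrier M. r \<odot>\<^bsub>M\<^esub> x \<in> carrier M) \<and>
     (\<forall>r\<in>carrier R. \<forall>s\<in>carrier R. \<forall>x\<in>carrier M.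
        (r \<oplus>\<^bsub>R\<^esub> s) \<odot>\<^bsub>M\<^esub> x = r \<odot>\<^bsub>M\<^esub> x \<oplus>\<^bsub>M\<^esub> s \<odot>\<^bsub>M\<^esub> x) \<and>
     (\<forall>r\<in>carrier R. \<forall>x\<in>carrier M. \<forall>y\<in>carrier M.
        r \<odot>\<^bsub>M\<^esub> (x \<oplus>\<^bsub>M\<^esub> y) = r \<odot>\<^bsub>M\<^esub> x \<oplus>\<^bsub>M\<^esub> r \<odot>\<^bsub>M\<^esub> y) \<and>
     (\<forall>r\<in>carrier R. \<forall>s\<in>carrier R. \<forall>x\<in>carrier M.
        (r \<otimes>\<^bsub>R\<^esub> s) \<odot>\<^bsub>M\<^esub> x = r \<odot>\<^bsub>M\<^esub> (s \<odot>\<^bsub>M\<^esub> x)) \<and>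
     (\<forall>x\<in>carrier M. \<one>\<^bsub>R\<^esub> \<odot>\<^bsub>M\<^esub> x = x)"

definition right_module :: "('r, 'x) ring_scheme \<Rightarrow> ('r, 'm, 'y) module_scheme \<Rightarrow> bool" where
  "right_module R M \<longleftrightarrow>
     ring R \<and> abelian_group M \<and>
     (\<forall>r\<in>carrier R. \<forall>x\<in>carrier M. r \<odot>\<^bsub>M\<^esub> x \<in> carrier M) \<and>
     (\<forall>r\<in>carrier R. \<forall>s\<in>carrier R. \<forall>x\<in>carrier M.
        (r \<oplus>\<^bsub>R\<^esub> s) \<odot>\<^bsub>M\<^esub> x = r \<odot>\<^bsub>M\<^esub> x \<oplus>\<^bsub>M\<^esub> s \<odot>\<^bsub>M\<^esub> x) \<and>
     (\<forall>r\<in>carrier R. \<forall>x\<in>carrier M. \<forall>y\<in>carrier M.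
        r \<odot>\<^bsub>M\<^esub> (x \<oplus>\<^bsub>M\<^esub> y) = r \<odot>\<^bsub>M\<^esub> x \<oplus>\<^bsub>M\<^esub> r \<odot>\<^bsub>M\<^esub> y) \<and>
     (\<forall>r\<in>carrier R. \<forall>s\<in>carrier R. \<forall>x\<in>carrier M.
        (r \<otimes>\<^bsub>R\<^esub> s) \<odot>\<^bsub>M\<^esub> x = s \<odot>\<^bsub>M\<^esub> (r \<odot>\<^bsub>M\<^esub> x)) \<and>
     (\<forall>x\<in>carrier M. \<one>\<^bsub>R\<^esub> \<odot>\<^bsub>M\<^esub> x = x)"

definition linear_hom ::
    "('r, 'x) ring_scheme \<Rightarrow> ('r, 'm, 'y) module_scheme \<Rightarrow> ('r, 'n, 'z) module_scheme
      \<Rightarrow> ('m \<Rightarrow> 'n) set" where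
  "linear_hom R M N =
     {f \<in> hom (add_monoid M) (add_monoid N).
        \<forall>r\<in>carrier R. \<forall>x\<in>carrier M. f (r \<odot>\<^bsub>M\<^esub> x) = r \<odot>\<^bsub>N\<^esub> f x}"

definition tensor_relations ::
    "('r, 'x) ring_scheme \<Rightarrow> ('r, 'm, 'y) module_scheme \<Rightarrow> ('r, 'n, 'z) module_scheme
      \<Rightarrow> ('m \<times> 'n \<Rightarrow>\<^sub>0 int) set" where
  "tensor_relations R A F = generate (free_Abelian_group (carrier A \<times> carrier F))
     ({frag_of (a \<oplus>\<^bsub>A\<^esub> b, x) - frag_of (a, x) - frag_of (b, x) | a b x.
         a \<in> carrier A \<and> b \<in> carrier A \<and> x \<in> carrier F} \<union>
      {frag_of (a, x \<oplus>\<^bsub>F\<^esub> y) - frag_of (a, x) - frag_of (a, y) | a x y.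
         a \<in> carrier A \<and> x \<in> carrier F \<and> y \<in> carrier F} \<union>
      {frag_of (r \<odot>\<^bsub>A\<^esub> a, x) - frag_of (a, r \<odot>\<^bsub>F\<^esub> x) | r a x.
         r \<in> carrier R \<and> a \<in> carrier A \<and> x \<in> carrier F})"

text \<open>\<open>A \<otimes>\<^sub>R F\<close> for a right module \<open>A\<close> and a left module \<open>F\<close>.\<close>

definition tensor ::
    "('r, 'x) ring_scheme \<Rightarrow> ('r, 'm, 'y) module_scheme \<Rightarrow> ('r, 'n, 'z) module_scheme
      \<Rightarrow> ('m \<times> 'n \<Rightarrow>\<^sub>0 int) set monoid" where
  "tensor R A F = free_Abelian_group (carrier A \<times> carrier F) Mod tensor_relations R A F"

text \<open>The map \<open>f \<otimes> F : A \<otimes>\<^sub>R F \<rightarrow> B \<otimes>\<^sub>R F\<close> induced by \<open>f : A \<rightarrow> B\<close>. All the cosets in the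
  union coincide when \<open>f\<close> is linear.\<close>

definition tensor_map ::
    "('r, 'x) ring_scheme \<Rightarrow> ('r, 'm, 'y) module_scheme \<Rightarrow> ('r, 'k, 'w) module_scheme
      \<Rightarrow> ('r, 'n, 'z) module_scheme \<Rightarrow> ('m \<Rightarrow> 'k)
      \<Rightarrow> ('m \<times> 'n \<Rightarrow>\<^sub>0 int) set \<Rightarrow> ('k \<times> 'n \<Rightarrow>\<^sub>0 int) set" where
  "tensor_map R A B F f K =
     (\<Union>z\<in>K. r_coset (free_Abelian_group (carrier B \<times> carrier F)) (tensor_relations R B F)
               (frag_extend (\<lambda>(a, x). frag_of (f a, x)) z))"

text \<open>\<open>F\<close> is flat if \<open>\<hyphen> \<otimes>\<^sub>R F\<close> preserves injectivity. The type \<open>nat \<Rightarrow> 'r\<close> serves as the universe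
  of modules. It contains a copy of \<open>R\<close> and of all its right ideals, and flatness is detected by
  the inclusions of right ideals into \<open>R\<close>, so allowing larger modules would not
  change the notion.\<close>

definition flat_module :: "('r, 'x) ring_scheme \<Rightarrow> ('r, 'm, 'y) module_scheme \<Rightarrow> bool" where
  "flat_module R F \<longleftrightarrow>
     left_module R F \<and>
     (\<forall>(A :: ('r, nat \<Rightarrow> 'r) module) (B :: ('r, nat \<Rightarrow> 'r) module) f.
        right_module R A \<and> right_module R B \<and> f \<in> linear_hom R A B \<and> inj_on f (carrier A)
        \<longrightarrow> inj_on (tensor_map R A B F f) (carrier (tensor R A F)))"

text \<open>A flat resolution \<open>0 \<rightarrow> F\<^sub>n \<rightarrow> \<dots> \<rightarrow> F\<^sub>0 \<rightarrow> M \<rightarrow> 0\<close> with augmentation \<open>e\<close> and differentials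
  \<open>\<delta> i : F\<^sub>i\<^sub>+\<^sub>1 \<rightarrow> F\<^sub>i\<close>, extended by zero modules.\<close>

definition flat_resolution ::
    "('r, 'x) ring_scheme \<Rightarrow> ('r, 'm, 'y) module_scheme \<Rightarrow> nat
      \<Rightarrow> (nat \<Rightarrow> ('r, 'k, 'z) module_scheme) \<Rightarrow> (nat \<Rightarrow> 'k \<Rightarrow> 'k) \<Rightarrow> ('k \<Rightarrow> 'm) \<Rightarrow> bool" where
  "flat_resolution R M n F \<delta> e \<longleftrightarrow>
     left_module R M \<and>
     (\<forall>i. flat_module R (F i)) \<and>
     (\<forall>i>n. carrier (F i) = {\<zero>\<^bsub>F i\<^esub>}) \<and>
     e \<in> linear_hom R (F 0) M \<and>
     (\<forall>i. \<delta> i \<in> linear_hom R (F (Suc i)) (F i)) \<and>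
     e ` carrier (F 0) = carrier M \<and>
     a_kernel (F 0) M e = \<delta> 0 ` carrier (F 1) \<and>
     (\<forall>i. a_kernel (F (Suc i)) (F i) (\<delta> i) = \<delta> (Suc i) ` carrier (F (Suc (Suc i))))"

text \<open>A module of cardinality at most that of \<open>nat \<Rightarrow> 'r\<close> has a free resolution by modules of that
  kind, hence, if its flat dimension is finite, a shortest flat resolution of that kind. So
  the universe \<open>nat \<Rightarrow> 'r\<close> loses nothing for such modules, if \<open>R\<close> is nontrivial.\<close>

definition flat_dim :: "('r, 'x) ring_scheme \<Rightarrow> ('r, 'm, 'y) module_scheme \<Rightarrow> enat" where
  "flat_dim R M =
     Inf {enat n | n. \<exists>(F :: nat \<Rightarrow> ('r, nat \<Rightarrow> 'r) module) \<delta> e. flat_resolution R M n F \<delta> e}"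

definition rational_group_ring :: "('a, 'b) monoid_scheme \<Rightarrow> ('a \<Rightarrow>\<^sub>0 rat) ring" where
  "rational_group_ring G =
     \<lparr>carrier = {f. Poly_Mapping.keys f \<subseteq> carrier G},
      monoid.mult = (\<lambda>f h. \<Sum>x\<in>Poly_Mapping.keys f. \<Sum>y\<in>Poly_Mapping.keys h.
        Poly_Mapping.single (x \<otimes>\<^bsub>G\<^esub> y) (Poly_Mapping.lookup f x * Poly_Mapping.lookup h y)),
      one = Poly_Mapping.single \<one>\<^bsub>G\<^esub> 1,
      ring.zero = 0,
      ring.add = (+)\<rparr>"

definition trivial_rational_module :: "('a \<Rightarrow>\<^sub>0 rat, rat) module" where
  "trivial_rational_module =
     \<lparr>carrier = UNIV, monoid.mult = (*), one = 1, ring.zero = 0, ring.add = (+),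
      smult = (\<lambda>f q. (\<Sum>x\<in>Poly_Mapping.keys f. Poly_Mapping.lookup f x) * q)\<rparr>"

definition hd_rat :: "('a, 'b) monoid_scheme \<Rightarrow> enat" where
  "hd_rat G = flat_dim (rational_group_ring G) trivial_rational_module"


section \<open>Group homology with complex coefficients\<close>

text \<open>The inhomogeneous bar complex: the list \<open>[g\<^sub>1, \<dots>, g\<^sub>n]\<close> is the bar generator
  \<open>[g\<^sub>1|\<dots>|g\<^sub>n]\<close>, and \<open>bar_face Q i\<close> is the \<open>i\<close>-th face map of the nerve of \<open>Q\<close>.\<close>

definition bar_face :: "('q, 'b) monoid_scheme \<Rightarrow> nat \<Rightarrow> 'q list \<Rightarrow> 'q list" where
  "bar_face Q i xs =
     (if i = 0 then tl xs
      else if i = length xs then butlast xs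
      else take (i - 1) xs @ (xs ! (i - 1) \<otimes>\<^bsub>Q\<^esub> xs ! i) # drop (i + 1) xs)"

definition bar_chains :: "('q, 'b) monoid_scheme \<Rightarrow> nat \<Rightarrow> ('q list \<Rightarrow>\<^sub>0 complex) set" where
  "bar_chains Q n =
     {c. \<forall>xs\<in>Poly_Mapping.keys c. length xs = n \<and> set xs \<subseteq> carrier Q}"

definition bar_boundary ::
    "('q, 'b) monoid_scheme \<Rightarrow> ('q list \<Rightarrow>\<^sub>0 complex) \<Rightarrow> ('q list \<Rightarrow>\<^sub>0 complex)" where
  "bar_boundary Q c =
     (\<Sum>xs\<in>Poly_Mapping.keys c. if xs = [] then 0 else
        (\<Sum>i\<le>length xs. Poly_Mapping.single (bar_face Q i xs) ((-1) ^ i * Poly_Mapping.lookup c xs)))"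

definition bar_cycle_group ::
    "('q, 'b) monoid_scheme \<Rightarrow> nat \<Rightarrow> ('q list \<Rightarrow>\<^sub>0 complex) monoid" where
  "bar_cycle_group Q n =
     \<lparr>carrier = {c \<in> bar_chains Q n. bar_boundary Q c = 0}, monoid.mult = (+), one = 0\<rparr>"

definition bar_boundaries :: "('q, 'b) monoid_scheme \<Rightarrow> nat \<Rightarrow> ('q list \<Rightarrow>\<^sub>0 complex) set" where
  "bar_boundaries Q n = bar_boundary Q ` bar_chains Q (Suc n)"

definition group_homology ::
    "('q, 'b) monoid_scheme \<Rightarrow> nat \<Rightarrow> ('q list \<Rightarrow>\<^sub>0 complex) set monoid" where
  "group_homology Q n = bar_cycle_group Q n Mod bar_boundaries Q n"


section \<open>The Gysin homomorphism and the Burghelea conjecture\<close>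

definition centralizer :: "('a, 'b) monoid_scheme \<Rightarrow> 'a \<Rightarrow> 'a set" where
  "centralizer G g = {h \<in> carrier G. h \<otimes>\<^bsub>G\<^esub> g = g \<otimes>\<^bsub>G\<^esub> h}"

definition centralizer_quotient :: "('a, 'b) monoid_scheme \<Rightarrow> 'a \<Rightarrow> 'a set monoid" where
  "centralizer_quotient G g = G\<lparr>carrier := centralizer G g\<rparr> Mod generate G {g}"

text \<open>The 2-cocycle of the central extension \<open>1 \<rightarrow> \<langle>g\<rangle> \<rightarrow> C\<^sub>g \<rightarrow> C\<^sub>g/\<langle>g\<rangle> \<rightarrow> 1\<close> for \<open>g\<close> of infinite order,
  relative to the section \<open>s\<close> choosing an element in each coset: \<open>s(K) s(L) = g\<^sup>k s(K L)\<close>.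
  It represents the Euler class in \<open>H\<^sup>2(C\<^sub>g/\<langle>g\<rangle>; \<int>)\<close>.\<close>

definition euler_cocycle :: "('a, 'b) monoid_scheme \<Rightarrow> 'a \<Rightarrow> 'a set \<Rightarrow> 'a set \<Rightarrow> int" where
  "euler_cocycle G g K L =
     (let s = (\<lambda>Z. SOME z. z \<in> Z) in
      THE k. s K \<otimes>\<^bsub>G\<^esub> s L = (g [^]\<^bsub>G\<^esub> k) \<otimes>\<^bsub>G\<^esub> s (K \<otimes>\<^bsub>centralizer_quotient G g\<^esub> L))"

text \<open>Cap product with a 2-cochain on bar chains of degree at least 2:
  \<open>[g\<^sub>1|\<dots>|g\<^sub>n] \<mapsto> u(g\<^sub>1, g\<^sub>2) [g\<^sub>3|\<dots>|g\<^sub>n]\<close>.\<close>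

definition bar_cap :: "('q \<Rightarrow> 'q \<Rightarrow> int) \<Rightarrow> ('q list \<Rightarrow>\<^sub>0 complex) \<Rightarrow> ('q list \<Rightarrow>\<^sub>0 complex)" where
  "bar_cap u c =
     (\<Sum>xs\<in>Poly_Mapping.keys c.
        Poly_Mapping.single (drop 2 xs) (of_int (u (xs ! 0) (xs ! 1)) * Poly_Mapping.lookup c xs))"

text \<open>\<open>S : H\<^sub>n\<^sub>+\<^sub>2(C\<^sub>g/\<langle>g\<rangle>; \<complex>) \<rightarrow> H\<^sub>n(C\<^sub>g/\<langle>g\<rangle>; \<complex>)\<close>. All the cosets in the union coincide, since capping
  with a cocycle is a chain map; changing the section changes that chain map by a homotopy.\<close>

definition gysin ::
    "('a, 'b) monoid_scheme \<Rightarrow> 'a \<Rightarrow> nat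
      \<Rightarrow> ('a set list \<Rightarrow>\<^sub>0 complex) set \<Rightarrow> ('a set list \<Rightarrow>\<^sub>0 complex) set" where
  "gysin G g n K =
     (let Q = centralizer_quotient G g in
        \<Union>z\<in>K. r_coset (bar_cycle_group Q n) (bar_boundaries Q n) (bar_cap (euler_cocycle G g) z))"

text \<open>The inverse limit \<open>T\<^sup>G\<^sub>i(g; \<complex>)\<close>; it is unchanged under conjugation of \<open>g\<close> up to
  isomorphism.\<close>

definition burghelea_T ::
    "('a, 'b) monoid_scheme \<Rightarrow> 'a \<Rightarrow> nat \<Rightarrow> (nat \<Rightarrow> ('a set list \<Rightarrow>\<^sub>0 complex) set) monoid" where
  "burghelea_T G g i = (let H = (\<lambda>n. group_homology (centralizer_quotient G g) (i + 2 * n)) in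
     \<lparr>carrier = {x. (\<forall>n. x n \<in> carrier (H n)) \<and> (\<forall>n. gysin G g (i + 2 * n) (x (Suc n)) = x n)},
      monoid.mult = (\<lambda>x y n. x n \<otimes>\<^bsub>H n\<^esub> y n),
      one = (\<lambda>n. \<one>\<^bsub>H n\<^esub>)\<rparr>)"

definition conjugacy_class :: "('a, 'b) monoid_scheme \<Rightarrow> 'a \<Rightarrow> 'a set" where
  "conjugacy_class G g = {h \<otimes>\<^bsub>G\<^esub> g \<otimes>\<^bsub>G\<^esub> inv\<^bsub>G\<^esub> h | h. h \<in> carrier G}"

text \<open>The library's \<open>group.ord\<close> is 0 exactly for elements of infinite order.\<close>

definition infinite_order_classes :: "('a, 'b) monoid_scheme \<Rightarrow> 'a set set" where
  "infinite_order_classes G = {conjugacy_class G g | g. g \<in> carrier G \<and> group.ord G g = 0}"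

definition burghelea_conjecture :: "('a, 'b) monoid_scheme \<Rightarrow> bool" where
  "burghelea_conjecture G \<longleftrightarrow>
     (\<forall>i\<in>{0, 1}. trivial_group
        (sum_group (infinite_order_classes G) (\<lambda>c. burghelea_T G (SOME g. g \<in> c) i)))"

end

theory Submission
  imports Defs
begin

text \<open>A group of finite asymptotic dimension is countable, so by the hypotheses every \<open>Q = C\<^sub>g/\<langle>g\<rangle>\<close> has
  finite \<open>hd\<^sub>\<rat>\<close>. Tensoring a finite flat resolution of \<open>\<rat>\<close> with the bar resolution gives a double complex
  with exact rows and columns; a diagram chase shows that the homology of \<open>Q\<close> vanishes in
  all large degrees, first over \<open>\<rat>\<close> and then, along a \<open>\<rat>\<close>-basis of \<open>\<complex>\<close>, over \<open>\<complex>\<close>. An inverse system of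
  groups that vanish from some stage on has trivial limit.\<close>

section \<open>Chains and the bar resolution\<close>

text \<open>The assumptions concern groups on the type \<open>nat\<close>, and the flat resolutions
  behind \<open>hd_rat\<close> live in a universe \<open>nat \<Rightarrow> 'r\<close>. Hence every
  countable group is replaced by an isomorphic one on \<open>nat\<close>: there lists are countable,
  so rational chains inject into that universe and flatness can be tested on the bar resolution.
  Rational coefficients are forced at this stage, since flatness is over the rational group ring. In
  the double complex the entry at (p, q) is C p \<otimes> F q, with C p the free right module of the
  bar resolution. Exactness along p comes from flatness of F q, exactness along q from freeness of C
  p. Since F q = 0 for q > N, a chase that starts at (p, 0) and trades one step of p for one step of
  q stops at a zero module after N + 1 steps; hence the range of degrees p > N. A thread of the
  inverse system that is zero far out is zero below once S(0) = 0. As S is a map of cosets, this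
  says that capping with the Euler cocycle preserves boundaries, and that is the cocycle
  identity.\<close>

definition pscale :: "'k::comm_ring_1 \<Rightarrow> ('x \<Rightarrow>\<^sub>0 'k) \<Rightarrow> ('x \<Rightarrow>\<^sub>0 'k)" where
  "pscale k c = Poly_Mapping.map ((*) k) c"

text \<open>Nearly all maps of chains below are such linear extensions, so an identity between two
  of them reduces by \<open>linext_linext\<close> and \<open>linext_cong_chains\<close> to a single
  list. The coefficient ring is arbitrary because the same maps serve over \<rat> and over
  \<complex>.\<close>

definition linext :: "('x \<Rightarrow> 'y \<Rightarrow>\<^sub>0 'k) \<Rightarrow> ('x \<Rightarrow>\<^sub>0 'k::comm_ring_1) \<Rightarrow> ('y \<Rightarrow>\<^sub>0 'k)" where
  "linext f c = (\<Sum>x\<in>Poly_Mapping.keys c. pscale (Poly_Mapping.lookup c x) (f x))"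

abbreviation basis :: "'x \<Rightarrow> ('x \<Rightarrow>\<^sub>0 'k::comm_ring_1)" where
  "basis x \<equiv> Poly_Mapping.single x 1"

lemma lookup_pscale [simp]: "Poly_Mapping.lookup (pscale k c) x = k * Poly_Mapping.lookup c x"
  unfolding pscale_def by (simp add: Poly_Mapping.map.rep_eq when_def)

lemma keys_pscale: "Poly_Mapping.keys (pscale k c) \<subseteq> Poly_Mapping.keys c"
  by (auto simp: in_keys_iff)

lemma pscale_add_left: "pscale (k + l) c = pscale k c + pscale l c"
  by (rule poly_mapping_eqI) (simp add: lookup_add distrib_right)

lemma pscale_add_right: "pscale k (c + d) = pscale k c + pscale k d"
  by (rule poly_mapping_eqI) (simp add: lookup_add distrib_left)

lemma pscale_diff_right: "pscale k (c - d) = pscale k c - pscale k d"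
  by (rule poly_mapping_eqI) (simp add: lookup_minus right_diff_distrib)

lemma pscale_uminus_left: "pscale (- k) c = - pscale k c"
  by (rule poly_mapping_eqI) simp

lemma pscale_zero_left [simp]: "pscale 0 c = 0"
  by (rule poly_mapping_eqI) simp

lemma pscale_zero_right [simp]: "pscale k 0 = 0"
  by (rule poly_mapping_eqI) simp

lemma pscale_one [simp]: "pscale 1 c = c"
  by (rule poly_mapping_eqI) simp

lemma pscale_pscale [simp]: "pscale k (pscale l c) = pscale (k * l) c"
  by (rule poly_mapping_eqI) (simp add: mult.assoc)

lemma pscale_single [simp]: "pscale k (Poly_Mapping.single x l) = Poly_Mapping.single x (k * l)"
  by (rule poly_mapping_eqI) (simp add: lookup_single when_def)

lemma pscale_sum: "pscale k (sum f S) = (\<Sum>i\<in>S. pscale k (f i))"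
  by (induction S rule: infinite_finite_induct) (auto simp: pscale_add_right)

lemma linext_superset:
  assumes "finite S" "Poly_Mapping.keys c \<subseteq> S"
  shows "linext f c = (\<Sum>x\<in>S. pscale (Poly_Mapping.lookup c x) (f x))"
  unfolding linext_def
  by (rule sum.mono_neutral_left) (use assms in \<open>auto simp: in_keys_iff\<close>)

lemma linext_zero [simp]: "linext f 0 = 0"
  by (simp add: linext_def)

lemma linext_add: "linext f (c + d) = linext f c + linext f d"
proof -
  let ?S = "Poly_Mapping.keys c \<union> Poly_Mapping.keys d"
  have "linext f (c + d) = (\<Sum>x\<in>?S. pscale (Poly_Mapping.lookup (c + d) x) (f x))"
    by (rule linext_superset) (use keys_add[of c d] in auto)
  also have "\<dots> = linext f c + linext f d"
    by (simp add: lookup_add pscale_add_left sum.distrib linext_superset[of ?S])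
  finally show ?thesis .
qed

lemma linext_pscale: "linext f (pscale k c) = pscale k (linext f c)"
  by (simp add: linext_superset[OF finite_keys keys_pscale] linext_def[of f c] pscale_sum)

lemma linext_uminus: "linext f (- c) = - linext f c"
proof -
  have "linext f (- c) + linext f c = 0"
    by (simp flip: linext_add)
  then show ?thesis
    by (simp add: eq_neg_iff_add_eq_0)
qed

lemma linext_diff: "linext f (c - d) = linext f c - linext f d"
  using linext_add[of f c "- d"] by (simp add: linext_uminus)

lemma linext_single [simp]: "linext f (Poly_Mapping.single x k) = pscale k (f x)"
  by (simp add: linext_superset[of "{x}"] keys_single)

lemma linext_sum: "linext f (sum g S) = (\<Sum>i\<in>S. linext f (g i))"
  by (induction S rule: infinite_finite_induct) (auto simp: linext_add)

lemma linext_linext: "linext f (linext g c) = linext (\<lambda>x. linext f (g x)) c"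
  by (simp add: linext_def[of g] linext_def[of _ c] linext_sum linext_pscale)

lemma linext_cong: "(\<And>x. x \<in> Poly_Mapping.keys c \<Longrightarrow> f x = g x) \<Longrightarrow> linext f c = linext g c"
  by (simp add: linext_def)

lemma linext_fun_add: "linext (\<lambda>x. f x + g x) c = linext f c + linext g c"
  by (simp add: linext_def pscale_add_right sum.distrib)

lemma linext_fun_pscale: "linext (\<lambda>x. pscale k (f x)) c = pscale k (linext f c)"
  by (simp add: linext_def pscale_sum mult.commute)

lemma linext_fun_zero [simp]: "linext (\<lambda>x. 0) c = 0"
  by (simp add: linext_def)

lemma linext_basis [simp]: "linext basis c = c"
proof (rule poly_mapping_eqI)
  fix y
  have "Poly_Mapping.lookup (linext basis c) y =
      (\<Sum>x\<in>Poly_Mapping.keys c. if x = y then Poly_Mapping.lookup c x else 0)"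
    unfolding linext_def lookup_sum by (rule sum.cong) (auto simp: lookup_single when_def)
  also have "\<dots> = Poly_Mapping.lookup c y"
    by (simp add: sum.delta' in_keys_iff)
  finally show "Poly_Mapping.lookup (linext basis c) y = Poly_Mapping.lookup c y" .
qed

lemma keys_linext: "Poly_Mapping.keys (linext f c) \<subseteq> (\<Union>x\<in>Poly_Mapping.keys c. Poly_Mapping.keys (f x))"
  unfolding linext_def
proof
  fix y assume "y \<in> Poly_Mapping.keys (\<Sum>x\<in>Poly_Mapping.keys c. pscale (Poly_Mapping.lookup c x) (f x))"
  then have "(\<Sum>x\<in>Poly_Mapping.keys c. Poly_Mapping.lookup c x * Poly_Mapping.lookup (f x) y) \<noteq> 0"
    by (simp add: in_keys_iff lookup_sum)
  then obtain x where "x \<in> Poly_Mapping.keys c" "Poly_Mapping.lookup c x * Poly_Mapping.lookup (f x) y \<noteq> 0"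
    by (rule sum.not_neutral_contains_not_neutral)
  moreover from this have "Poly_Mapping.lookup (f x) y \<noteq> 0"
    by auto
  ultimately show "y \<in> (\<Union>x\<in>Poly_Mapping.keys c. Poly_Mapping.keys (f x))"
    by (auto simp: in_keys_iff)
qed

lemma keys_lextI:
  assumes "\<And>x y. x \<in> Poly_Mapping.keys c \<Longrightarrow> y \<in> Poly_Mapping.keys (f x) \<Longrightarrow> P y"
  shows "\<forall>y\<in>Poly_Mapping.keys (linext f c). P y"
  using keys_linext[of f c] assms by blast

lemma keys_basis [simp]: "Poly_Mapping.keys (basis x :: 'x \<Rightarrow>\<^sub>0 'k::comm_ring_1) = {x}"
  by (simp add: keys_single)

lemma keys_sumE:
  assumes "y \<in> Poly_Mapping.keys (sum f S)"
  obtains i where "i \<in> S" "y \<in> Poly_Mapping.keys (f i)"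
proof -
  have "(\<Sum>i\<in>S. Poly_Mapping.lookup (f i) y) \<noteq> 0"
    using assms by (simp add: in_keys_iff lookup_sum)
  then obtain i where "i \<in> S" "Poly_Mapping.lookup (f i) y \<noteq> 0"
    by (rule sum.not_neutral_contains_not_neutral)
  then show thesis
    using that by (simp add: in_keys_iff)
qed

section \<open>The bar complex and the bar resolution over arbitrary coefficients\<close>

definition tuple_chains :: "('q, 'b) monoid_scheme \<Rightarrow> nat \<Rightarrow> ('q list \<Rightarrow>\<^sub>0 'k::comm_ring_1) set" where
  "tuple_chains Q m = {w. \<forall>xs\<in>Poly_Mapping.keys w. length xs = m \<and> set xs \<subseteq> carrier Q}"

definition bar_bd :: "('q, 'b) monoid_scheme \<Rightarrow> ('q list \<Rightarrow>\<^sub>0 'k) \<Rightarrow> ('q list \<Rightarrow>\<^sub>0 'k::comm_ring_1)" where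
  "bar_bd Q = linext (\<lambda>xs. if xs = [] then 0 else
     (\<Sum>i\<le>length xs. Poly_Mapping.single (bar_face Q i xs) ((-1) ^ i)))"

text \<open>A list of length m stands for
  \<open>[g\<^sub>1|...|g\<^sub>m\<^sub>-\<^sub>1] g\<^sub>m\<close> in degree m - 1 of the bar
  resolution. The face that would delete the last entry is left out; the one of index m - 1
  multiplies into that entry. On lists of length 1 the map is the augmentation, with values in
  multiples of the empty list.\<close>

definition free_bar_bd :: "('q, 'b) monoid_scheme \<Rightarrow> ('q list \<Rightarrow>\<^sub>0 'k) \<Rightarrow> ('q list \<Rightarrow>\<^sub>0 'k::comm_ring_1)" where
  "free_bar_bd Q = linext (\<lambda>xs. \<Sum>i<length xs. Poly_Mapping.single (bar_face Q i xs) ((-1) ^ i))"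

definition shift :: "('q, 'b) monoid_scheme \<Rightarrow> 'q \<Rightarrow> 'q list \<Rightarrow> 'q list" where
  "shift Q g xs = butlast xs @ [last xs \<otimes>\<^bsub>Q\<^esub> g]"

definition right_act :: "('q, 'b) monoid_scheme \<Rightarrow> ('q \<Rightarrow>\<^sub>0 'k) \<Rightarrow> ('q list \<Rightarrow>\<^sub>0 'k) \<Rightarrow> ('q list \<Rightarrow>\<^sub>0 'k::comm_ring_1)" where
  "right_act Q r w = linext (\<lambda>xs. linext (\<lambda>g. basis (shift Q g xs)) r) w"

lemma bar_bd_zero [simp]: "bar_bd Q 0 = 0"
  and bar_bd_diff: "bar_bd Q (c - d) = bar_bd Q c - bar_bd Q d"
  and bar_bd_pscale: "bar_bd Q (pscale k c) = pscale k (bar_bd Q c)"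
  and bar_bd_sum: "bar_bd Q (sum f S) = (\<Sum>i\<in>S. bar_bd Q (f i))"
  by (simp_all add: bar_bd_def linext_diff linext_pscale linext_sum)

lemma tuple_chains_zero [simp]: "0 \<in> tuple_chains Q m"
  by (simp add: tuple_chains_def)

lemma tuple_chains_add: "c \<in> tuple_chains Q m \<Longrightarrow> d \<in> tuple_chains Q m \<Longrightarrow> c + d \<in> tuple_chains Q m"
  using keys_add[of c d] by (auto simp: tuple_chains_def)

lemma tuple_chains_pscale: "c \<in> tuple_chains Q m \<Longrightarrow> pscale k c \<in> tuple_chains Q m"
  using keys_pscale[of k c] by (auto simp: tuple_chains_def)

lemma tuple_chains_uminus: "c \<in> tuple_chains Q m \<Longrightarrow> - c \<in> tuple_chains Q m"
  using tuple_chains_pscale[of c Q m "-1"] by (simp add: pscale_uminus_left)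

lemma tuple_chains_diff: "c \<in> tuple_chains Q m \<Longrightarrow> d \<in> tuple_chains Q m \<Longrightarrow> c - d \<in> tuple_chains Q m"
  using tuple_chains_add[of c Q m "-d"] by (simp add: tuple_chains_uminus)

lemma tuple_chains_basis: "length xs = m \<Longrightarrow> set xs \<subseteq> carrier Q \<Longrightarrow> basis xs \<in> tuple_chains Q m"
  by (simp add: tuple_chains_def)

lemma tuple_chains_single: "length xs = m \<Longrightarrow> set xs \<subseteq> carrier Q \<Longrightarrow> Poly_Mapping.single xs k \<in> tuple_chains Q m"
  by (simp add: tuple_chains_def keys_single)

lemma tuple_chains_sum: "(\<And>i. i \<in> S \<Longrightarrow> f i \<in> tuple_chains Q m) \<Longrightarrow> sum f S \<in> tuple_chains Q m"
  by (induction S rule: infinite_finite_induct) (auto simp: tuple_chains_add)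

lemma tuple_chains_lext:
  "c \<in> tuple_chains Q n \<Longrightarrow> (\<And>xs. length xs = n \<Longrightarrow> set xs \<subseteq> carrier Q \<Longrightarrow> f xs \<in> tuple_chains Q' m) \<Longrightarrow> linext f c \<in> tuple_chains Q' m"
  unfolding tuple_chains_def using keys_linext[of f c] by blast

lemma linext_cong_chains:
  "c \<in> tuple_chains Q n \<Longrightarrow> (\<And>xs. length xs = n \<Longrightarrow> set xs \<subseteq> carrier Q \<Longrightarrow> f xs = g xs) \<Longrightarrow> linext f c = linext g c"
  by (rule linext_cong) (auto simp: tuple_chains_def)

lemma length_bar_face: "i \<le> length xs \<Longrightarrow> xs \<noteq> [] \<Longrightarrow> length (bar_face Q i xs) = length xs - 1"
  by (auto simp: bar_face_def min_def)

lemma set_bar_face: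
  assumes "group Q" "i \<le> length xs" "set xs \<subseteq> carrier Q"
  shows "set (bar_face Q i xs) \<subseteq> carrier Q"
proof -
  interpret group Q by fact
  show ?thesis
  proof (cases "i = 0 \<or> i = length xs")
    case True
    then show ?thesis
      using assms by (auto simp: bar_face_def dest: in_set_butlastD list.set_sel(2) split: if_splits)
        (metis in_mono list.sel(2) list.set_sel(2))
  next
    case False
    then have "xs ! (i - 1) \<in> carrier Q" "xs ! i \<in> carrier Q"
      using assms by (auto simp: subset_iff)
    then show ?thesis
      using False assms by (auto simp: bar_face_def dest: in_set_takeD in_set_dropD)
  qed
qed

lemma free_bar_bd_chains:
  assumes "group Q" "w \<in> tuple_chains Q m"
  shows "free_bar_bd Q w \<in> tuple_chains Q (m - 1)"
  unfolding free_bar_bd_def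
proof (rule tuple_chains_lext[OF assms(2)])
  fix xs assume "length xs = m" "set xs \<subseteq> carrier Q"
  then show "(\<Sum>i<length xs. Poly_Mapping.single (bar_face Q i xs) ((-1) ^ i)) \<in> tuple_chains Q (m - 1)"
    by (intro tuple_chains_sum tuple_chains_single length_bar_face[THEN trans] set_bar_face[OF assms(1)]) auto
qed

lemma free_bar_bd_add: "free_bar_bd Q (c + d) = free_bar_bd Q c + free_bar_bd Q d"
  by (simp add: free_bar_bd_def linext_add)

lemma free_bar_bd_diff: "free_bar_bd Q (c - d) = free_bar_bd Q c - free_bar_bd Q d"
  by (simp add: free_bar_bd_def linext_diff)

lemma free_bar_bd_uminus: "free_bar_bd Q (- c) = - free_bar_bd Q c"
  by (simp add: free_bar_bd_def linext_uminus)

lemma free_bar_bd_pscale: "free_bar_bd Q (pscale k c) = pscale k (free_bar_bd Q c)"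
  by (simp add: free_bar_bd_def linext_pscale)

lemma free_bar_bd_zero [simp]: "free_bar_bd Q 0 = 0"
  by (simp add: free_bar_bd_def)

lemma bar_face_snoc:
  assumes "group Q" "i < length xs" "set xs \<subseteq> carrier Q"
  shows "bar_face Q i (xs @ [g]) = bar_face Q i xs @ [g]"
  using assms by (auto simp: bar_face_def nth_append)

lemma bar_face_last:
  "ys \<noteq> [] \<Longrightarrow> bar_face Q (length ys) (ys @ [g]) = butlast ys @ [last ys \<otimes>\<^bsub>Q\<^esub> g]"
  by (simp add: bar_face_def nth_append butlast_conv_take last_conv_nth)

text \<open>Only the face multiplying the last two entries touches the last one, and there
  associativity suffices. On a list of length 1 the face of index 0 deletes the entry acted on,
  whence \<open>len\<close>.\<close>

lemma shift_bar_face: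
  assumes Q: "group Q" and xs: "set xs \<subseteq> carrier Q" and g: "g \<in> carrier Q"
    and len: "length xs \<ge> 2" and i: "i < length xs"
  shows "bar_face Q i (shift Q g xs) = shift Q g (bar_face Q i xs)"
proof -
  interpret group Q by fact
  obtain ys a where ya: "xs = ys @ [a]"
    using len by (cases xs rule: rev_cases) auto
  then have ys: "ys \<noteq> []" and [simp]: "a \<in> carrier Q" "set ys \<subseteq> carrier Q" 
    using len xs by auto
  then have ly: "last ys \<in> carrier Q"
    using last_in_set by blast
  show ?thesis
  proof (cases "i = length ys")
    case True
    then show ?thesis
      using ys ly g by (simp add: ya shift_def bar_face_last m_assoc)
  next
    case False
    then have "i < length ys" using i ya by simp
    then show ?thesis
      by (simp add: ya shift_def bar_face_snoc[OF Q])
  qed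
qed

lemma right_act_add_left: "right_act Q (r + s) w = right_act Q r w + right_act Q s w"
  by (simp add: right_act_def linext_add linext_fun_add)

lemma right_act_add_right: "right_act Q r (v + w) = right_act Q r v + right_act Q r w"
  by (simp add: right_act_def linext_add)

lemma right_act_zero_right [simp]: "right_act Q r 0 = 0"
  by (simp add: right_act_def)

lemma set_shift: "group Q \<Longrightarrow> xs \<noteq> [] \<Longrightarrow> set xs \<subseteq> carrier Q \<Longrightarrow> g \<in> carrier Q \<Longrightarrow> set (shift Q g xs) \<subseteq> carrier Q"
  by (auto simp: shift_def dest: in_set_butlastD intro!: monoid.m_closed[OF group.is_monoid])

lemma length_shift [simp]: "xs \<noteq> [] \<Longrightarrow> length (shift Q g xs) = length xs"
  by (simp add: shift_def)

lemma right_act_chains: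
  assumes Q: "group Q" and r: "Poly_Mapping.keys r \<subseteq> carrier Q" and w: "w \<in> tuple_chains Q m" and m: "m > 0"
  shows "right_act Q r w \<in> tuple_chains Q m"
  unfolding right_act_def
proof (rule tuple_chains_lext[OF w])
  fix xs :: "'a list" assume xs: "length xs = m" "set xs \<subseteq> carrier Q"
  then have ne: "xs \<noteq> []" using m by auto
  show "linext (\<lambda>g. basis (shift Q g xs)) r \<in> tuple_chains Q m"
    unfolding tuple_chains_def mem_Collect_eq
    by (rule keys_lextI) (use xs r ne in \<open>auto simp: dest!: set_shift[OF Q ne xs(2)]\<close>)
qed

lemma right_act_one:
  assumes Q: "group Q" and w: "w \<in> tuple_chains Q m" and m: "m > 0"
  shows "right_act Q (basis \<one>\<^bsub>Q\<^esub>) w = w"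
proof -
  interpret group Q by fact
  have "right_act Q (basis \<one>\<^bsub>Q\<^esub>) w = linext basis w"
    unfolding right_act_def
  proof (rule linext_cong_chains[OF w])
    fix xs :: "'a list" assume xs: "length xs = m" "set xs \<subseteq> carrier Q"
    then have "xs \<noteq> []" using m by auto
    with xs have "last xs \<in> carrier Q" by auto
    then show "linext (\<lambda>g. basis (shift Q g xs)) (basis \<one>\<^bsub>Q\<^esub>) = basis xs"
      using \<open>xs \<noteq> []\<close> by (simp add: shift_def)
  qed
  then show ?thesis by simp
qed

lemma rational_group_ring_mult:
  "f \<otimes>\<^bsub>rational_group_ring Q\<^esub> h = linext (\<lambda>x. linext (\<lambda>y. basis (x \<otimes>\<^bsub>Q\<^esub> y)) h) f"
  by (simp add: rational_group_ring_def linext_def pscale_sum)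

lemma shift_shift:
  assumes "group Q" "xs \<noteq> []" "set xs \<subseteq> carrier Q" "g \<in> carrier Q" "h \<in> carrier Q"
  shows "shift Q h (shift Q g xs) = shift Q (g \<otimes>\<^bsub>Q\<^esub> h) xs"
proof -
  interpret group Q by fact
  have "last xs \<in> carrier Q" using assms(2,3) by auto
  then show ?thesis
    using assms by (simp add: shift_def m_assoc)
qed

lemma right_act_mult:
  assumes Q: "group Q" and w: "w \<in> tuple_chains Q m" and m: "m > 0"
    and r: "Poly_Mapping.keys r \<subseteq> carrier Q" and s: "Poly_Mapping.keys s \<subseteq> carrier Q"
  shows "right_act Q (r \<otimes>\<^bsub>rational_group_ring Q\<^esub> s) w = right_act Q s (right_act Q r w)"
  unfolding right_act_def rational_group_ring_mult linext_linext
proof (rule linext_cong_chains[OF w], rule linext_cong)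
  fix xs :: "'a list" and g assume xs: "length xs = m" "set xs \<subseteq> carrier Q" and g: "g \<in> Poly_Mapping.keys r"
  then have "xs \<noteq> []" using m by auto
  then show "linext (\<lambda>x. linext (\<lambda>g. basis (shift Q g xs)) (basis (g \<otimes>\<^bsub>Q\<^esub> x))) s =
    linext (\<lambda>xs. linext (\<lambda>g. basis (shift Q g xs)) s) (basis (shift Q g xs))"
    using xs g r s by (auto intro!: linext_cong simp: shift_shift[OF Q] subset_iff)
qed

lemma free_bar_bd_basis: "free_bar_bd Q (basis xs) = (\<Sum>i<length xs. Poly_Mapping.single (bar_face Q i xs) ((-1) ^ i))"
  by (simp add: free_bar_bd_def)

lemma free_bar_bd_linext: "free_bar_bd Q (linext f c) = linext (\<lambda>x. free_bar_bd Q (f x)) c"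
  by (simp add: free_bar_bd_def linext_linext)

lemma right_act_linext: "right_act Q r (linext f c) = linext (\<lambda>x. right_act Q r (f x)) c"
  by (simp add: right_act_def linext_linext)

lemma free_bar_bd_eq_linext: "free_bar_bd Q w = linext (\<lambda>xs. free_bar_bd Q (basis xs)) w"
  using free_bar_bd_linext[of Q basis w] by simp

lemma right_act_sum: "right_act Q r (sum f S) = (\<Sum>i\<in>S. right_act Q r (f i))"
  by (simp add: right_act_def linext_sum)

lemma right_act_single: "right_act Q r (Poly_Mapping.single xs k) = pscale k (linext (\<lambda>g. basis (shift Q g xs)) r)"
  by (simp add: right_act_def)

lemma free_bar_bd_right_act:
  assumes Q: "group Q" and r: "Poly_Mapping.keys r \<subseteq> carrier Q" and w: "w \<in> tuple_chains Q m" and m: "m \<ge> 2"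
  shows "free_bar_bd Q (right_act Q r w) = right_act Q r (free_bar_bd Q w)"
proof -
  have "free_bar_bd Q (right_act Q r w) = linext (\<lambda>xs. linext (\<lambda>g. free_bar_bd Q (basis (shift Q g xs))) r) w"
    by (simp add: right_act_def free_bar_bd_linext)
  also have "\<dots> = linext (\<lambda>xs. right_act Q r (free_bar_bd Q (basis xs))) w"
  proof (rule linext_cong_chains[OF w])
    fix xs :: "'a list" assume xs: "length xs = m" "set xs \<subseteq> carrier Q"
    then have ne: "xs \<noteq> []" using m by auto
    have "free_bar_bd Q (basis (shift Q g xs)) =
        (\<Sum>i<length xs. pscale ((-1) ^ i) (basis (shift Q g (bar_face Q i xs))))" if "g \<in> Poly_Mapping.keys r" for g
      using that r xs m ne by (auto simp: free_bar_bd_basis shift_bar_face[OF Q] intro!: sum.cong)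
    then have "linext (\<lambda>g. free_bar_bd Q (basis (shift Q g xs))) r =
        linext (\<lambda>g. \<Sum>i<length xs. pscale ((-1) ^ i) (basis (shift Q g (bar_face Q i xs)))) r"
      by (intro linext_cong) auto
    also have "\<dots> = (\<Sum>i<length xs. pscale ((-1) ^ i) (linext (\<lambda>g. basis (shift Q g (bar_face Q i xs))) r))"
      unfolding linext_def pscale_sum by (subst sum.swap) (simp add: mult.commute)
    also have "\<dots> = right_act Q r (free_bar_bd Q (basis xs))"
      by (simp add: free_bar_bd_basis right_act_sum right_act_single)
    finally show "linext (\<lambda>g. free_bar_bd Q (basis (shift Q g xs))) r = right_act Q r (free_bar_bd Q (basis xs))" .
  qed
  also have "\<dots> = right_act Q r (free_bar_bd Q w)"
    by (simp add: free_bar_bd_eq_linext[of Q w] right_act_linext)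
  finally show ?thesis .
qed

section \<open>Contraction of the bar resolution\<close>

definition bar_cone :: "('q, 'b) monoid_scheme \<Rightarrow> ('q list \<Rightarrow>\<^sub>0 'k) \<Rightarrow> ('q list \<Rightarrow>\<^sub>0 'k::comm_ring_1)" where
  "bar_cone Q = linext (\<lambda>xs. basis (xs @ [\<one>\<^bsub>Q\<^esub>]))"

lemma bar_cone_zero [simp]: "bar_cone Q 0 = 0"
  by (simp add: bar_cone_def)

lemma bar_cone_chains:
  assumes "group Q" "w \<in> tuple_chains Q m"
  shows "bar_cone Q w \<in> tuple_chains Q (Suc m)"
  unfolding bar_cone_def using assms(1)
  by (intro tuple_chains_lext[OF assms(2)] tuple_chains_basis) (auto intro!: monoid.one_closed group.is_monoid)

text \<open>Of the m + 1 faces of \<open>xs @ [\<one>]\<close>, those of index below m leave the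
  appended unit alone and form the cone of the boundary; the last one absorbs the unit into the
  entry before it and returns \<open>xs\<close> with sign (-1) to the m.\<close>

lemma free_bar_bd_bar_cone:
  fixes w :: "'q list \<Rightarrow>\<^sub>0 'k::comm_ring_1"
  assumes Q: "group Q" and w: "w \<in> tuple_chains Q m" and m: "m > 0"
  shows "free_bar_bd Q (bar_cone Q w) = bar_cone Q (free_bar_bd Q w) + pscale ((-1) ^ m) w"
proof -
  interpret group Q by fact
  have "free_bar_bd Q (bar_cone Q w) = linext (\<lambda>xs. free_bar_bd Q (basis (xs @ [\<one>\<^bsub>Q\<^esub>]))) w"
    by (simp add: bar_cone_def free_bar_bd_linext)
  also have "\<dots> = linext (\<lambda>xs. bar_cone Q (free_bar_bd Q (basis xs)) + pscale ((-1) ^ m) (basis xs)) w"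
  proof (rule linext_cong_chains[OF w])
    fix xs :: "'q list" assume xs: "length xs = m" "set xs \<subseteq> carrier Q"
    then have ne: "xs \<noteq> []" using m by auto
    then have l: "last xs \<in> carrier Q" using xs by auto
    have "free_bar_bd Q (basis (xs @ [\<one>\<^bsub>Q\<^esub>])) =
       (\<Sum>i<length xs. Poly_Mapping.single (bar_face Q i (xs @ [\<one>\<^bsub>Q\<^esub>])) ((-1) ^ i)) +
        Poly_Mapping.single (bar_face Q (length xs) (xs @ [\<one>\<^bsub>Q\<^esub>])) ((-1::'k) ^ m)"
      using xs by (simp add: free_bar_bd_basis)
    also have "bar_face Q (length xs) (xs @ [\<one>\<^bsub>Q\<^esub>]) = xs"
      using ne l by (simp add: bar_face_last)
    also have "(\<Sum>i<length xs. Poly_Mapping.single (bar_face Q i (xs @ [\<one>\<^bsub>Q\<^esub>])) ((-1::'k) ^ i)) =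
       bar_cone Q (free_bar_bd Q (basis xs))"
      using xs by (simp add: free_bar_bd_basis bar_cone_def linext_sum bar_face_snoc[OF Q])
    finally show "free_bar_bd Q (basis (xs @ [\<one>\<^bsub>Q\<^esub>])) = bar_cone Q (free_bar_bd Q (basis xs)) + pscale ((-1::'k) ^ m) (basis xs)"
      by simp
  qed
  also have "\<dots> = bar_cone Q (free_bar_bd Q w) + pscale ((-1) ^ m) w"
    unfolding linext_fun_add linext_fun_pscale linext_basis
    by (simp add: bar_cone_def free_bar_bd_eq_linext[of Q w] linext_linext)
  finally show ?thesis .
qed

text \<open>By the homotopy formula \<open>free_bar_bd_bar_cone\<close>, \<open>\<partial>\<partial>\<close> vanishes on cones over lists of length \<open>m\<close> if it
  vanishes on lists of length \<open>m\<close>, and these cones generate the chains of length \<open>m + 1\<close> as a right module.\<close>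

lemma free_bar_bd_free_bar_bd:
  fixes w :: "'q list \<Rightarrow>\<^sub>0 'k::comm_ring_1"
  assumes Q: "group Q" and w: "w \<in> tuple_chains Q m"
  shows "free_bar_bd Q (free_bar_bd Q w) = 0"
proof -
  have basis: "free_bar_bd Q (free_bar_bd Q (basis xs)) = (0 :: 'q list \<Rightarrow>\<^sub>0 'k)" if "set xs \<subseteq> carrier Q" for xs
    using that
  proof (induction xs rule: rev_induct)
    case Nil
    then show ?case by (simp add: free_bar_bd_basis)
  next
    case (snoc h xs)
    show ?case
    proof (cases "xs = []")
      case True
      then show ?thesis by (simp add: free_bar_bd_basis bar_face_def)
    next
      case False
      interpret group Q by fact
      let ?m = "length xs"
      have m: "?m > 0" using False by simp
      have xs: "basis xs \<in> tuple_chains Q ?m" using snoc.prems by (auto intro: tuple_chains_basis)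
      have h: "Poly_Mapping.keys (basis h :: 'q \<Rightarrow>\<^sub>0 'k) \<subseteq> carrier Q" using snoc.prems by simp
      have c: "bar_cone Q (basis xs) \<in> tuple_chains Q (Suc ?m)" by (rule bar_cone_chains[OF Q xs])
      have e: "basis (xs @ [h]) = (right_act Q (basis h) (bar_cone Q (basis xs)) :: 'q list \<Rightarrow>\<^sub>0 'k)"
        using snoc.prems by (simp add: bar_cone_def right_act_def shift_def)
      have bx: "free_bar_bd Q (basis xs) \<in> tuple_chains Q (?m - 1)" by (rule free_bar_bd_chains[OF Q xs])
      have "free_bar_bd Q (free_bar_bd Q (bar_cone Q (basis xs))) = (0 :: 'q list \<Rightarrow>\<^sub>0 'k)"
      proof (cases "?m = 1")
        case True
        then obtain a where "xs = [a]" by (cases xs) auto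
        then show ?thesis
          by (simp add: bar_cone_def free_bar_bd_basis bar_face_def free_bar_bd_add free_bar_bd_pscale lessThan_Suc)
            (simp add: free_bar_bd_def linext_uminus linext_add bar_face_def single_uminus)
      next
        case False
        then have "?m - 1 > 0" using m by arith
        then have "free_bar_bd Q (bar_cone Q (free_bar_bd Q (basis xs))) = bar_cone Q (free_bar_bd Q (free_bar_bd Q (basis xs))) +
            pscale ((-1) ^ (?m - 1)) (free_bar_bd Q (basis xs) :: 'q list \<Rightarrow>\<^sub>0 'k)"
          by (rule free_bar_bd_bar_cone[OF Q bx])
        \<comment> \<open>The homotopy formula is applied in lengths \<open>?m\<close> and
          \<open>?m - 1\<close>; the two remaining copies of the boundary of \<open>xs\<close> carry
          opposite signs and cancel.\<close>
        moreover have "(-1) ^ (?m - 1) = - ((-1 :: 'k) ^ ?m)"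
          using m by (cases ?m) auto
        moreover have "free_bar_bd Q (free_bar_bd Q (basis xs)) = (0 :: 'q list \<Rightarrow>\<^sub>0 'k)"
          using snoc by simp
        ultimately show ?thesis
          by (simp add: free_bar_bd_bar_cone[OF Q xs m] free_bar_bd_add free_bar_bd_pscale pscale_uminus_left del: pscale_single)
      qed
      then have "right_act Q (basis h) (free_bar_bd Q (free_bar_bd Q (bar_cone Q (basis xs)))) = (0 :: 'q list \<Rightarrow>\<^sub>0 'k)"
        by simp
      \<comment> \<open>The action must be moved past both differentials, the second of which starts
        in length \<open>?m\<close>, so length 2 is needed there; lists of length 2 in all are
        computed by hand.\<close>
      show ?thesis
      proof (cases "?m = 1")
        case True
        then obtain a where "xs = [a]" by (cases xs) auto
        then show ?thesis
          by (simp add: free_bar_bd_basis bar_face_def free_bar_bd_add free_bar_bd_pscale lessThan_Suc)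
            (simp add: free_bar_bd_def linext_uminus linext_add bar_face_def single_uminus)
      next
        case False
        then have "?m \<ge> 2" using m by arith
        have "free_bar_bd Q (right_act Q (basis h) (bar_cone Q (basis xs))) = right_act Q (basis h) (free_bar_bd Q (bar_cone Q (basis xs) :: 'q list \<Rightarrow>\<^sub>0 'k))"
          using \<open>?m \<ge> 2\<close> by (intro free_bar_bd_right_act[OF Q h c]) auto
        moreover have "free_bar_bd Q (right_act Q (basis h) (free_bar_bd Q (bar_cone Q (basis xs)))) =
            right_act Q (basis h) (free_bar_bd Q (free_bar_bd Q (bar_cone Q (basis xs) :: 'q list \<Rightarrow>\<^sub>0 'k)))"
          using \<open>?m \<ge> 2\<close> free_bar_bd_chains[OF Q c] by (intro free_bar_bd_right_act[OF Q h]) auto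
        ultimately show ?thesis
          using \<open>right_act Q (basis h) (free_bar_bd Q (free_bar_bd Q (bar_cone Q (basis xs)))) = 0\<close> by (simp add: e)
      qed
    qed
  qed
  have "free_bar_bd Q (free_bar_bd Q w) = linext (\<lambda>xs. free_bar_bd Q (free_bar_bd Q (basis xs))) w"
    by (simp add: free_bar_bd_eq_linext[of Q w] free_bar_bd_linext)
  also have "\<dots> = linext (\<lambda>xs. 0) w"
    by (rule linext_cong_chains[OF w]) (simp add: basis)
  finally show ?thesis by simp
qed

text \<open>For a cycle the homotopy formula says that the cone has boundary w up to a sign, and the
  sign is its own inverse. For m = 1 this is exactness in degree 0, where the outgoing map is the
  augmentation.\<close>

lemma free_bar_bd_exact:
  fixes w :: "'q list \<Rightarrow>\<^sub>0 'k::comm_ring_1"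
  assumes Q: "group Q" and w: "w \<in> tuple_chains Q m" and m: "m > 0" and "free_bar_bd Q w = 0"
  shows "\<exists>v\<in>tuple_chains Q (Suc m). free_bar_bd Q v = w"
proof
  show "pscale ((-1) ^ m) (bar_cone Q w) \<in> tuple_chains Q (Suc m)"
    by (intro tuple_chains_pscale bar_cone_chains Q w)
  show "free_bar_bd Q (pscale ((-1) ^ m) (bar_cone Q w)) = w"
    using assms by (simp add: free_bar_bd_pscale free_bar_bd_bar_cone[OF Q w m] flip: power_mult_distrib)
qed

section \<open>Tensor products and flatness\<close>

lemma left_moduleD:
  assumes "left_module R M"
  shows "ring R" "abelian_group M"
    "\<And>r x. r \<in> carrier R \<Longrightarrow> x \<in> carrier M \<Longrightarrow> r \<odot>\<^bsub>M\<^esub> x \<in> carrier M"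
    "\<And>r s x. r \<in> carrier R \<Longrightarrow> s \<in> carrier R \<Longrightarrow> x \<in> carrier M \<Longrightarrow>
        (r \<oplus>\<^bsub>R\<^esub> s) \<odot>\<^bsub>M\<^esub> x = r \<odot>\<^bsub>M\<^esub> x \<oplus>\<^bsub>M\<^esub> s \<odot>\<^bsub>M\<^esub> x"
    "\<And>r x y. r \<in> carrier R \<Longrightarrow> x \<in> carrier M \<Longrightarrow> y \<in> carrier M \<Longrightarrow>
        r \<odot>\<^bsub>M\<^esub> (x \<oplus>\<^bsub>M\<^esub> y) = r \<odot>\<^bsub>M\<^esub> x \<oplus>\<^bsub>M\<^esub> r \<odot>\<^bsub>M\<^esub> y"
    "\<And>r s x. r \<in> carrier R \<Longrightarrow> s \<in> carrier R \<Longrightarrow> x \<in> carrier M \<Longrightarrow>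
        (r \<otimes>\<^bsub>R\<^esub> s) \<odot>\<^bsub>M\<^esub> x = r \<odot>\<^bsub>M\<^esub> (s \<odot>\<^bsub>M\<^esub> x)"
    "\<And>x. x \<in> carrier M \<Longrightarrow> \<one>\<^bsub>R\<^esub> \<odot>\<^bsub>M\<^esub> x = x"
  using assms by (auto simp: left_module_def)

lemma right_moduleD:
  assumes "right_module R M"
  shows "ring R" "abelian_group M"
    "\<And>r x. r \<in> carrier R \<Longrightarrow> x \<in> carrier M \<Longrightarrow> r \<odot>\<^bsub>M\<^esub> x \<in> carrier M"
    "\<And>r s x. r \<in> carrier R \<Longrightarrow> s \<in> carrier R \<Longrightarrow> x \<in> carrier M \<Longrightarrow>
        (r \<oplus>\<^bsub>R\<^esub> s) \<odot>\<^bsub>M\<^esub> x = r \<odot>\<^bsub>M\<^esub> x \<oplus>\<^bsub>M\<^esub> s \<odot>\<^bsub>M\<^esub> x"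
    "\<And>r x y. r \<in> carrier R \<Longrightarrow> x \<in> carrier M \<Longrightarrow> y \<in> carrier M \<Longrightarrow>
        r \<odot>\<^bsub>M\<^esub> (x \<oplus>\<^bsub>M\<^esub> y) = r \<odot>\<^bsub>M\<^esub> x \<oplus>\<^bsub>M\<^esub> r \<odot>\<^bsub>M\<^esub> y"
    "\<And>r s x. r \<in> carrier R \<Longrightarrow> s \<in> carrier R \<Longrightarrow> x \<in> carrier M \<Longrightarrow>
        (r \<otimes>\<^bsub>R\<^esub> s) \<odot>\<^bsub>M\<^esub> x = s \<odot>\<^bsub>M\<^esub> (r \<odot>\<^bsub>M\<^esub> x)"
    "\<And>x. x \<in> carrier M \<Longrightarrow> \<one>\<^bsub>R\<^esub> \<odot>\<^bsub>M\<^esub> x = x"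
  using assms by (auto simp: right_module_def)

lemma linear_homD:
  assumes "f \<in> linear_hom R M N"
  shows "\<And>x. x \<in> carrier M \<Longrightarrow> f x \<in> carrier N"
    "\<And>x y. x \<in> carrier M \<Longrightarrow> y \<in> carrier M \<Longrightarrow> f (x \<oplus>\<^bsub>M\<^esub> y) = f x \<oplus>\<^bsub>N\<^esub> f y"
    "\<And>r x. r \<in> carrier R \<Longrightarrow> x \<in> carrier M \<Longrightarrow> f (r \<odot>\<^bsub>M\<^esub> x) = r \<odot>\<^bsub>N\<^esub> f x"
  using assms by (auto simp: linear_hom_def hom_def Pi_iff)

lemma linear_homI:
  assumes "\<And>x. x \<in> carrier M \<Longrightarrow> f x \<in> carrier N"
    "\<And>x y. x \<in> carrier M \<Longrightarrow> y \<in> carrier M \<Longrightarrow> f (x \<oplus>\<^bsub>M\<^esub> y) = f x \<oplus>\<^bsub>N\<^esub> f y"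
    "\<And>r x. r \<in> carrier R \<Longrightarrow> x \<in> carrier M \<Longrightarrow> f (r \<odot>\<^bsub>M\<^esub> x) = r \<odot>\<^bsub>N\<^esub> f x"
  shows "f \<in> linear_hom R M N"
  using assms by (auto simp: linear_hom_def hom_def Pi_iff)

text \<open>Tensors are handled by representatives, that is integer combinations of pairs; two
  represent the same tensor when their difference lies in \<open>tensor_relations\<close>. A map of
  pairs acts on representatives through \<open>frag_map\<close>, so maps of tensors compose and
  commute as honest functions, without choices in cosets.\<close>

definition frag_map :: "('x \<Rightarrow> 'y) \<Rightarrow> ('x \<Rightarrow>\<^sub>0 int) \<Rightarrow> ('y \<Rightarrow>\<^sub>0 int)" where
  "frag_map f = frag_extend (\<lambda>x. frag_of (f x))"

lemma frag_map_0 [simp]: "frag_map f 0 = 0"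
  and frag_map_of [simp]: "frag_map f (frag_of x) = frag_of (f x)"
  and frag_map_add: "frag_map f (c + d) = frag_map f c + frag_map f d"
  and frag_map_diff: "frag_map f (c - d) = frag_map f c - frag_map f d"
  by (simp_all add: frag_map_def frag_extend_add frag_extend_diff)

lemma frag_map_sum: "frag_map f (sum g S) = (\<Sum>i\<in>S. frag_map f (g i))"
  by (induction S rule: infinite_finite_induct) (auto simp: frag_map_add)

lemma keys_frag_map: "Poly_Mapping.keys c \<subseteq> S \<Longrightarrow> (\<And>x. x \<in> S \<Longrightarrow> f x \<in> T) \<Longrightarrow> Poly_Mapping.keys (frag_map f c) \<subseteq> T"
proof
  fix y assume "Poly_Mapping.keys c \<subseteq> S" "\<And>x. x \<in> S \<Longrightarrow> f x \<in> T" "y \<in> Poly_Mapping.keys (frag_map f c)"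
  moreover from this obtain x where "x \<in> Poly_Mapping.keys c" "y = f x"
    using keys_frag_extend[of "\<lambda>x. frag_of (f x)" c] unfolding frag_map_def keys_frag_of by blast
  ultimately show "y \<in> T" by auto
qed

lemma frag_map_frag_map: "frag_map f (frag_map g c) = frag_map (\<lambda>x. f (g x)) c"
  using subset_UNIV[of "Poly_Mapping.keys c"]
  by (induction c rule: frag_induction) (auto simp: frag_map_diff)

lemma frag_map_ident: "frag_map (\<lambda>x. x) c = c"
  using subset_UNIV[of "Poly_Mapping.keys c"]
  by (induction c rule: frag_induction) (auto simp: frag_map_diff)

locale tensor_modules =
  fixes R :: "('r, 'x) ring_scheme" and A :: "('r, 'm, 'y) module_scheme" and F :: "('r, 'n, 'z) module_scheme"
  assumes right: "right_module R A" and left: "left_module R F"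
begin

sublocale A: abelian_group A
  using right by (simp add: right_module_def)

sublocale F: abelian_group F
  using left by (simp add: left_module_def)

abbreviation TR where "TR \<equiv> tensor_relations R A F"
abbreviation S where "S \<equiv> carrier A \<times> carrier F"

lemmas smultA = right_moduleD(3)[OF right]
lemmas smultF = left_moduleD(3)[OF left]

lemma TR_subgroup: "subgroup TR (free_Abelian_group S)"
proof -
  interpret G: group "free_Abelian_group S" by simp
  show ?thesis
    unfolding tensor_relations_def
    by (rule G.generate_is_subgroup)
      (auto simp: smultA smultF keys_frag_of dest!: keys_diff[THEN subsetD])
qed

lemma TR_keys: "c \<in> TR \<Longrightarrow> Poly_Mapping.keys c \<subseteq> S"
  using subsetD[OF subgroup.subset[OF TR_subgroup]] by (simp only: carrier_free_Abelian_group_iff)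

lemma TR_zero [simp]: "0 \<in> TR"
  using subgroup.one_closed[OF TR_subgroup] by simp

lemma TR_add: "c \<in> TR \<Longrightarrow> d \<in> TR \<Longrightarrow> c + d \<in> TR"
  using subgroup.m_closed[OF TR_subgroup] by simp

lemma TR_uminus: "c \<in> TR \<Longrightarrow> - c \<in> TR"
  using subgroup.m_inv_closed[OF TR_subgroup, of c] TR_keys[of c] by simp

lemma TR_diff: "c \<in> TR \<Longrightarrow> d \<in> TR \<Longrightarrow> c - d \<in> TR"
  using TR_add[of c "- d"] TR_uminus by simp

lemma TR_sum: "(\<And>i. i \<in> I \<Longrightarrow> f i \<in> TR) \<Longrightarrow> sum f I \<in> TR"
  by (induction I rule: infinite_finite_induct) (auto simp: TR_add)

lemma TR_addl:
  "a \<in> carrier A \<Longrightarrow> b \<in> carrier A \<Longrightarrow> x \<in> carrier F \<Longrightarrow>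
    frag_of (a \<oplus>\<^bsub>A\<^esub> b, x) - frag_of (a, x) - frag_of (b, x) \<in> TR"
  unfolding tensor_relations_def by (rule generate.incl) blast

lemma TR_addr:
  "a \<in> carrier A \<Longrightarrow> x \<in> carrier F \<Longrightarrow> y \<in> carrier F \<Longrightarrow>
    frag_of (a, x \<oplus>\<^bsub>F\<^esub> y) - frag_of (a, x) - frag_of (a, y) \<in> TR"
  unfolding tensor_relations_def by (rule generate.incl) blast

lemma TR_balanced:
  "r \<in> carrier R \<Longrightarrow> a \<in> carrier A \<Longrightarrow> x \<in> carrier F \<Longrightarrow>
    frag_of (r \<odot>\<^bsub>A\<^esub> a, x) - frag_of (a, r \<odot>\<^bsub>F\<^esub> x) \<in> TR"
  unfolding tensor_relations_def by (rule generate.incl) blast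

lemma TR_zerol: "x \<in> carrier F \<Longrightarrow> frag_of (\<zero>\<^bsub>A\<^esub>, x) \<in> TR"
  using TR_uminus[OF TR_addl[of "\<zero>\<^bsub>A\<^esub>" "\<zero>\<^bsub>A\<^esub>" x]] by simp

lemma TR_zeror: "a \<in> carrier A \<Longrightarrow> frag_of (a, \<zero>\<^bsub>F\<^esub>) \<in> TR"
  using TR_uminus[OF TR_addr[of a "\<zero>\<^bsub>F\<^esub>" "\<zero>\<^bsub>F\<^esub>"]] by simp

lemma TR_minusr:
  assumes "a \<in> carrier A" "x \<in> carrier F" "y \<in> carrier F"
  shows "frag_of (a, x \<ominus>\<^bsub>F\<^esub> y) - (frag_of (a, x) - frag_of (a, y)) \<in> TR"
proof -
  have "x \<ominus>\<^bsub>F\<^esub> y \<oplus>\<^bsub>F\<^esub> y = x"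
    using assms by (simp add: F.minus_eq F.a_assoc F.l_neg)
  then show ?thesis
    using TR_uminus[OF TR_addr[of a "x \<ominus>\<^bsub>F\<^esub> y" y]] assms by (simp add: algebra_simps)
qed

text \<open>The elements satisfying P form a subgroup because inverses and sums are differences: -c
  = 0 - c and c + d = c - (0 - d). This is the tool for showing that a map on representatives
  respects the relations.\<close>

lemma TR_induct [consumes 1, case_names zero diff addl addr balanced]:
  assumes "c \<in> TR" and 0: "P 0" and diff: "\<And>c d. c \<in> TR \<Longrightarrow> d \<in> TR \<Longrightarrow> P c \<Longrightarrow> P d \<Longrightarrow> P (c - d)"
    and addl: "\<And>a b x. a \<in> carrier A \<Longrightarrow> b \<in> carrier A \<Longrightarrow> x \<in> carrier F \<Longrightarrow>
      P (frag_of (a \<oplus>\<^bsub>A\<^esub> b, x) - frag_of (a, x) - frag_of (b, x))"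
    and addr: "\<And>a x y. a \<in> carrier A \<Longrightarrow> x \<in> carrier F \<Longrightarrow> y \<in> carrier F \<Longrightarrow>
      P (frag_of (a, x \<oplus>\<^bsub>F\<^esub> y) - frag_of (a, x) - frag_of (a, y))"
    and balanced: "\<And>r a x. r \<in> carrier R \<Longrightarrow> a \<in> carrier A \<Longrightarrow> x \<in> carrier F \<Longrightarrow>
      P (frag_of (r \<odot>\<^bsub>A\<^esub> a, x) - frag_of (a, r \<odot>\<^bsub>F\<^esub> x))"
  shows "P c"
proof -
  interpret G: group "free_Abelian_group S" by simp
  have "subgroup {c \<in> TR. P c} (free_Abelian_group S)"
  proof (rule G.subgroupI)
    show "{c \<in> TR. P c} \<subseteq> carrier (free_Abelian_group S)"
      using TR_keys by auto
    show "{c \<in> TR. P c} \<noteq> {}"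
    proof -
      have "0 \<in> {c \<in> TR. P c}" using 0 TR_zero by simp
      then show ?thesis by (metis empty_iff)
    qed
    show "inv\<^bsub>free_Abelian_group S\<^esub> c \<in> {c \<in> TR. P c}" if "c \<in> {c \<in> TR. P c}" for c
      using that TR_keys[of c] TR_uminus[of c] diff[of 0 c] 0 by simp
    show "c \<otimes>\<^bsub>free_Abelian_group S\<^esub> d \<in> {c \<in> TR. P c}" if "c \<in> {c \<in> TR. P c}" "d \<in> {c \<in> TR. P c}" for c d
      using that TR_add[of c d] TR_uminus[of d] diff[of 0 d] diff[of c "- d"] 0 by simp
  qed
  then have "TR \<subseteq> {c \<in> TR. P c}"
    unfolding tensor_relations_def
    by (rule G.generate_subgroup_incl[rotated])
      (use addl addr balanced TR_addl TR_addr TR_balanced in \<open>auto simp: tensor_relations_def\<close>)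
  then show ?thesis
    using assms(1) by auto
qed

end

text \<open>Linear maps on the two factors carry each of the three kinds of generating relation to
  one of the same kind. This is functoriality of the tensor product on representatives.\<close>

lemma tensor_relations_map:
  assumes "tensor_modules R A F" "tensor_modules R B F'" "f \<in> linear_hom R A B" "g \<in> linear_hom R F F'"
    and c: "c \<in> tensor_relations R A F"
  shows "frag_map (\<lambda>(a, x). (f a, g x)) c \<in> tensor_relations R B F'"
proof -
  interpret T: tensor_modules R A F by fact
  interpret U: tensor_modules R B F' by fact
  note fg = linear_homD[OF assms(3)] linear_homD[OF assms(4)]
  from c show ?thesis
    by (induction c rule: T.TR_induct)
      (auto simp: frag_map_diff fg T.smultA T.smultF intro: U.TR_diff U.TR_addl U.TR_addr U.TR_balanced)
qed

lemma linear_hom_id: "(\<lambda>x. x) \<in> linear_hom R M M"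
  by (rule linear_homI) auto

text \<open>Flatness restated for representatives: the cosets of c and of 0 have the same image, the
  zero coset, so injectivity of \<open>tensor_map\<close> identifies them.\<close>

lemma flat_module_inj:
  fixes A B :: "('r, nat \<Rightarrow> 'r) module" and R :: "('r, 'x) ring_scheme"
  assumes F: "flat_module R F" and A: "right_module R A" and B: "right_module R B"
    and f: "f \<in> linear_hom R A B" "inj_on f (carrier A)"
    and c: "Poly_Mapping.keys c \<subseteq> carrier A \<times> carrier F"
    and fc: "frag_map (\<lambda>(a, x). (f a, x)) c \<in> tensor_relations R B F"
  shows "c \<in> tensor_relations R A F"
proof -
  have left: "left_module R F"
    using F unfolding flat_module_def by (rule conjunct1)
  have inj: "inj_on (tensor_map R A B F f) (carrier (tensor R A F))"
    using F A B f unfolding flat_module_def by blast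
  interpret T: tensor_modules R A F
    using A left by unfold_locales
  interpret U: tensor_modules R B F
    using B left by unfold_locales
  let ?GA = "free_Abelian_group (carrier A \<times> carrier F)"
  let ?GB = "free_Abelian_group (carrier B \<times> carrier F)"
  interpret GA: group ?GA by simp
  interpret GB: group ?GB by simp
  have map: "frag_extend (\<lambda>(a, x). frag_of (f a, x)) = frag_map (\<lambda>(a, x). (f a, x))"
    by (simp add: frag_map_def case_prod_unfold)
  have TRmap: "frag_map (\<lambda>(a, x). (f a, x)) z \<in> U.TR" if "z \<in> T.TR" for z
    using tensor_relations_map[OF T.tensor_modules_axioms U.tensor_modules_axioms f(1) linear_hom_id that] .
  \<comment> \<open>\<open>tensor_map\<close> takes a union over all representatives of a coset.
    Each of them maps into the relations, so the union is over copies of one coset, and it is not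
    empty since z is a representative.\<close>
  have coset: "tensor_map R A B F f (T.TR #>\<^bsub>?GA\<^esub> z) = U.TR"
    if "frag_map (\<lambda>(a, x). (f a, x)) z \<in> U.TR" for z
  proof -
    have "U.TR #>\<^bsub>?GB\<^esub> frag_map (\<lambda>(a, x). (f a, x)) y = U.TR" if y: "y \<in> T.TR #>\<^bsub>?GA\<^esub> z" for y
    proof -
      obtain t where "t \<in> T.TR" "y = t + z"
        using y by (auto simp: r_coset_def)
      then have "frag_map (\<lambda>(a, x). (f a, x)) y \<in> U.TR"
        using TRmap \<open>frag_map _ z \<in> U.TR\<close> by (simp add: frag_map_add U.TR_add)
      then show ?thesis
        using U.TR_subgroup by (intro GB.coset_join2) (auto dest: U.TR_keys[THEN subsetD])
    qed
    moreover have "z \<in> T.TR #>\<^bsub>?GA\<^esub> z"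
      unfolding r_coset_def by (rule UN_I[OF T.TR_zero]) simp
    ultimately show ?thesis
      unfolding tensor_map_def map by blast
  qed
  have mem: "T.TR #>\<^bsub>?GA\<^esub> z \<in> carrier (tensor R A F)" if "Poly_Mapping.keys z \<subseteq> carrier A \<times> carrier F" for z
    using that by (auto simp: tensor_def FactGroup_def RCOSETS_def)
  have "tensor_map R A B F f (T.TR #>\<^bsub>?GA\<^esub> c) = tensor_map R A B F f (T.TR #>\<^bsub>?GA\<^esub> 0)"
    using coset[OF fc] coset[of 0] by simp
  then have "T.TR #>\<^bsub>?GA\<^esub> c = T.TR #>\<^bsub>?GA\<^esub> 0"
    by (rule inj_onD[OF inj]) (auto intro!: mem c)
  moreover have "c \<in> T.TR #>\<^bsub>?GA\<^esub> c"
    unfolding r_coset_def by (rule UN_I[OF T.TR_zero]) simp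
  ultimately show ?thesis
    by (auto simp: r_coset_def)
qed

text \<open>Transport of structure along an injection of the whole type, for which
  \<open>inv_into UNIV\<close> undoes \<iota> everywhere. It copies a test module into the universe
  over which \<open>flat_module\<close> quantifies.\<close>

definition module_image :: "('m \<Rightarrow> 'k) \<Rightarrow> ('r, 'm) module \<Rightarrow> ('r, 'k) module" where
  "module_image \<iota> M =
     \<lparr>carrier = \<iota> ` carrier M, monoid.mult = undefined, one = undefined, ring.zero = \<iota> \<zero>\<^bsub>M\<^esub>,
      ring.add = (\<lambda>u v. \<iota> (inv_into UNIV \<iota> u \<oplus>\<^bsub>M\<^esub> inv_into UNIV \<iota> v)),
      smult = (\<lambda>r u. \<iota> (r \<odot>\<^bsub>M\<^esub> inv_into UNIV \<iota> u))\<rparr>"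

lemma module_image_simps:
  assumes "inj \<iota>"
  shows "carrier (module_image \<iota> M) = \<iota> ` carrier M"
    "\<zero>\<^bsub>module_image \<iota> M\<^esub> = \<iota> \<zero>\<^bsub>M\<^esub>"
    "\<iota> x \<oplus>\<^bsub>module_image \<iota> M\<^esub> \<iota> y = \<iota> (x \<oplus>\<^bsub>M\<^esub> y)"
    "r \<odot>\<^bsub>module_image \<iota> M\<^esub> \<iota> x = \<iota> (r \<odot>\<^bsub>M\<^esub> x)"
  using assms by (simp_all add: module_image_def)

lemma right_module_image:
  assumes M: "right_module R M" and \<iota>: "inj \<iota>"
  shows "right_module R (module_image \<iota> M)"
proof -
  interpret M: abelian_group M using M by (simp add: right_module_def)
  note s = module_image_simps[OF \<iota>] right_moduleD[OF M]
  have "abelian_group (module_image \<iota> M)"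
  proof (rule abelian_groupI, goal_cases)
    case (3 x y z)
    then show ?case by (auto simp: s M.a_assoc)
  next
    case (4 x y)
    then show ?case by (auto simp: s M.a_comm)
  next
    case (6 x)
    then obtain a where "a \<in> carrier M" "x = \<iota> a" by (auto simp: s)
    then show ?case by (intro bexI[of _ "\<iota> (\<ominus>\<^bsub>M\<^esub> a)"]) (auto simp: s M.l_neg)
  qed (auto simp: s)
  then show ?thesis
    unfolding right_module_def by (auto simp: s)
qed

text \<open>The universe \<open>nat \<Rightarrow> 'r\<close> of test modules may be replaced by any type that injects into it.\<close>

lemma flat_module_submodule:
  fixes A B :: "('r, 'm) module" and \<iota> :: "'m \<Rightarrow> nat \<Rightarrow> 'r"
  assumes F: "flat_module R F" and A: "right_module R A" and B: "right_module R B"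
    and \<iota>: "inj \<iota>" and sub: "(\<lambda>x. x) \<in> linear_hom R A B"
    and c: "Poly_Mapping.keys c \<subseteq> carrier A \<times> carrier F" "c \<in> tensor_relations R B F"
  shows "c \<in> tensor_relations R A F"
proof -
  have left: "left_module R F"
    using F unfolding flat_module_def by (rule conjunct1)
  have A': "right_module R (module_image \<iota> A)" and B': "right_module R (module_image \<iota> B)"
    using A B \<iota> by (auto intro: right_module_image)
  note s = module_image_simps[OF \<iota>]
  have TA: "tensor_modules R A F" and TB: "tensor_modules R B F"
    and TA': "tensor_modules R (module_image \<iota> A) F" and TB': "tensor_modules R (module_image \<iota> B) F"
    using left A B A' B' by unfold_locales
  let ?j = "frag_map (\<lambda>(a, x). (\<iota> a, x))"
  have "?j c \<in> tensor_relations R (module_image \<iota> B) F"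
    by (rule tensor_relations_map[OF TB TB' _ linear_hom_id c(2)]) (auto intro: linear_homI simp: s)
  moreover have "(\<lambda>x. x) \<in> linear_hom R (module_image \<iota> A) (module_image \<iota> B)"
    by (rule linear_homI) (auto simp: s linear_homD[OF sub])
  moreover have "Poly_Mapping.keys (?j c) \<subseteq> carrier (module_image \<iota> A) \<times> carrier F"
    by (rule keys_frag_map[OF c(1)]) (auto simp: s)
  ultimately have "?j c \<in> tensor_relations R (module_image \<iota> A) F"
    by (intro flat_module_inj[OF F A' B']) (auto simp: frag_map_ident case_prod_unfold)
  \<comment> \<open>Back to the original modules: on the carrier of the copy the inverse of \<iota>
    is linear, and on representatives it undoes \<open>?j\<close> literally.\<close>
  then have "frag_map (\<lambda>(a, x). (inv_into UNIV \<iota> a, x)) (?j c) \<in> tensor_relations R A F"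
    by (rule tensor_relations_map[OF TA' TA _ linear_hom_id, rotated]) (auto intro!: linear_homI simp: s \<iota>)
  also have "frag_map (\<lambda>(a, x). (inv_into UNIV \<iota> a, x)) (?j c) = c"
    using \<iota> by (simp add: frag_map_frag_map case_prod_unfold frag_map_ident)
  finally show ?thesis .
qed

section \<open>The double complex\<close>

definition bar_module :: "('q, 'b) monoid_scheme \<Rightarrow> nat \<Rightarrow> ('q \<Rightarrow>\<^sub>0 rat, 'q list \<Rightarrow>\<^sub>0 rat) module" where
  "bar_module Q m = \<lparr>carrier = tuple_chains Q m, monoid.mult = undefined, one = undefined,
     ring.zero = 0, ring.add = (+), smult = right_act Q\<rparr>"

text \<open>The boundaries as a submodule of \<open>bar_module Q m\<close>. It is to this inclusion
  that flatness will be applied.\<close>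

definition boundary_module :: "('q, 'b) monoid_scheme \<Rightarrow> nat \<Rightarrow> ('q \<Rightarrow>\<^sub>0 rat, 'q list \<Rightarrow>\<^sub>0 rat) module" where
  "boundary_module Q m = (bar_module Q m)\<lparr>carrier := free_bar_bd Q ` tuple_chains Q (Suc m)\<rparr>"

lemma bar_module_simps [simp]:
  "carrier (bar_module Q m) = tuple_chains Q m" "\<zero>\<^bsub>bar_module Q m\<^esub> = 0"
  "u \<oplus>\<^bsub>bar_module Q m\<^esub> v = u + v" "r \<odot>\<^bsub>bar_module Q m\<^esub> u = right_act Q r u"
  "carrier (boundary_module Q m) = free_bar_bd Q ` tuple_chains Q (Suc m)" "\<zero>\<^bsub>boundary_module Q m\<^esub> = 0"
  "u \<oplus>\<^bsub>boundary_module Q m\<^esub> v = u + v" "r \<odot>\<^bsub>boundary_module Q m\<^esub> u = right_act Q r u"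
  by (simp_all add: bar_module_def boundary_module_def)

lemma carrier_rational_group_ring: "carrier (rational_group_ring Q) = {r. Poly_Mapping.keys r \<subseteq> carrier Q}"
  by (simp add: rational_group_ring_def)

lemma rational_group_ring_simps [simp]:
  "r \<oplus>\<^bsub>rational_group_ring Q\<^esub> s = r + s" "\<one>\<^bsub>rational_group_ring Q\<^esub> = basis \<one>\<^bsub>Q\<^esub>"
  by (simp_all add: rational_group_ring_def)

text \<open>Tensoring with the free right \<open>\<rat>Q\<close>-modules of the bar resolution: \<open>bar_module Q (p + 1)\<close> is its
  term of degree \<open>p\<close>, with rational basis the lists of length \<open>p + 1\<close>; the group acts on the last entry.\<close>

locale bar_resolution =
  fixes Q :: "('q, 'b) monoid_scheme"
  assumes group: "group Q" and ring: "ring (rational_group_ring Q)"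
begin

sublocale Q: group Q by (rule group)

abbreviation R where "R \<equiv> rational_group_ring Q"
abbreviation TR where "TR m F \<equiv> tensor_relations R (bar_module Q m) F"
abbreviation gens :: "nat \<Rightarrow> ('q \<Rightarrow>\<^sub>0 rat, 'k, 'w) module_scheme \<Rightarrow> (('q list \<Rightarrow>\<^sub>0 rat) \<times> 'k \<Rightarrow>\<^sub>0 int) set" where
    "gens m F \<equiv> {z. Poly_Mapping.keys z \<subseteq> tuple_chains Q m \<times> carrier F}"
text \<open>The two differentials of the double complex on representatives: \<open>PB\<close> lowers
  the bar degree, \<open>FM g\<close> applies a map of the flat modules. They commute exactly, see
  \<open>PB_FM\<close>, so no signs are introduced.\<close>

abbreviation PB where "PB \<equiv> frag_map (\<lambda>(w, x). (free_bar_bd Q w, x))"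
abbreviation FM where "FM g \<equiv> frag_map (\<lambda>(w, x). (w, g x))"

text \<open>Positivity of m provides the last entry on which the group ring acts.\<close>

lemma right_bar_module:
  assumes "m > 0"
  shows "right_module R (bar_module Q m)"
proof -
  have "abelian_group (bar_module Q m)"
  proof (rule abelian_groupI, goal_cases)
    case (6 x)
    then show ?case by (intro bexI[of _ "- x"]) (auto intro: tuple_chains_uminus)
  qed (auto simp: tuple_chains_add)
  then show ?thesis
    using assms ring group
    by (auto simp: right_module_def carrier_rational_group_ring right_act_add_left right_act_add_right right_act_mult right_act_one right_act_chains)
qed

lemma right_boundary_module:
  assumes "m > 0"
  shows "right_module R (boundary_module Q m)"
proof -
  have sub: "free_bar_bd Q u \<in> tuple_chains Q m" if "u \<in> tuple_chains Q (Suc m)" for u :: "'q list \<Rightarrow>\<^sub>0 rat"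
    using free_bar_bd_chains[OF group that] by simp
  have "abelian_group (boundary_module Q m)"
  proof (rule abelian_groupI, goal_cases)
    case (1 x y)
    then show ?case by (auto simp flip: free_bar_bd_add intro!: imageI tuple_chains_add)
  next
    case 2
    then show ?case using imageI[of 0 "tuple_chains Q (Suc m)" "free_bar_bd Q"] by simp
  next
    case (6 x)
    then show ?case by (intro bexI[of _ "- x"]) (auto simp flip: free_bar_bd_uminus intro!: imageI tuple_chains_uminus)
  qed (auto simp: add.assoc add.commute)
  moreover have "right_act Q r (free_bar_bd Q u) \<in> free_bar_bd Q ` tuple_chains Q (Suc m)"
    if "Poly_Mapping.keys r \<subseteq> carrier Q" "u \<in> tuple_chains Q (Suc m)" for r u
    using that assms by (subst free_bar_bd_right_act[OF group _ that(2), symmetric]) (auto intro!: imageI right_act_chains group)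
  ultimately show ?thesis
    using assms ring group sub
    by (auto simp: right_module_def carrier_rational_group_ring right_act_add_left right_act_add_right right_act_mult[of Q _ m] right_act_one[of Q _ m])
qed

lemma tensor_bar: "m > 0 \<Longrightarrow> left_module R F \<Longrightarrow> tensor_modules R (bar_module Q m) F"
  by unfold_locales (auto intro: right_bar_module)

lemma free_bar_bd_linear: "m > 0 \<Longrightarrow> free_bar_bd Q \<in> linear_hom R (bar_module Q (Suc m)) (bar_module Q m)"
  using free_bar_bd_chains[OF group, of _ "Suc m"]
  by (intro linear_homI) (auto simp: free_bar_bd_add carrier_rational_group_ring intro!: free_bar_bd_right_act[OF group, of _ _ "Suc m"])

lemma gens_diff: "c \<in> gens m F \<Longrightarrow> d \<in> gens m F \<Longrightarrow> c - d \<in> gens m F"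
  using keys_diff[of c d] by auto

lemma PB_gens: "z \<in> gens (Suc m) F \<Longrightarrow> PB z \<in> gens m F"
  using free_bar_bd_chains[OF group, of _ "Suc m"] unfolding mem_Collect_eq
  by (intro keys_frag_map[where S="tuple_chains Q (Suc m) \<times> carrier F"]) auto

lemma FM_gens: "z \<in> gens m F \<Longrightarrow> g \<in> linear_hom R F F' \<Longrightarrow> FM g z \<in> gens m F'"
  using linear_homD(1)[of g R F F'] unfolding mem_Collect_eq
  by (intro keys_frag_map[where S="tuple_chains Q m \<times> carrier F"]) auto

lemma PB_FM: "PB (FM g z) = FM g (PB z)"
  by (simp add: frag_map_frag_map case_prod_unfold)

lemma PB_TR:
  assumes "m > 0" "left_module R F" "z \<in> TR (Suc m) F"
  shows "PB z \<in> TR m F"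
  using assms by (intro tensor_relations_map[where g="\<lambda>x. x"]) (auto intro: tensor_bar free_bar_bd_linear linear_hom_id)

lemma FM_TR:
  assumes "m > 0" "left_module R F" "left_module R F'" "g \<in> linear_hom R F F'" "z \<in> TR m F"
  shows "FM g z \<in> TR m F'"
  using assms by (intro tensor_relations_map[where f="\<lambda>x. x"]) (auto intro: tensor_bar linear_hom_id)

text \<open>The composite sends a pair (w, x) to (0, x), which is a relation but not 0 in the free
  abelian group; hence a statement modulo relations only.\<close>

lemma PB_PB:
  assumes F: "left_module R F" and m: "m > 0" and z: "z \<in> gens (Suc (Suc m)) F"
  shows "PB (PB z) \<in> TR m F"
proof -
  interpret T: tensor_modules R "bar_module Q m" F by (rule tensor_bar[OF m F])
  have "Poly_Mapping.keys z \<subseteq> tuple_chains Q (Suc (Suc m)) \<times> carrier F"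
    using z by simp
  then show ?thesis
  proof (induction z rule: frag_induction)
    case (one p)
    then show ?case
      using T.TR_zerol by (auto simp: free_bar_bd_free_bar_bd[OF group])
  qed (auto simp: frag_map_diff T.TR_diff)
qed

lemma FM_FM_zero:
  assumes F: "left_module R F" "left_module R F'" and m: "m > 0" and z: "z \<in> gens m F''"
    and gf: "\<And>x. x \<in> carrier F'' \<Longrightarrow> g (f x) = \<zero>\<^bsub>F\<^esub>"
  shows "FM g (FM f z) \<in> TR m F"
proof -
  interpret T: tensor_modules R "bar_module Q m" F by (rule tensor_bar[OF m F(1)])
  have "Poly_Mapping.keys z \<subseteq> tuple_chains Q m \<times> carrier F''"
    using z by simp
  then show ?thesis
  proof (induction z rule: frag_induction)
    case (one p)
    then show ?case
      using T.TR_zeror by (auto simp: gf)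
  qed (auto simp: frag_map_diff T.TR_diff)
qed

text \<open>Let B be the module of boundaries in \<open>bar_module Q m\<close>. The bar modules of
  indices m + 2 and m + 1 followed by B form a sequence exact up to the surjection onto B, and
  tensoring keeps it so. Flatness embeds B \<otimes> F into the tensor product with the bar module
  of index m, so a tensor killed by \<open>PB\<close> is already zero in B \<otimes> F. Right
  exactness is proved by hand: a map back from B \<otimes> F to the cokernel of \<open>PB\<close> is
  built from a section of the differential.\<close>

lemma flat_exact:
  fixes \<iota> :: "('q list \<Rightarrow>\<^sub>0 rat) \<Rightarrow> nat \<Rightarrow> ('q \<Rightarrow>\<^sub>0 rat)"
  assumes \<iota>: "inj \<iota>" and F: "flat_module R F" and m: "m > 0" and z: "z \<in> gens (Suc m) F" and Bz: "PB z \<in> TR m F"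
  shows "\<exists>y\<in>gens (Suc (Suc m)) F. z - PB y \<in> TR (Suc m) F"
proof -
  have left: "left_module R F"
    using F unfolding flat_module_def by (rule conjunct1)
  interpret T: tensor_modules R "bar_module Q (Suc m)" F by (rule tensor_bar[OF _ left]) simp
  interpret U: tensor_modules R "boundary_module Q m" F
    using left right_boundary_module[OF m] by unfold_locales
  \<comment> \<open>V consists of the representatives that die in the cokernel of the incoming
    \<open>PB\<close>; the goal is that z lies in V.\<close>
  define V where "V = {c. \<exists>y\<in>gens (Suc (Suc m)) F. c - PB y \<in> TR (Suc m) F}"
  have V_diff: "c - d \<in> V" if c: "c \<in> V" and d: "d \<in> V" for c d
  proof -
    obtain y y' where "y \<in> gens (Suc (Suc m)) F" "c - PB y \<in> TR (Suc m) F"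
        "y' \<in> gens (Suc (Suc m)) F" "d - PB y' \<in> TR (Suc m) F"
      using c d unfolding V_def by blast
    then have "(c - d) - PB (y - y') \<in> TR (Suc m) F" "y - y' \<in> gens (Suc (Suc m)) F"
      using T.TR_diff[of "c - PB y" "d - PB y'"] gens_diff[of y "Suc (Suc m)" F y']
      by (auto simp: frag_map_diff algebra_simps)
    then show ?thesis unfolding V_def by blast
  qed
  have V_TR: "c \<in> V" if "c \<in> TR (Suc m) F" for c
    unfolding V_def using that by (auto intro!: exI[of _ 0])
  have V_add: "c + d \<in> V" if "c \<in> V" "d \<in> V" for c d
    using V_diff[OF that(1) V_diff[OF V_TR[OF T.TR_zero] that(2)]] by simp
  have cycle: "frag_of (w, x) \<in> V" if w: "w \<in> tuple_chains Q (Suc m)" "free_bar_bd Q w = 0" and x: "x \<in> carrier F" for w x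
  proof -
    obtain v where "v \<in> tuple_chains Q (Suc (Suc m))" "free_bar_bd Q v = w"
      using free_bar_bd_exact[OF group w(1) _ w(2)] by auto
    then show ?thesis
      unfolding V_def mem_Collect_eq by (intro bexI[of _ "frag_of (v, x)"]) (auto simp: x)
  qed
  \<comment> \<open>An arbitrary choice of preimages, in general not linear. By \<open>lin\<close>
    below, two preimages of the same boundary agree modulo V, which repairs additivity and
    compatibility with the action.\<close>
  define sec where "sec a = (SOME w. w \<in> tuple_chains Q (Suc m) \<and> free_bar_bd Q w = a)" for a :: "'q list \<Rightarrow>\<^sub>0 rat"
  have sec: "sec a \<in> tuple_chains Q (Suc m)" "free_bar_bd Q (sec a) = a" if "a \<in> free_bar_bd Q ` tuple_chains Q (Suc m)" for a
  proof -
    have "\<exists>w. w \<in> tuple_chains Q (Suc m) \<and> free_bar_bd Q w = a" using that by auto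
    from someI_ex[OF this] show "sec a \<in> tuple_chains Q (Suc m)" "free_bar_bd Q (sec a) = a"
      unfolding sec_def by auto
  qed
  have lin: "frag_of (u, x) - frag_of (v, x) \<in> V"
    if u: "u \<in> tuple_chains Q (Suc m)" and v: "v \<in> tuple_chains Q (Suc m)" and uv: "free_bar_bd Q u = free_bar_bd Q v" and x: "x \<in> carrier F" for u v x
  proof -
    have 1: "frag_of (u - v, x) \<in> V"
      using uv by (intro cycle tuple_chains_diff u v x) (simp add: free_bar_bd_diff)
    have 2: "frag_of ((u - v) + v, x) - frag_of (u - v, x) - frag_of (v, x) \<in> TR (Suc m) F"
      using T.TR_addl[of "u - v" v x] u v x by (simp add: tuple_chains_diff)
    have "(frag_of ((u - v) + v, x) - frag_of (u - v, x) - frag_of (v, x)) + frag_of (u - v, x) \<in> V"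
      by (rule V_add[OF V_TR[OF 2] 1])
    then show ?thesis by simp
  qed
  \<comment> \<open>The map from B \<otimes> F back to the cokernel; it is well defined because it
    carries relations into V.\<close>
  let ?\<psi> = "frag_map (\<lambda>(a, x). (sec a, x))"
  have \<psi>: "?\<psi> c \<in> V" if "c \<in> U.TR" for c
    using that
  proof (induction c rule: U.TR_induct)
    case zero
    show ?case using V_TR[OF T.TR_zero] by simp
  next
    case (diff c d)
    then show ?case by (simp add: frag_map_diff V_diff)
  next
    case (addl a b x)
    then have ab: "a \<in> free_bar_bd Q ` tuple_chains Q (Suc m)" "b \<in> free_bar_bd Q ` tuple_chains Q (Suc m)" "a + b \<in> free_bar_bd Q ` tuple_chains Q (Suc m)"
      using U.A.a_closed[of a b] by auto
    have 1: "frag_of (sec (a + b), x) - frag_of (sec a + sec b, x) \<in> V"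
      using ab addl by (intro lin) (auto simp: sec free_bar_bd_add tuple_chains_add)
    have 2: "frag_of (sec a + sec b, x) - frag_of (sec a, x) - frag_of (sec b, x) \<in> V"
      using T.TR_addl[of "sec a" "sec b" x] ab addl by (intro V_TR) (auto simp: sec)
    show ?case
      using V_add[OF 1 2] by (simp add: frag_map_diff frag_map_add algebra_simps)
  next
    case (addr a x y)
    then show ?case
      using V_TR[OF T.TR_addr[of "sec a" x y]] by (auto simp: frag_map_diff sec)
  next
    case (balanced r a x)
    then have a: "a \<in> free_bar_bd Q ` tuple_chains Q (Suc m)" "right_act Q r a \<in> free_bar_bd Q ` tuple_chains Q (Suc m)" and r: "Poly_Mapping.keys r \<subseteq> carrier Q"
      using U.smultA[of r a] by (auto simp: carrier_rational_group_ring)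
    have 1: "frag_of (sec (right_act Q r a), x) - frag_of (right_act Q r (sec a), x) \<in> V"
      using a balanced r m by (intro lin) (auto simp: sec right_act_chains[OF group] free_bar_bd_right_act[OF group r, of _ "Suc m"])
    have 2: "frag_of (right_act Q r (sec a), x) - frag_of (sec a, r \<odot>\<^bsub>F\<^esub> x) \<in> V"
      using T.TR_balanced[of r "sec a" x] a balanced by (intro V_TR) (auto simp: sec)
    show ?case
      using V_add[OF 1 2] by (simp add: frag_map_diff frag_map_add algebra_simps)
  qed
  \<comment> \<open>Here flatness enters: the relation among chains is already a relation among
    boundaries.\<close>
  have "PB z \<in> U.TR"
  proof (rule flat_module_submodule[OF F _ _ \<iota> _ _ Bz])
    show "right_module R (boundary_module Q m)" "right_module R (bar_module Q m)"
      using m by (auto intro: right_boundary_module right_bar_module)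
    show "(\<lambda>x. x) \<in> linear_hom R (boundary_module Q m) (bar_module Q m)"
      using free_bar_bd_chains[OF group, of _ "Suc m"] by (intro linear_homI) auto
    show "Poly_Mapping.keys (PB z) \<subseteq> carrier (boundary_module Q m) \<times> carrier F"
      using z by (intro keys_frag_map[where S="tuple_chains Q (Suc m) \<times> carrier F"]) auto
  qed
  then have 1: "?\<psi> (PB z) \<in> V" by (rule \<psi>)
  \<comment> \<open>For a single pair (w, x) the chains w and \<open>sec (free_bar_bd Q w)\<close>
    have the same boundary, so \<open>lin\<close> applies.\<close>
  have 2: "z - ?\<psi> (PB z) \<in> V"
  proof -
    have "Poly_Mapping.keys z \<subseteq> tuple_chains Q (Suc m) \<times> carrier F" using z by simp
    then show ?thesis
    proof (induction z rule: frag_induction)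
      case zero
      show ?case using V_TR[OF T.TR_zero] by simp
    next
      case (one p)
      then show ?case by (auto intro!: lin simp: sec)
    next
      case (diff a b)
      then show ?case
        using V_diff[of "a - ?\<psi> (PB a)" "b - ?\<psi> (PB b)"] by (simp add: frag_map_diff algebra_simps)
    qed
  qed
  have "z \<in> V"
    using V_add[OF 2 1] by simp
  then show ?thesis unfolding V_def by blast
qed

section \<open>Freeness of the bar modules: normal forms of tensors\<close>

definition gen :: "'q list \<Rightarrow> 'q list \<Rightarrow>\<^sub>0 rat" where
  "gen ys = basis (ys @ [\<one>\<^bsub>Q\<^esub>])"

lemma gen_chains: "length ys = m \<Longrightarrow> set ys \<subseteq> carrier Q \<Longrightarrow> gen ys \<in> tuple_chains Q (Suc m)"
  unfolding gen_def by (rule tuple_chains_basis) auto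

lemma TR_sum_left:
  assumes "m > 0" "left_module R F" "x \<in> carrier F" "\<And>i. i \<in> I \<Longrightarrow> f i \<in> tuple_chains Q m" "finite I"
  shows "frag_of (sum f I, x) - (\<Sum>i\<in>I. frag_of (f i, x)) \<in> TR m F"
proof -
  interpret T: tensor_modules R "bar_module Q m" F by (rule tensor_bar) fact+
  from assms(5,4) show ?thesis
  proof (induction I rule: finite_induct)
    case empty
    then show ?case using T.TR_zerol assms(3) by simp
  next
    case (insert i I)
    then have "frag_of (f i + sum f I, x) - frag_of (f i, x) - frag_of (sum f I, x) \<in> TR m F"
      using T.TR_addl[of "f i" "sum f I" x] assms(3) by (simp add: tuple_chains_sum)
    moreover have "frag_of (sum f I, x) - (\<Sum>i\<in>I. frag_of (f i, x)) \<in> TR m F"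
      using insert by simp
    ultimately have "(frag_of (f i + sum f I, x) - frag_of (f i, x) - frag_of (sum f I, x)) +
        (frag_of (sum f I, x) - (\<Sum>i\<in>I. frag_of (f i, x))) \<in> TR m F"
      by (rule T.TR_add)
    then show ?case
      using insert(1,2) by (simp add: algebra_simps)
  qed
qed

text \<open>The lists ending in the unit form a basis over the group ring: \<open>ys @ [h]\<close>
  is \<open>gen ys\<close> acted on by h. Moving the last entry of every list across the tensor sign
  leaves one coefficient in F for each basis element. The coefficient function is total with values
  in F, which spares side conditions outside S.\<close>

lemma normal_form:
  assumes left: "left_module R F" and z: "z \<in> gens (Suc m) F"
  shows "\<exists>S n. finite S \<and> (\<forall>ys\<in>S. length ys = m \<and> set ys \<subseteq> carrier Q) \<and> (\<forall>ys. n ys \<in> carrier F) \<and>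
    z - (\<Sum>ys\<in>S. frag_of (gen ys, n ys)) \<in> TR (Suc m) F"
proof -
  interpret T: tensor_modules R "bar_module Q (Suc m)" F by (rule tensor_bar[OF _ left]) simp
  define L where "L = {ys. length ys = m \<and> set ys \<subseteq> carrier Q}"
  define NF where "NF c \<longleftrightarrow> (\<exists>S n. finite S \<and> S \<subseteq> L \<and> (\<forall>ys. n ys \<in> carrier F) \<and>
    c - (\<Sum>ys\<in>S. frag_of (gen ys, n ys)) \<in> TR (Suc m) F)" for c
  have gL: "gen ys \<in> tuple_chains Q (Suc m)" if "ys \<in> L" for ys
    using that gen_chains by (auto simp: L_def)
  \<comment> \<open>Normal forms are subtracted on a common support. Padding with the coefficient
    zero changes nothing modulo relations, since each \<open>(gen ys, \<zero>)\<close> is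
    one.\<close>
  have enlarge: "\<exists>n'. (\<forall>ys. n' ys \<in> carrier F) \<and> c - (\<Sum>ys\<in>S'. frag_of (gen ys, n' ys)) \<in> TR (Suc m) F"
    if S: "S \<subseteq> S'" "finite S'" "S' \<subseteq> L" and n: "\<forall>ys. n ys \<in> carrier F"
      and c: "c - (\<Sum>ys\<in>S. frag_of (gen ys, n ys)) \<in> TR (Suc m) F" for c S S' n
  proof (intro exI conjI)
    let ?n = "\<lambda>ys. if ys \<in> S then n ys else \<zero>\<^bsub>F\<^esub>"
    show "\<forall>ys. ?n ys \<in> carrier F" using n by simp
    have "(\<Sum>ys\<in>S'. frag_of (gen ys, ?n ys)) = (\<Sum>ys\<in>S' - S. frag_of (gen ys, ?n ys)) + (\<Sum>ys\<in>S. frag_of (gen ys, ?n ys))"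
      by (rule sum.subset_diff) (use S in auto)
    also have "\<dots> = (\<Sum>ys\<in>S' - S. frag_of (gen ys, \<zero>\<^bsub>F\<^esub>)) + (\<Sum>ys\<in>S. frag_of (gen ys, n ys))"
      by simp
    finally have eq: "c - (\<Sum>ys\<in>S'. frag_of (gen ys, ?n ys)) =
        (c - (\<Sum>ys\<in>S. frag_of (gen ys, n ys))) - (\<Sum>ys\<in>S' - S. frag_of (gen ys, \<zero>\<^bsub>F\<^esub>))"
      by simp
    have "(\<Sum>ys\<in>S' - S. frag_of (gen ys, \<zero>\<^bsub>F\<^esub>)) \<in> TR (Suc m) F"
      using S gL by (intro T.TR_sum T.TR_zeror) auto
    with c show "c - (\<Sum>ys\<in>S'. frag_of (gen ys, ?n ys)) \<in> TR (Suc m) F"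
      unfolding eq by (rule T.TR_diff)
  qed
  have NF_diff: "NF (c - d)" if c: "NF c" and d: "NF d" for c d
  proof -
    from c d obtain S1 n1 S2 n2 where 1: "finite S1" "S1 \<subseteq> L" "\<forall>ys. n1 ys \<in> carrier F"
        "c - (\<Sum>ys\<in>S1. frag_of (gen ys, n1 ys)) \<in> TR (Suc m) F"
      and 2: "finite S2" "S2 \<subseteq> L" "\<forall>ys. n2 ys \<in> carrier F"
        "d - (\<Sum>ys\<in>S2. frag_of (gen ys, n2 ys)) \<in> TR (Suc m) F"
      unfolding NF_def by blast
    let ?S = "S1 \<union> S2"
    obtain k1 where k1: "\<forall>ys. k1 ys \<in> carrier F" "c - (\<Sum>ys\<in>?S. frag_of (gen ys, k1 ys)) \<in> TR (Suc m) F"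
      using enlarge[OF _ _ _ 1(3,4), of ?S] 1 2 by auto
    obtain k2 where k2: "\<forall>ys. k2 ys \<in> carrier F" "d - (\<Sum>ys\<in>?S. frag_of (gen ys, k2 ys)) \<in> TR (Suc m) F"
      using enlarge[OF _ _ _ 2(3,4), of ?S] 1 2 by auto
    have "(\<Sum>ys\<in>?S. frag_of (gen ys, k1 ys \<ominus>\<^bsub>F\<^esub> k2 ys) - (frag_of (gen ys, k1 ys) - frag_of (gen ys, k2 ys))) \<in> TR (Suc m) F"
      using k1(1) k2(1) 1 2 gL by (intro T.TR_sum T.TR_minusr) auto
    then have "(c - (\<Sum>ys\<in>?S. frag_of (gen ys, k1 ys))) - (d - (\<Sum>ys\<in>?S. frag_of (gen ys, k2 ys))) -
        (\<Sum>ys\<in>?S. frag_of (gen ys, k1 ys \<ominus>\<^bsub>F\<^esub> k2 ys) - (frag_of (gen ys, k1 ys) - frag_of (gen ys, k2 ys))) \<in> TR (Suc m) F"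
      by (intro T.TR_diff k1(2) k2(2))
    then have "(c - d) - (\<Sum>ys\<in>?S. frag_of (gen ys, k1 ys \<ominus>\<^bsub>F\<^esub> k2 ys)) \<in> TR (Suc m) F"
      by (simp add: sum_subtractf sum.distrib algebra_simps)
    then show ?thesis
      unfolding NF_def using 1 2 k1(1) k2(1) by (intro exI[of _ ?S] exI[of _ "\<lambda>ys. k1 ys \<ominus>\<^bsub>F\<^esub> k2 ys"]) auto
  qed
  have NF_TR: "NF c" if "c \<in> TR (Suc m) F" for c
    unfolding NF_def using that by (intro exI[of _ "{}"] exI[of _ "\<lambda>_. \<zero>\<^bsub>F\<^esub>"]) auto
  have NF_add: "NF (c + d)" if "NF c" "NF d" for c d
    using NF_diff[OF that(1) NF_diff[OF NF_TR[OF T.TR_zero] that(2)]] by simp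
  have NF_sum: "NF (sum f I)" if "\<And>i. i \<in> I \<Longrightarrow> NF (f i)" for f and I :: "'q list set"
    using that by (induction I rule: infinite_finite_induct) (auto intro: NF_add NF_TR)
  have NF_single: "NF (frag_of (Poly_Mapping.single xs k, x))"
    if xs: "length xs = Suc m" "set xs \<subseteq> carrier Q" and x: "x \<in> carrier F" for xs k x
  proof -
    obtain ys h where ys: "xs = ys @ [h]" using xs(1) by (cases xs rule: rev_cases) auto
    then have L: "ys \<in> L" and h: "h \<in> carrier Q" using xs by (auto simp: L_def)
    have r: "Poly_Mapping.single h k \<in> carrier R"
      using h by (auto simp: carrier_rational_group_ring)
    \<comment> \<open>The balancing relation for the monomial k h, which carries
      \<open>gen ys\<close> to the given multiple of \<open>xs\<close>.\<close>
    have "frag_of (right_act Q (Poly_Mapping.single h k) (gen ys), x) - frag_of (gen ys, Poly_Mapping.single h k \<odot>\<^bsub>F\<^esub> x) \<in> TR (Suc m) F"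
      using T.TR_balanced[OF r, of "gen ys" x] gL[OF L] x by simp
    also have "right_act Q (Poly_Mapping.single h k) (gen ys) = Poly_Mapping.single xs k"
      using h by (simp add: gen_def right_act_def shift_def ys)
    finally show ?thesis
      unfolding NF_def using L x
      by (intro exI[of _ "{ys}"] exI[of _ "\<lambda>_. Poly_Mapping.single h k \<odot>\<^bsub>F\<^esub> x"]) (auto intro: T.smultF r)
  qed
  have "NF z"
    using z unfolding mem_Collect_eq
  proof (induction z rule: frag_induction)
    case zero
    show ?case by (rule NF_TR) simp
  next
    case (diff a b)
    then show ?case by (intro NF_diff)
  next
    case (one p)
    then obtain w x where p: "p = (w, x)" "w \<in> tuple_chains Q (Suc m)" "x \<in> carrier F" by auto
    let ?f = "\<lambda>xs. Poly_Mapping.single xs (Poly_Mapping.lookup w xs)"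
    have "(\<Sum>xs\<in>Poly_Mapping.keys w. ?f xs) = w"
      using linext_basis[of w] unfolding linext_def by simp
    then have w: "w = (\<Sum>xs\<in>Poly_Mapping.keys w. ?f xs)" by (rule sym)
    have f: "?f xs \<in> tuple_chains Q (Suc m)" if "xs \<in> Poly_Mapping.keys w" for xs
      using that p(2) by (intro tuple_chains_single) (auto simp: tuple_chains_def)
    have "frag_of (sum ?f (Poly_Mapping.keys w), x) - (\<Sum>xs\<in>Poly_Mapping.keys w. frag_of (?f xs, x)) \<in> TR (Suc m) F"
      by (rule TR_sum_left) (use left p f in auto)
    moreover have "NF (\<Sum>xs\<in>Poly_Mapping.keys w. frag_of (?f xs, x))"
      using p by (intro NF_sum NF_single) (auto simp: tuple_chains_def)
    ultimately have "NF ((frag_of (w, x) - (\<Sum>xs\<in>Poly_Mapping.keys w. frag_of (?f xs, x))) +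
        (\<Sum>xs\<in>Poly_Mapping.keys w. frag_of (?f xs, x)))"
      unfolding w[symmetric] by (rule NF_add[OF NF_TR])
    then show ?case by (simp add: p(1))
  qed
  then obtain S n where "finite S" "S \<subseteq> L" "\<forall>ys. n ys \<in> carrier F" "z - (\<Sum>ys\<in>S. frag_of (gen ys, n ys)) \<in> TR (Suc m) F"
    unfolding NF_def by (elim exE conjE) (rule that)
  then show ?thesis
    by (intro exI[of _ S] exI[of _ n] conjI) (auto simp: L_def)
qed

text \<open>The coordinate of a chain at the basis element \<open>gen ys\<close>: among the lists
  that begin with \<open>ys\<close>, the last entries are read off as an element of the group
  ring.\<close>

definition coord :: "'q list \<Rightarrow> ('q list \<Rightarrow>\<^sub>0 rat) \<Rightarrow> ('q \<Rightarrow>\<^sub>0 rat)" where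
  "coord ys = linext (\<lambda>xs. if butlast xs = ys then basis (last xs) else 0)"

lemma coord_closed:
  assumes "w \<in> tuple_chains Q (Suc m)"
  shows "coord ys w \<in> carrier R"
  unfolding coord_def carrier_rational_group_ring
proof (intro CollectI subsetI)
  fix g assume "g \<in> Poly_Mapping.keys (linext (\<lambda>xs. if butlast xs = ys then basis (last xs) else 0) w)"
  then obtain xs where "xs \<in> Poly_Mapping.keys w" "g \<in> Poly_Mapping.keys (if butlast xs = ys then basis (last xs) else (0 :: 'q \<Rightarrow>\<^sub>0 rat))"
    using keys_linext by fastforce
  moreover from this have "xs \<noteq> []" "set xs \<subseteq> carrier Q"
    using assms by (auto simp: tuple_chains_def)
  ultimately show "g \<in> carrier Q"
    by (auto split: if_splits)
qed

lemma coord_right_act: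
  assumes "w \<in> tuple_chains Q (Suc m)"
  shows "coord ys (right_act Q r w) = coord ys w \<otimes>\<^bsub>R\<^esub> r"
  unfolding coord_def right_act_def rational_group_ring_mult linext_linext
proof (rule linext_cong_chains[OF assms])
  fix xs :: "'q list" assume "length xs = Suc m"
  then show "linext (\<lambda>x. linext (\<lambda>xs. if butlast xs = ys then basis (last xs) else 0) (basis (shift Q x xs))) r =
    linext (\<lambda>x. linext (\<lambda>y. basis (x \<otimes>\<^bsub>Q\<^esub> y)) r) (if butlast xs = ys then basis (last xs) else 0)"
    by (auto simp: shift_def)
qed

lemma coord_gen: "coord ys (gen ys') = (if ys' = ys then \<one>\<^bsub>R\<^esub> else 0)"
  by (simp add: coord_def gen_def)

text \<open>Uniqueness of normal forms. The assignment of \<open>coord ys0 w\<close> times x to the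
  pair (w, x) is additive in both arguments and balanced, hence defined on tensors, and it reads off
  the coefficient at \<open>ys0\<close>.\<close>

lemma normal_form_zero:
  assumes left: "left_module R F" and S: "finite S" "\<And>ys. ys \<in> S \<Longrightarrow> length ys = m \<and> set ys \<subseteq> carrier Q"
    and n: "\<And>ys. n ys \<in> carrier F"
    and TR: "(\<Sum>ys\<in>S. frag_of (gen ys, n ys)) \<in> TR (Suc m) F" and ys: "ys0 \<in> S"
  shows "n ys0 = \<zero>\<^bsub>F\<^esub>"
proof -
  interpret T: tensor_modules R "bar_module Q (Suc m)" F by (rule tensor_bar[OF _ left]) simp
  let ?S = "tuple_chains Q (Suc m) \<times> carrier F"
  let ?f = "\<lambda>(w, x). coord ys0 w \<odot>\<^bsub>F\<^esub> x"
  have f: "?f ` ?S \<subseteq> carrier F"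
    using T.smultF coord_closed by auto
  \<comment> \<open>The universal property of the free abelian group extends \<open>?f\<close> to
    representatives; \<open>kill\<close> then shows that the extension vanishes on
    relations.\<close>
  obtain h where h: "h \<in> hom (free_Abelian_group ?S) (add_monoid F)" "\<And>p. p \<in> ?S \<Longrightarrow> h (frag_of p) = ?f p"
    using comm_group.free_Abelian_group_universal[OF T.F.a_comm_group, of ?f ?S] f by auto
  interpret h: group_hom "free_Abelian_group ?S" "add_monoid F" h
    by (intro group_hom.intro group_free_Abelian_group T.F.a_group group_hom_axioms.intro h(1))
  have h_closed: "h c \<in> carrier F" if "Poly_Mapping.keys c \<subseteq> ?S" for c
    using h.hom_closed[of c] that by simp
  have h_add: "h (c + d) = h c \<oplus>\<^bsub>F\<^esub> h d" if "Poly_Mapping.keys c \<subseteq> ?S" "Poly_Mapping.keys d \<subseteq> ?S" for c d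
    using h.hom_mult[of c d] that by simp
  have h_zero: "h 0 = \<zero>\<^bsub>F\<^esub>"
    using h.hom_one by simp
  have h_diff: "h (c - d) = \<zero>\<^bsub>F\<^esub>" if "Poly_Mapping.keys c \<subseteq> ?S" "Poly_Mapping.keys d \<subseteq> ?S" "h c = h d" for c d
  proof -
    have "Poly_Mapping.keys (c - d) \<subseteq> ?S" using that keys_diff[of c d] by auto
    then have "h (c - d) \<oplus>\<^bsub>F\<^esub> h d = \<zero>\<^bsub>F\<^esub> \<oplus>\<^bsub>F\<^esub> h d" "h (c - d) \<in> carrier F"
      using h_add[of "c - d" d] that h_closed by simp_all
    then show ?thesis
      using T.F.add.right_cancel[of "h d" "h (c - d)" "\<zero>\<^bsub>F\<^esub>"] h_closed[OF that(2)] by blast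
  qed
  have c_add: "coord ys0 (a + b) = coord ys0 a + coord ys0 b" for a b
    by (simp add: coord_def linext_add)
  have kill: "h c = \<zero>\<^bsub>F\<^esub>" if "c \<in> TR (Suc m) F" for c
    using that
  proof (induction c rule: T.TR_induct)
    case zero
    show ?case by (rule h_zero)
  next
    case (diff c d)
    then show ?case using T.TR_keys[of c] T.TR_keys[of d] by (intro h_diff) auto
  next
    case (addl a b x)
    have "h (frag_of (a + b, x)) = h (frag_of (a, x) + frag_of (b, x))"
      using addl left_moduleD(4)[OF left coord_closed[of a m] coord_closed[of b m]]
      by (subst h_add) (auto simp: h(2) c_add tuple_chains_add)
    then have "h (frag_of (a + b, x) - (frag_of (a, x) + frag_of (b, x))) = \<zero>\<^bsub>F\<^esub>"
      using addl keys_add[of "frag_of (a, x)" "frag_of (b, x)"] by (intro h_diff) (auto simp: tuple_chains_add)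
    then show ?case by (simp add: algebra_simps)
  next
    case (addr a x y)
    have "h (frag_of (a, x \<oplus>\<^bsub>F\<^esub> y)) = h (frag_of (a, x) + frag_of (a, y))"
      using addr left_moduleD(5)[OF left coord_closed[of a m]]
      by (subst h_add) (auto simp: h(2))
    then have "h (frag_of (a, x \<oplus>\<^bsub>F\<^esub> y) - (frag_of (a, x) + frag_of (a, y))) = \<zero>\<^bsub>F\<^esub>"
      using addr keys_add[of "frag_of (a, x)" "frag_of (a, y)"] by (intro h_diff) auto
    then show ?case by (simp add: algebra_simps)
  next
    case (balanced r a x)
    then have "right_act Q r a \<in> tuple_chains Q (Suc m)"
      using T.smultA[of r a] by simp
    then show ?case
      using balanced left_moduleD(6)[OF left coord_closed[of a m]]
      by (intro h_diff) (auto simp: h(2) coord_right_act T.smultF)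
  qed
  have eval: "h (\<Sum>ys\<in>S'. frag_of (gen ys, n ys)) = (if ys0 \<in> S' then n ys0 else \<zero>\<^bsub>F\<^esub>)" if "finite S'" "S' \<subseteq> S" for S'
    using that
  proof (induction S' rule: finite_induct)
    case empty
    then show ?case by (simp add: h_zero)
  next
    case (insert ys S')
    have zero: "(0 :: 'q \<Rightarrow>\<^sub>0 rat) \<odot>\<^bsub>F\<^esub> x = \<zero>\<^bsub>F\<^esub>" if "x \<in> carrier F" for x
    proof -
      have "0 \<in> carrier R" by (simp add: carrier_rational_group_ring)
      then have "(0 :: 'q \<Rightarrow>\<^sub>0 rat) \<odot>\<^bsub>F\<^esub> x \<oplus>\<^bsub>F\<^esub> 0 \<odot>\<^bsub>F\<^esub> x = \<zero>\<^bsub>F\<^esub> \<oplus>\<^bsub>F\<^esub> 0 \<odot>\<^bsub>F\<^esub> x"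
          "(0 :: 'q \<Rightarrow>\<^sub>0 rat) \<odot>\<^bsub>F\<^esub> x \<in> carrier F"
        using left_moduleD(4)[OF left, of 0 0 x] that T.smultF[of 0 x] by simp_all
      then show ?thesis
        using T.F.add.right_cancel[of "0 \<odot>\<^bsub>F\<^esub> x" "0 \<odot>\<^bsub>F\<^esub> x" "\<zero>\<^bsub>F\<^esub>"] by blast
    qed
    have g: "gen ys \<in> tuple_chains Q (Suc m)" if "ys \<in> S" for ys using S(2)[OF that] gen_chains by auto
    have "Poly_Mapping.keys (\<Sum>ys\<in>S'. frag_of (gen ys, n ys)) \<subseteq> ?S"
      using insert g n by (auto elim!: keys_sumE)
    then have "h (\<Sum>ys\<in>insert ys S'. frag_of (gen ys, n ys)) = (coord ys0 (gen ys) \<odot>\<^bsub>F\<^esub> n ys) \<oplus>\<^bsub>F\<^esub> h (\<Sum>ys\<in>S'. frag_of (gen ys, n ys))"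
      using insert g n by (simp add: h_add h(2))
    also have "h (\<Sum>ys\<in>S'. frag_of (gen ys, n ys)) = (if ys0 \<in> S' then n ys0 else \<zero>\<^bsub>F\<^esub>)"
      using insert by simp
    finally show ?case
      using insert(2) n left_moduleD(7)[OF left] zero by (auto simp: coord_gen)
  qed
  show ?thesis
    using eval[OF S(1)] kill[OF TR] ys by simp
qed

text \<open>By freeness exactness can be checked coefficientwise: in normal form every coefficient
  of z lies in the kernel of g, so each lifts through f separately.\<close>

lemma free_exact:
  assumes F: "left_module R F1" "left_module R F" "left_module R F'"
    and f: "f \<in> linear_hom R F1 F" and g: "g \<in> linear_hom R F F'" and ker: "a_kernel F F' g = f ` carrier F1"
    and z: "z \<in> gens (Suc m) F" and gz: "FM g z \<in> TR (Suc m) F'"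
  shows "\<exists>y\<in>gens (Suc m) F1. z - FM f y \<in> TR (Suc m) F"
proof -
  interpret T: tensor_modules R "bar_module Q (Suc m)" F' by (rule tensor_bar[OF _ F(3)]) simp
  obtain S n where S: "finite S" "\<And>ys. ys \<in> S \<Longrightarrow> length ys = m \<and> set ys \<subseteq> carrier Q" and n: "\<And>ys. n ys \<in> carrier F"
    and zn: "z - (\<Sum>ys\<in>S. frag_of (gen ys, n ys)) \<in> TR (Suc m) F"
    using normal_form[OF F(2) z] by blast
  have "FM g (z - (\<Sum>ys\<in>S. frag_of (gen ys, n ys))) \<in> TR (Suc m) F'"
    by (rule FM_TR[OF _ F(2,3) g zn]) simp
  then have "FM g z - (\<Sum>ys\<in>S. frag_of (gen ys, g (n ys))) \<in> TR (Suc m) F'"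
    by (simp add: frag_map_diff frag_map_sum)
  from T.TR_diff[OF gz this] have "(\<Sum>ys\<in>S. frag_of (gen ys, g (n ys))) \<in> TR (Suc m) F'"
    by simp
  then have "g (n ys) = \<zero>\<^bsub>F'\<^esub>" if "ys \<in> S" for ys
    using normal_form_zero[OF F(3) S, of "\<lambda>ys. g (n ys)"] linear_homD(1)[OF g n] that by blast
  then have "\<forall>ys\<in>S. \<exists>y\<in>carrier F1. n ys = f y"
    using ker n unfolding a_kernel_def' by blast
  then obtain y where y: "\<And>ys. ys \<in> S \<Longrightarrow> y ys \<in> carrier F1 \<and> n ys = f (y ys)"
    by metis
  have "(\<Sum>ys\<in>S. frag_of (gen ys, n ys)) = FM f (\<Sum>ys\<in>S. frag_of (gen ys, y ys))"
    using y by (simp add: frag_map_sum)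
  with zn have zy: "z - FM f (\<Sum>ys\<in>S. frag_of (gen ys, y ys)) \<in> TR (Suc m) F"
    by simp
  have "gen ys \<in> tuple_chains Q (Suc m)" if "ys \<in> S" for ys
    using S(2)[OF that] by (intro gen_chains) auto
  then have "(\<Sum>ys\<in>S. frag_of (gen ys, y ys)) \<in> gens (Suc m) F1"
    using y by (auto elim!: keys_sumE)
  with zy show ?thesis
    by (rule bexI)
qed

text \<open>Dimension shifting: with the bar module of index p + 1 in degree p, the claim is that
  the p-th Tor of the cokernel of \<open>\<delta> q\<close> vanishes for p + q > N. A chain whose
  boundary lies in the image of \<delta> is, modulo that image, a boundary. The number j counts the
  steps from q up to N + 1, and each step lowers p by one, whence j \<le> p. In degree p = 0 every
  element counts as a cycle, so nothing is asked there.\<close>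

lemma exactness_propagates:
  fixes \<iota> :: "('q list \<Rightarrow>\<^sub>0 rat) \<Rightarrow> nat \<Rightarrow> ('q \<Rightarrow>\<^sub>0 rat)"
    and F :: "nat \<Rightarrow> ('q \<Rightarrow>\<^sub>0 rat, nat \<Rightarrow> 'q \<Rightarrow>\<^sub>0 rat) module"
  assumes \<iota>: "inj \<iota>" and F: "\<And>q. flat_module R (F q)" and zero: "\<And>q. q > N \<Longrightarrow> carrier (F q) = {\<zero>\<^bsub>F q\<^esub>}"
    and \<delta>: "\<And>q. \<delta> q \<in> linear_hom R (F (Suc q)) (F q)"
    and ker: "\<And>q. a_kernel (F (Suc q)) (F q) (\<delta> q) = \<delta> (Suc q) ` carrier (F (Suc (Suc q)))"
  shows "q + j = Suc N \<Longrightarrow> j \<le> p \<Longrightarrow> z \<in> gens (Suc p) (F q) \<Longrightarrow>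
    (p > 0 \<Longrightarrow> \<exists>y\<in>gens p (F (Suc q)). PB z - FM (\<delta> q) y \<in> TR p (F q)) \<Longrightarrow>
    \<exists>y\<in>gens (Suc p) (F (Suc q)). \<exists>d\<in>gens (Suc (Suc p)) (F q). z - FM (\<delta> q) y - PB d \<in> TR (Suc p) (F q)"
proof (induction j arbitrary: p q z)
  case 0
  have left: "left_module R (F q)"
    using F[of q] unfolding flat_module_def by (rule conjunct1)
  interpret T: tensor_modules R "bar_module Q (Suc p)" "F q" by (rule tensor_bar[OF _ left]) simp
  have "Poly_Mapping.keys z \<subseteq> tuple_chains Q (Suc p) \<times> carrier (F q)"
    using 0 by simp
  \<comment> \<open>At q = N + 1 the module F q is zero, so every pair is of the form (w,
    0).\<close>
  then have "z \<in> TR (Suc p) (F q)"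
  proof (induction z rule: frag_induction)
    case (one x)
    then show ?case using zero[of q] 0(1) T.TR_zeror by auto
  qed (auto intro: T.TR_diff)
  then show ?case
    by (intro bexI[of _ 0]) auto
next
  case (Suc j)
  have left: "left_module R (F q)" for q
    using F[of q] unfolding flat_module_def by (rule conjunct1)
  obtain p' where p: "p = Suc p'" using Suc.prems(2) by (cases p) auto
  interpret T: tensor_modules R "bar_module Q p" "F q" by (rule tensor_bar[OF _ left]) (simp add: p)
  interpret U: tensor_modules R "bar_module Q (Suc p)" "F q" by (rule tensor_bar[OF _ left]) simp
  have z: "z \<in> gens (Suc p) (F q)" by (rule Suc.prems(3))
  obtain y' where y': "y' \<in> gens p (F (Suc q))" and n: "PB z - FM (\<delta> q) y' \<in> TR p (F q)"
    using Suc.prems(4) p by auto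
  \<comment> \<open>The induction hypothesis is applied to the element y' witnessing the hypothesis
    on z, one bar degree lower and one place further along the resolution. Its own cycle condition
    follows by applying \<open>PB\<close> to that hypothesis and using exactness along the
    resolution.\<close>
  have "\<exists>y\<in>gens (Suc p') (F (Suc (Suc q))). \<exists>d\<in>gens (Suc (Suc p')) (F (Suc q)).
     y' - FM (\<delta> (Suc q)) y - PB d \<in> TR (Suc p') (F (Suc q))"
  proof (rule Suc.IH)
    show "Suc q + j = Suc N" "j \<le> p'" using Suc.prems(1,2) p by auto
    show "y' \<in> gens (Suc p') (F (Suc q))" using y' p by simp
    show "\<exists>y\<in>gens p' (F (Suc (Suc q))). PB y' - FM (\<delta> (Suc q)) y \<in> TR p' (F (Suc q))" if pos: "p' > 0"
    proof -
      obtain p'' where p': "p' = Suc p''" using pos by (cases p') auto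
      interpret V: tensor_modules R "bar_module Q p'" "F q" by (rule tensor_bar[OF pos left])
      have "PB (PB z) \<in> TR p' (F q)"
        by (rule PB_PB[OF left pos]) (use z p in simp)
      moreover have "PB (PB z - FM (\<delta> q) y') \<in> TR p' (F q)"
        by (rule PB_TR[OF pos left]) (use n p in simp)
      ultimately have "PB (PB z) - PB (PB z - FM (\<delta> q) y') \<in> TR p' (F q)"
        by (rule V.TR_diff)
      then have "FM (\<delta> q) (PB y') \<in> TR p' (F q)"
        by (simp add: frag_map_diff flip: PB_FM)
      moreover have "PB y' \<in> gens p' (F (Suc q))"
        by (rule PB_gens) (use y' p in simp)
      ultimately show ?thesis
        unfolding p' by (intro free_exact[OF left left left \<delta> \<delta> ker])
    qed
  qed
  then obtain y'' d' where y'': "y'' \<in> gens p (F (Suc (Suc q)))" and d': "d' \<in> gens (Suc p) (F (Suc q))"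
    and n': "y' - FM (\<delta> (Suc q)) y'' - PB d' \<in> TR p (F (Suc q))"
    unfolding p by blast
  have "FM (\<delta> q) (y' - FM (\<delta> (Suc q)) y'' - PB d') \<in> TR p (F q)"
    by (rule FM_TR[OF _ left left \<delta> n']) (simp add: p)
  \<comment> \<open>Modulo relations the boundary of z is the \<delta>-image of
    \<open>FM (\<delta> (Suc q)) y'' + PB d'\<close>. The first summand disappears because \<delta>
    squares to zero, and the second commutes past \<delta>; thus z minus the \<delta>-image of d'
    becomes a cycle for \<open>PB\<close>, to which \<open>flat_exact\<close> applies.\<close>
  then have "(PB z - FM (\<delta> q) y') + FM (\<delta> q) (y' - FM (\<delta> (Suc q)) y'' - PB d') \<in> TR p (F q)"
    by (rule T.TR_add[OF n])
  moreover have "FM (\<delta> q) (FM (\<delta> (Suc q)) y'') \<in> TR p (F q)"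
  proof (rule FM_FM_zero[OF left left _ y''])
    show "p > 0" by (simp add: p)
    fix x assume "x \<in> carrier (F (Suc (Suc q)))"
    then have "\<delta> (Suc q) x \<in> a_kernel (F (Suc q)) (F q) (\<delta> q)"
      unfolding ker by (rule imageI)
    then show "\<delta> q (\<delta> (Suc q) x) = \<zero>\<^bsub>F q\<^esub>"
      by (simp add: a_kernel_def')
  qed
  ultimately have "((PB z - FM (\<delta> q) y') + FM (\<delta> q) (y' - FM (\<delta> (Suc q)) y'' - PB d')) +
      FM (\<delta> q) (FM (\<delta> (Suc q)) y'') \<in> TR p (F q)"
    by (rule T.TR_add)
  then have "PB (z - FM (\<delta> q) d') \<in> TR p (F q)"
    by (simp add: frag_map_diff PB_FM)
  moreover have "z - FM (\<delta> q) d' \<in> gens (Suc p) (F q)"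
    by (intro gens_diff z FM_gens[OF d' \<delta>])
  ultimately obtain d where "d \<in> gens (Suc (Suc p)) (F q)" "z - FM (\<delta> q) d' - PB d \<in> TR (Suc p) (F q)"
    using flat_exact[OF \<iota> F, of p "z - FM (\<delta> q) d'" q] p by auto
  then show ?case
    using d' by blast
qed

section \<open>From the double complex to the rational bar complex\<close>

definition collapse :: "('q list \<Rightarrow>\<^sub>0 rat) \<Rightarrow> ('q list \<Rightarrow>\<^sub>0 rat)" where
  "collapse = linext (\<lambda>xs. basis (butlast xs))"

text \<open>The map induced by e from tensors with F 0 to tensors with the trivial module \<rat>,
  the latter identified with bar chains: tensoring with \<rat> forgets the entry that carries the
  group action.\<close>

definition augment :: "('k \<Rightarrow> rat) \<Rightarrow> (('q list \<Rightarrow>\<^sub>0 rat) \<times> 'k \<Rightarrow>\<^sub>0 int) \<Rightarrow> ('q list \<Rightarrow>\<^sub>0 rat)" where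
  "augment e c = (\<Sum>p\<in>Poly_Mapping.keys c. pscale (of_int (Poly_Mapping.lookup c p) * e (snd p)) (collapse (fst p)))"

lemma augment_0 [simp]: "augment e 0 = 0"
  by (simp add: augment_def)

lemma augment_of [simp]: "augment e (frag_of (w, x)) = pscale (e x) (collapse w)"
  by (simp add: augment_def)

lemma augment_add: "augment e (c + d) = augment e c + augment e d"
  unfolding augment_def
  by (rule setsum_keys_plus_distrib) (simp_all add: distrib_right pscale_add_left)

lemma augment_diff: "augment e (c - d) = augment e c - augment e d"
  using augment_add[of e "c - d" d] by simp

lemma augment_sum: "augment e (sum f I) = (\<Sum>i\<in>I. augment e (f i))"
  by (induction I rule: infinite_finite_induct) (auto simp: augment_add)

lemma sum_single: "(\<Sum>i\<in>I. Poly_Mapping.single x (f i)) = Poly_Mapping.single x (sum f I)"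
  by (induction I rule: infinite_finite_induct) (auto simp: single_add)

text \<open>Acting changes only the entry that \<open>collapse\<close> deletes, so each group
  element acts as 1 and r through its coefficient sum, exactly as on the trivial module.\<close>

lemma collapse_right_act:
  assumes "w \<in> tuple_chains Q (Suc m)"
  shows "collapse (right_act Q r w) = pscale (\<Sum>x\<in>Poly_Mapping.keys r. Poly_Mapping.lookup r x) (collapse w)"
proof -
  have "collapse (right_act Q r w) = linext (\<lambda>xs. linext (\<lambda>g. basis (butlast xs)) r) w"
    by (simp add: collapse_def right_act_def linext_linext shift_def)
  also have "\<dots> = linext (\<lambda>xs. pscale (\<Sum>x\<in>Poly_Mapping.keys r. Poly_Mapping.lookup r x) (basis (butlast xs))) w"
    by (simp add: linext_def sum_single)
  finally show ?thesis
    by (simp only: linext_fun_pscale collapse_def)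
qed

text \<open>For a list \<open>ys @ [h]\<close> the faces of index below m are faces of
  \<open>ys\<close>; the one of index m multiplies the end of \<open>ys\<close> into h, and after
  deletion this is the last face of \<open>ys\<close>. For m = 0 the sides would differ: the
  augmentation is not zero, while \<open>bar_bd\<close> vanishes on the empty list.\<close>

lemma collapse_free_bar_bd:
  assumes w: "w \<in> tuple_chains Q (Suc m)" and m: "m > 0"
  shows "collapse (free_bar_bd Q w) = bar_bd Q (collapse w)"
proof -
  have "collapse (free_bar_bd Q w) = linext (\<lambda>xs. collapse (free_bar_bd Q (basis xs))) w"
    by (simp add: free_bar_bd_eq_linext[of Q w] collapse_def linext_linext)
  also have "\<dots> = linext (\<lambda>xs. bar_bd Q (basis (butlast xs))) w"
  proof (rule linext_cong_chains[OF w])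
    fix xs :: "'q list" assume xs: "length xs = Suc m" "set xs \<subseteq> carrier Q"
    then obtain ys h where ys: "xs = ys @ [h]" by (cases xs rule: rev_cases) auto
    with xs m have ne: "ys \<noteq> []" and l: "length ys = m" and c: "set ys \<subseteq> carrier Q" by auto
    have last: "butlast (bar_face Q m (ys @ [h])) = bar_face Q m ys"
      using ne bar_face_last[OF ne, of Q h] by (simp add: l[symmetric]) (simp add: bar_face_def)
    have "collapse (free_bar_bd Q (basis xs)) = (\<Sum>i<Suc m. Poly_Mapping.single (butlast (bar_face Q i (ys @ [h]))) ((-1) ^ i))"
      using l by (simp add: free_bar_bd_basis collapse_def linext_sum ys linext_add)
    also have "\<dots> = (\<Sum>i<Suc m. Poly_Mapping.single (bar_face Q i ys) ((-1) ^ i))"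
      by (rule sum.cong) (auto simp: last less_Suc_eq bar_face_snoc[OF group _ c] l)
    also have "\<dots> = bar_bd Q (basis (butlast xs))"
      using ne l by (simp add: bar_bd_def ys lessThan_Suc_atMost)
    finally show "collapse (free_bar_bd Q (basis xs)) = bar_bd Q (basis (butlast xs))" .
  qed
  also have "\<dots> = bar_bd Q (collapse w)"
    by (simp add: bar_bd_def collapse_def linext_linext)
  finally show ?thesis .
qed

lemma augment_PB:
  assumes z: "z \<in> gens (Suc m) F" and m: "m > 0"
  shows "augment e (PB z) = bar_bd Q (augment e z)"
proof -
  have "Poly_Mapping.keys z \<subseteq> tuple_chains Q (Suc m) \<times> carrier F"
    using z by simp
  then show ?thesis
    by (induction z rule: frag_induction)
      (auto simp: frag_map_diff augment_diff bar_bd_diff bar_bd_pscale collapse_free_bar_bd[OF _ m])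
qed

lemma augment_chains:
  assumes z: "z \<in> gens (Suc m) F"
  shows "augment e z \<in> tuple_chains Q m"
proof -
  have c: "collapse w \<in> tuple_chains Q m" if "w \<in> tuple_chains Q (Suc m)" for w
    unfolding collapse_def
    by (rule tuple_chains_lext[OF that], rule tuple_chains_basis) (auto dest: in_set_butlastD)
  show ?thesis
    unfolding augment_def using z by (auto intro!: tuple_chains_sum tuple_chains_pscale c)
qed

lemma augment_TR:
  assumes F: "left_module R F" and e: "e \<in> linear_hom R F trivial_rational_module" and z: "z \<in> TR (Suc m) F"
  shows "augment e z = 0"
proof -
  interpret T: tensor_modules R "bar_module Q (Suc m)" F by (rule tensor_bar[OF _ F]) simp
  note e = linear_homD[OF e]
  from z show ?thesis
  proof (induction z rule: T.TR_induct)
    case (addl a b x)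
    then show ?case by (simp add: augment_diff collapse_def linext_add pscale_add_right)
  next
    case (addr a x y)
    then show ?case by (simp add: augment_diff e(2) pscale_add_left trivial_rational_module_def)
  next
    case (balanced r a x)
    then show ?case by (simp add: augment_diff e(3) collapse_right_act trivial_rational_module_def mult.commute)
  qed (auto simp: augment_diff)
qed

text \<open>A cycle z is lifted to a tensor x with coefficients in F 0. The boundary of x augments
  to zero and so comes from F 1; the chase then writes x as a boundary plus a tensor coming from F
  1, and the augmentation kills the latter.\<close>

lemma rational_cycle_is_boundary:
  fixes \<iota> :: "('q list \<Rightarrow>\<^sub>0 rat) \<Rightarrow> nat \<Rightarrow> ('q \<Rightarrow>\<^sub>0 rat)"
    and F :: "nat \<Rightarrow> ('q \<Rightarrow>\<^sub>0 rat, nat \<Rightarrow> 'q \<Rightarrow>\<^sub>0 rat) module"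
    and z :: "'q list \<Rightarrow>\<^sub>0 rat"
  assumes \<iota>: "inj \<iota>" and res: "flat_resolution R trivial_rational_module N F \<delta> e"
    and n: "n > N" and z: "z \<in> tuple_chains Q n" and cyc: "bar_bd Q z = 0"
  shows "\<exists>v\<in>tuple_chains Q (Suc n). bar_bd Q v = z"
proof -
  let ?T = "trivial_rational_module :: ('q \<Rightarrow>\<^sub>0 rat, rat) module"
  have "\<forall>q. flat_module R (F q)" "\<forall>q>N. carrier (F q) = {\<zero>\<^bsub>F q\<^esub>}"
    and e: "e \<in> linear_hom R (F 0) ?T"
    and "\<forall>q. \<delta> q \<in> linear_hom R (F (Suc q)) (F q)"
    and surj: "e ` carrier (F 0) = carrier ?T"
    and ker0: "a_kernel (F 0) ?T e = \<delta> 0 ` carrier (F 1)"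
    and "\<forall>q. a_kernel (F (Suc q)) (F q) (\<delta> q) = \<delta> (Suc q) ` carrier (F (Suc (Suc q)))"
    by (insert res[unfolded flat_resolution_def], (elim conjE, assumption)+)
  then have flat: "flat_module R (F q)" and zero: "q > N \<Longrightarrow> carrier (F q) = {\<zero>\<^bsub>F q\<^esub>}"
    and \<delta>: "\<delta> q \<in> linear_hom R (F (Suc q)) (F q)"
    and ker: "a_kernel (F (Suc q)) (F q) (\<delta> q) = \<delta> (Suc q) ` carrier (F (Suc (Suc q)))" for q
    by simp_all
  have left: "left_module R (F q)" for q
    using flat[of q] unfolding flat_module_def by (rule conjunct1)
  have "k \<in> e ` carrier (F 0)" for k
    unfolding surj by (simp add: trivial_rational_module_def)
  then have s: "inv_into (carrier (F 0)) e k \<in> carrier (F 0)" "e (inv_into (carrier (F 0)) e k) = k" for k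
    by (simp_all add: inv_into_into f_inv_into_f)
  \<comment> \<open>Only a set-theoretic section of e: it is applied to the finitely many
    coefficients of z one at a time.\<close>
  let ?s = "inv_into (carrier (F 0)) e"
  have gn: "gen ys \<in> tuple_chains Q (Suc n)" if "ys \<in> Poly_Mapping.keys z" for ys
    using z that by (intro gen_chains) (auto simp: tuple_chains_def)
  define x where "x = (\<Sum>ys\<in>Poly_Mapping.keys z. frag_of (gen ys, ?s (Poly_Mapping.lookup z ys)))"
  have x: "x \<in> gens (Suc n) (F 0)"
    unfolding x_def using gn s by (auto elim!: keys_sumE)
  have "augment e x = linext basis z"
    unfolding linext_def by (simp add: x_def augment_sum s collapse_def gen_def)
  then have ex: "augment e x = z" by simp
  obtain n' where n': "n = Suc n'" using n by (cases n) auto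
  have "\<exists>y\<in>gens n (F (Suc 0)). PB x - FM (\<delta> 0) y \<in> TR n (F 0)"
  proof -
    have Px: "PB x \<in> gens (Suc n') (F 0)"
      using PB_gens[OF x] n' by simp
    have aPx: "augment e (PB x) = 0"
      using augment_PB[OF x, of e] ex cyc n' by simp
    obtain S k where S: "finite S" "\<And>ys. ys \<in> S \<Longrightarrow> length ys = n' \<and> set ys \<subseteq> carrier Q" and k: "\<And>ys. k ys \<in> carrier (F 0)"
      and PBx: "PB x - (\<Sum>ys\<in>S. frag_of (gen ys, k ys)) \<in> TR (Suc n') (F 0)"
      using normal_form[OF left Px] by blast
    have "(\<Sum>ys\<in>S. Poly_Mapping.single ys (e (k ys))) = 0"
      using augment_TR[OF left e PBx] aPx by (simp add: augment_diff augment_sum collapse_def gen_def)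
    \<comment> \<open>Each \<open>gen ys\<close> collapses to \<open>ys\<close>, so distinct basis
      elements stay distinct and the vanishing sum forces every single coefficient into the kernel
      of e.\<close>
    then have l0: "Poly_Mapping.lookup (\<Sum>ys\<in>S. Poly_Mapping.single ys (e (k ys))) ys = 0" for ys
      by simp
    have "e (k ys) = 0" if "ys \<in> S" for ys
      using l0[of ys] that S(1) by (simp add: lookup_sum lookup_single when_def sum.delta)
    then have "k ys \<in> a_kernel (F 0) ?T e" if "ys \<in> S" for ys
      using that k by (simp add: a_kernel_def' trivial_rational_module_def)
    then have ky: "k ys \<in> \<delta> 0 ` carrier (F 1)" if "ys \<in> S" for ys
      using that unfolding ker0 by blast
    let ?y = "\<lambda>ys. inv_into (carrier (F 1)) (\<delta> 0) (k ys)"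
    have y: "?y ys \<in> carrier (F 1) \<and> k ys = \<delta> 0 (?y ys)" if "ys \<in> S" for ys
      using inv_into_into[OF ky[OF that]] f_inv_into_f[OF ky[OF that]] by simp
    have gS: "gen ys \<in> tuple_chains Q n" if "ys \<in> S" for ys
      unfolding n' using S(2)[OF that] by (intro gen_chains) auto
    have "(\<Sum>ys\<in>S. frag_of (gen ys, k ys)) = FM (\<delta> 0) (\<Sum>ys\<in>S. frag_of (gen ys, ?y ys))"
      using y by (simp add: frag_map_sum)
    with PBx have "PB x - FM (\<delta> 0) (\<Sum>ys\<in>S. frag_of (gen ys, ?y ys)) \<in> TR n (F 0)"
      by (simp add: n')
    moreover have "(\<Sum>ys\<in>S. frag_of (gen ys, ?y ys)) \<in> gens n (F (Suc 0))"
      using y gS by (auto elim!: keys_sumE)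
    ultimately show ?thesis by (rule bexI)
  qed
  \<comment> \<open>The chase begins at q = 0 with j = \<open>Suc N\<close>; its condition j \<le> p
    is the assumption n > N.\<close>
  then obtain y d where y: "y \<in> gens (Suc n) (F (Suc 0))" and d: "d \<in> gens (Suc (Suc n)) (F 0)"
    and xyd: "x - FM (\<delta> 0) y - PB d \<in> TR (Suc n) (F 0)"
    using exactness_propagates[where F=F and \<delta>=\<delta> and N=N, OF \<iota> flat zero \<delta> ker, of 0 "Suc N" n x] n x by auto
  have "Poly_Mapping.keys y \<subseteq> tuple_chains Q (Suc n) \<times> carrier (F (Suc 0))"
    using y by simp
  then have "augment e (FM (\<delta> 0) y) = 0"
  proof (induction y rule: frag_induction)
    case (one p)
    then obtain w u where "p = (w, u)" "u \<in> carrier (F 1)" by auto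
    moreover from this have "\<delta> 0 u \<in> a_kernel (F 0) ?T e"
      unfolding ker0 by simp
    ultimately show ?case
      by (simp add: a_kernel_def' trivial_rational_module_def)
  qed (auto simp: frag_map_diff augment_diff)
  then have "z = augment e (PB d)"
    using augment_TR[OF left e xyd] ex by (simp add: augment_diff)
  also have "\<dots> = bar_bd Q (augment e d)"
    by (rule augment_PB[OF d]) simp
  finally show ?thesis
    using augment_chains[OF d] by blast
qed

end

section \<open>Vanishing of complex group homology\<close>

lemma bar_boundary_eq_bar_bd: "bar_boundary Q c = bar_bd Q c"
  unfolding bar_boundary_def bar_bd_def linext_def
  by (rule sum.cong) (auto simp: pscale_sum mult.commute)

lemma bar_chains_eq_chains: "bar_chains Q n = tuple_chains Q n"
  by (simp add: bar_chains_def tuple_chains_def)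

section \<open>From rational to complex coefficients\<close>

lemma lookup_map_additive:
  assumes "\<And>x y. f (x + y) = f x + (f y :: 'l::ab_group_add)"
  shows "Poly_Mapping.lookup (Poly_Mapping.map f c) x = f (Poly_Mapping.lookup c x :: 'k::ab_group_add)"
proof -
  have "f 0 = 0" using assms[of 0 0] by simp
  then show ?thesis by (simp add: Poly_Mapping.map.rep_eq when_def)
qed

lemma keys_map_additive: "Poly_Mapping.keys (Poly_Mapping.map f c) \<subseteq> Poly_Mapping.keys c"
  by (auto simp: in_keys_iff Poly_Mapping.map.rep_eq when_def split: if_splits)

text \<open>The boundary has coefficients 1 and -1, so it commutes with any additive change of
  coefficients, in particular with rational coordinates of complex numbers, which are not
  multiplicative.\<close>

lemma bar_bd_map_additive:
  fixes f :: "'k::comm_ring_1 \<Rightarrow> 'l::comm_ring_1"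
  assumes f: "\<And>x y. f (x + y) = f x + f y"
  shows "bar_bd Q (Poly_Mapping.map f c) = Poly_Mapping.map f (bar_bd Q c)"
proof -
  have f0: "f 0 = 0" using f[of 0 0] by simp
  have fm: "f (- x) = - f x" for x
    using f[of x "- x"] by (simp add: f0 eq_neg_iff_add_eq_0 add.commute)
  have fp: "f ((-1) ^ i * x) = (-1) ^ i * f x" for i x
    by (cases "even i") (auto simp: fm)
  let ?m = "Poly_Mapping.map f :: ('a list \<Rightarrow>\<^sub>0 'k) \<Rightarrow> 'a list \<Rightarrow>\<^sub>0 'l"
  have madd: "?m (c + d) = ?m c + ?m d" for c d
    by (rule poly_mapping_eqI) (simp add: lookup_map_additive[OF f] lookup_add f)
  have m0: "?m 0 = 0"
    by (rule poly_mapping_eqI) (simp add: lookup_map_additive[OF f] f0)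
  have msum: "?m (sum g I) = (\<Sum>i\<in>I. ?m (g i))" for g :: "'i \<Rightarrow> _" and I
    by (induction I rule: infinite_finite_induct) (auto simp: madd m0)
  have msingle: "?m (Poly_Mapping.single x k) = Poly_Mapping.single x (f k)" for x k
    by (rule poly_mapping_eqI) (auto simp: lookup_map_additive[OF f] lookup_single when_def f0)
  have ms: "?m (pscale k (if xs = [] then 0 else (\<Sum>i\<le>length xs. Poly_Mapping.single (bar_face Q i xs) ((-1) ^ i)))) =
      pscale (f k) (if xs = [] then 0 else (\<Sum>i\<le>length xs. Poly_Mapping.single (bar_face Q i xs) ((-1) ^ i)))" for k xs
  proof (cases "xs = []")
    case True
    then show ?thesis by (simp add: m0)
  next
    case False
    then show ?thesis
      by (simp add: pscale_sum msum msingle fp mult.commute[of _ "(-1) ^ _"])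
  qed
  show ?thesis
    unfolding bar_bd_def linext_superset[OF finite_keys keys_map_additive[of f c]]
    unfolding linext_def msum ms by (simp add: lookup_map_additive[OF f])
qed

lemma tuple_chains_map_additive: "c \<in> tuple_chains Q n \<Longrightarrow> Poly_Mapping.map f c \<in> tuple_chains Q n"
  using keys_map_additive[of f c] by (auto simp: tuple_chains_def)

interpretation complex_rat: vector_space "\<lambda>(q::rat) (z::complex). of_rat q * z"
  by unfold_locales (auto simp: algebra_simps of_rat_add of_rat_mult)

text \<open>In a rational basis of \<complex>, each coordinate of a complex cycle is a rational
  cycle. These are filled separately, and the fillings are reassembled with the basis elements as
  weights.\<close>

lemma complex_cycle_is_boundary:
  assumes rational: "\<And>z :: 'q list \<Rightarrow>\<^sub>0 rat. z \<in> tuple_chains Q n \<Longrightarrow> bar_bd Q z = 0 \<Longrightarrow> \<exists>v\<in>tuple_chains Q (Suc n). bar_bd Q v = z"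
    and c: "(c :: 'q list \<Rightarrow>\<^sub>0 complex) \<in> tuple_chains Q n" "bar_bd Q c = 0"
  shows "\<exists>v\<in>tuple_chains Q (Suc n). bar_bd Q v = c"
proof -
  define B where "B = complex_rat.extend_basis {}"
  have B: "complex_rat.independent B" "complex_rat.span B = UNIV"
    unfolding B_def
    by (simp_all add: complex_rat.independent_extend_basis complex_rat.span_extend_basis complex_rat.independent_empty)
  define r where "r b z = complex_rat.representation B z b" for b z
  have r: "r b (x + y) = r b x + r b y" for b x y
    unfolding r_def using B by (simp add: complex_rat.representation_add)
  define C where "C b = Poly_Mapping.map (r b) c" for b
  have "\<exists>v. v \<in> tuple_chains Q (Suc n) \<and> bar_bd Q v = C b" for b
  proof -
    have "bar_bd Q (C b) = 0"
      unfolding C_def using c(2)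
      by (simp add: bar_bd_map_additive[OF r]) (rule poly_mapping_eqI, use r[of b 0 0] in \<open>simp add: lookup_map_additive[OF r]\<close>)
    then show ?thesis
      using rational[of "C b"] tuple_chains_map_additive[OF c(1), of "r b"] unfolding C_def by blast
  qed
  then obtain v where v: "\<And>b. v b \<in> tuple_chains Q (Suc n)" "\<And>b. bar_bd Q (v b) = C b"
    by metis
  \<comment> \<open>The basis elements occurring in some coefficient of c; there are finitely many,
    which makes the reassembled filling a finite sum.\<close>
  define T where "T = (\<Union>xs\<in>Poly_Mapping.keys c. {b. r b (Poly_Mapping.lookup c xs) \<noteq> 0})"
  have fin: "finite {b. r b z \<noteq> 0}" for z
    unfolding r_def by (rule complex_rat.finite_representation)
  then have T: "finite T" by (auto simp: T_def)
  define s where "s b q = of_rat q * (b :: complex)" for b q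
  have s: "s b (x + y) = s b x + s b y" for b x y
    by (simp add: s_def of_rat_add distrib_right)
  have "c = (\<Sum>b\<in>T. Poly_Mapping.map (s b) (C b))"
  proof (rule poly_mapping_eqI)
    fix xs
    have "Poly_Mapping.lookup (\<Sum>b\<in>T. Poly_Mapping.map (s b) (C b)) xs =
        (\<Sum>b\<in>T. of_rat (r b (Poly_Mapping.lookup c xs)) * b)"
      by (simp add: lookup_sum lookup_map_additive[OF s] C_def lookup_map_additive[OF r] s_def)
    also have "\<dots> = (\<Sum>b\<in>{b. r b (Poly_Mapping.lookup c xs) \<noteq> 0}. of_rat (r b (Poly_Mapping.lookup c xs)) * b)"
    proof (cases "xs \<in> Poly_Mapping.keys c")
      case True
      then show ?thesis
        by (intro sum.mono_neutral_right T) (auto simp: T_def)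
    next
      case False
      then have "Poly_Mapping.lookup c xs = 0" by (simp add: in_keys_iff)
      moreover have "r b 0 = 0" for b using r[of b 0 0] by simp
      ultimately show ?thesis by simp
    qed
    also have "\<dots> = Poly_Mapping.lookup c xs"
      unfolding r_def using B by (intro complex_rat.sum_nonzero_representation_eq) auto
    finally show "Poly_Mapping.lookup c xs = Poly_Mapping.lookup (\<Sum>b\<in>T. Poly_Mapping.map (s b) (C b)) xs"
      by simp
  qed
  also have "\<dots> = bar_bd Q (\<Sum>b\<in>T. Poly_Mapping.map (s b) (v b))"
    by (simp add: bar_bd_sum bar_bd_map_additive[OF s] v)
  finally show ?thesis
    using v(1) by (intro bexI[of _ "\<Sum>b\<in>T. Poly_Mapping.map (s b) (v b)"] tuple_chains_sum tuple_chains_map_additive) auto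
qed

definition acyclic_above :: "('q, 'b) monoid_scheme \<Rightarrow> nat \<Rightarrow> bool" where
  "acyclic_above Q N \<longleftrightarrow>
     (\<forall>n>N. \<forall>z :: 'q list \<Rightarrow>\<^sub>0 complex. z \<in> tuple_chains Q n \<longrightarrow> bar_bd Q z = 0 \<longrightarrow> (\<exists>v\<in>tuple_chains Q (Suc n). bar_bd Q v = z))"

text \<open>The underlying type is \<open>nat\<close> so that lists can be numbered, which provides
  the injection into the universe of test modules.\<close>

lemma finite_hd_rat_acyclic:
  fixes Q :: "nat monoid"
  assumes Q: "group Q" and "hd_rat Q < \<infinity>"
  shows "\<exists>N. acyclic_above Q N"
proof -
  let ?R = "rational_group_ring Q"
  let ?A = "{enat n | n. \<exists>(F :: nat \<Rightarrow> (nat \<Rightarrow>\<^sub>0 rat, nat \<Rightarrow> nat \<Rightarrow>\<^sub>0 rat) module) \<delta> e.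
      flat_resolution ?R trivial_rational_module n F \<delta> e}"
  have "?A \<noteq> {}"
  proof
    assume "?A = {}"
    then have "hd_rat Q = \<infinity>"
      unfolding hd_rat_def flat_dim_def by (metis Inf_empty top_enat_def)
    with assms(2) show False by simp
  qed
  then obtain N and F :: "nat \<Rightarrow> (nat \<Rightarrow>\<^sub>0 rat, nat \<Rightarrow> nat \<Rightarrow>\<^sub>0 rat) module" and \<delta> e
    where res: "flat_resolution ?R trivial_rational_module N F \<delta> e"
    by blast
  \<comment> \<open>The ring axioms of the group ring come with the resolution, as
    \<open>left_module\<close> contains them.\<close>
  have "ring ?R"
    using res by (simp add: flat_resolution_def left_module_def)
  then interpret bar_resolution Q
    by (rule bar_resolution.intro[OF Q])
  \<comment> \<open>The coefficient of the k-th list is stored at position k as a multiple of the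
    group ring basis element indexed by 0; any fixed index would do.\<close>
  define \<iota> where "\<iota> w k = Poly_Mapping.single (0::nat) (Poly_Mapping.lookup w (from_nat k :: nat list) :: rat)" for w k
  have "inj \<iota>"
  proof (rule injI, rule poly_mapping_eqI)
    fix v w :: "nat list \<Rightarrow>\<^sub>0 rat" and xs :: "nat list" assume "\<iota> v = \<iota> w"
    then have "Poly_Mapping.lookup (\<iota> v (to_nat xs)) 0 = Poly_Mapping.lookup (\<iota> w (to_nat xs)) 0" by simp
    then show "Poly_Mapping.lookup v xs = Poly_Mapping.lookup w xs"
      by (simp add: \<iota>_def)
  qed
  note rational_cycle_is_boundary[OF this res]
  then have "acyclic_above Q N"
    unfolding acyclic_above_def by (intro allI impI complex_cycle_is_boundary)
  then show ?thesis ..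
qed

section \<open>Isomorphism invariance of acyclicity\<close>

lemma bar_face_map:
  assumes "\<phi> \<in> hom Q Q'" "set xs \<subseteq> carrier Q" "i \<le> length xs"
  shows "bar_face Q' i (map \<phi> xs) = map \<phi> (bar_face Q i xs)"
proof (cases "i = 0 \<or> i = length xs")
  case True
  then show ?thesis by (auto simp: bar_face_def map_tl map_butlast)
next
  case False
  then have "xs ! (i - 1) \<in> carrier Q" "xs ! i \<in> carrier Q"
    using assms by (auto simp: subset_iff)
  then have "\<phi> (xs ! (i - 1) \<otimes>\<^bsub>Q\<^esub> xs ! i) = \<phi> (xs ! (i - 1)) \<otimes>\<^bsub>Q'\<^esub> \<phi> (xs ! i)"
    using assms(1) by (simp add: hom_def)
  moreover have "i - 1 < length xs" "i < length xs"
    using False assms(3) by auto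
  ultimately show ?thesis
    using False by (simp add: bar_face_def take_map drop_map)
qed

lemma bar_bd_push:
  assumes \<phi>: "\<phi> \<in> hom Q Q'" and c: "c \<in> tuple_chains Q n"
  shows "bar_bd Q' (linext (\<lambda>xs. basis (map \<phi> xs)) c) = linext (\<lambda>xs. basis (map \<phi> xs)) (bar_bd Q c)"
  unfolding bar_bd_def linext_linext
proof (rule linext_cong_chains[OF c])
  fix xs assume xs: "length xs = n" "set xs \<subseteq> carrier Q"
  show "linext (\<lambda>xs. if xs = [] then 0 else \<Sum>i\<le>length xs. Poly_Mapping.single (bar_face Q' i xs) ((-1) ^ i)) (basis (map \<phi> xs)) =
    linext (\<lambda>xs. basis (map \<phi> xs)) (if xs = [] then 0 else \<Sum>i\<le>length xs. Poly_Mapping.single (bar_face Q i xs) ((-1) ^ i))"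
    using bar_face_map[OF \<phi> xs(2)] by (auto simp: linext_sum)
qed

lemma tuple_chains_push:
  assumes \<phi>: "\<phi> \<in> hom Q Q'" and c: "c \<in> tuple_chains Q n"
  shows "linext (\<lambda>xs. basis (map \<phi> xs)) c \<in> tuple_chains Q' n"
  by (rule tuple_chains_lext[OF c], rule tuple_chains_basis) (use \<phi> in \<open>auto simp: hom_def\<close>)

text \<open>A cycle is pushed forward entrywise, filled, and the filling is pulled back.
  Homomorphisms commute with the faces, and the two pushes cancel on lists in the carrier.\<close>

lemma acyclic_above_iso:
  assumes \<phi>: "\<phi> \<in> iso Q Q'" and Q: "group Q" and N: "acyclic_above Q' N"
  shows "acyclic_above Q N"
  unfolding acyclic_above_def
proof (intro allI impI)
  fix n and z :: "'a list \<Rightarrow>\<^sub>0 complex"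
  assume n: "n > N" and z: "z \<in> tuple_chains Q n" "bar_bd Q z = 0"
  let ?\<psi> = "inv_into (carrier Q) \<phi>"
  have hom: "\<phi> \<in> hom Q Q'" and hom': "?\<psi> \<in> hom Q' Q" and inj: "inj_on \<phi> (carrier Q)"
    using \<phi> group.iso_set_sym[OF Q \<phi>] by (auto simp: iso_def bij_betw_def)
  let ?f = "linext (\<lambda>xs. basis (map \<phi> xs))" and ?g = "linext (\<lambda>xs. basis (map ?\<psi> xs))"
  have "bar_bd Q' (?f z) = 0"
    using bar_bd_push[OF hom z(1)] z(2) by simp
  then obtain v where v: "v \<in> tuple_chains Q' (Suc n)" "bar_bd Q' v = ?f z"
    using N n tuple_chains_push[OF hom z(1)] unfolding acyclic_above_def by blast
  have "bar_bd Q (?g v) = ?g (?f z)"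
    using bar_bd_push[OF hom' v(1)] v(2) by simp
  also have "\<dots> = linext basis z"
    unfolding linext_linext
  proof (rule linext_cong_chains[OF z(1)])
    fix xs :: "'a list" assume "set xs \<subseteq> carrier Q"
    then have "map ?\<psi> (map \<phi> xs) = xs"
      using inj by (simp add: map_idI inv_into_f_f subset_iff)
    then show "linext (\<lambda>xs. basis (map ?\<psi> xs)) (basis (map \<phi> xs)) = basis xs"
      by simp
  qed
  finally have "bar_bd Q (?g v) = z" by simp
  then show "\<exists>v\<in>tuple_chains Q (Suc n). bar_bd Q v = z"
    using tuple_chains_push[OF hom' v(1)] by blast
qed

section \<open>Asymptotic dimension and centralizer quotients\<close>

text \<open>An infimum in \<open>enat\<close> is finite exactly when some finite bound is in the
  set, the empty infimum being \<infinity>.\<close>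

lemma asdim_finite_iff:
  "asdim G < \<infinity> \<longleftrightarrow> (\<exists>d n. proper_left_invariant_metric G d \<and> asdim_le (carrier G) d n)"
proof
  assume "asdim G < \<infinity>"
  then have "{enat n | n. \<exists>d. proper_left_invariant_metric G d \<and> asdim_le (carrier G) d n} \<noteq> {}"
    unfolding asdim_def by (metis Inf_empty order_less_irrefl top_enat_def)
  then show "\<exists>d n. proper_left_invariant_metric G d \<and> asdim_le (carrier G) d n"
    by blast
next
  assume "\<exists>d n. proper_left_invariant_metric G d \<and> asdim_le (carrier G) d n"
  then obtain d n where "proper_left_invariant_metric G d \<and> asdim_le (carrier G) d n" by blast
  then have "asdim G \<le> enat n"
    unfolding asdim_def by (intro Inf_lower) blast
  then show "asdim G < \<infinity>"
    by (metis enat_ord_code(4) order_le_less_trans)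
qed

lemma asdim_finite_iso:
  assumes G: "group G" and \<phi>: "\<phi> \<in> iso G H" and "asdim G < \<infinity>"
  shows "asdim H < \<infinity>"
proof -
  obtain d n where d: "proper_left_invariant_metric G d" and n: "asdim_le (carrier G) d n"
    using assms(3) asdim_finite_iff by blast
  have ms: "Metric_space (carrier G) d"
    and fin: "\<And>x r. x \<in> carrier G \<Longrightarrow> finite (Metric_space.mcball (carrier G) d x r)"
    and inv: "\<And>g x y. g \<in> carrier G \<Longrightarrow> x \<in> carrier G \<Longrightarrow> y \<in> carrier G \<Longrightarrow> d (g \<otimes>\<^bsub>G\<^esub> x) (g \<otimes>\<^bsub>G\<^esub> y) = d x y"
    using d unfolding proper_left_invariant_metric_def by auto
  interpret M: Metric_space "carrier G" d by (rule ms)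
  let ?\<psi> = "inv_into (carrier G) \<phi>"
  have inj: "inj_on \<phi> (carrier G)" and img: "\<phi> ` carrier G = carrier H"
    using \<phi> by (auto simp: iso_def bij_betw_def)
  have \<psi>: "?\<psi> x \<in> carrier G" "\<phi> (?\<psi> x) = x" if "x \<in> carrier H" for x
    using that img by (auto simp: inv_into_into f_inv_into_f)
  have \<psi>\<phi>: "?\<psi> (\<phi> x) = x" if "x \<in> carrier G" for x
    using that inj by simp
  have hom: "?\<psi> \<in> hom H G"
    using group.iso_set_sym[OF G \<phi>] by (simp add: iso_def)
  define d' where "d' x y = d (?\<psi> x) (?\<psi> y)" for x y
  have ms': "Metric_space (carrier H) d'"
  proof
    fix x y z
    show "0 \<le> d' x y" "d' x y = d' y x"
      by (simp_all add: d'_def M.commute)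
    show "d' x y = 0 \<longleftrightarrow> x = y" if "x \<in> carrier H" "y \<in> carrier H"
      using that \<psi> unfolding d'_def by (metis M.zero)
    show "d' x z \<le> d' x y + d' y z" if "x \<in> carrier H" "y \<in> carrier H" "z \<in> carrier H"
      using that \<psi> unfolding d'_def by (intro M.triangle) auto
  qed
  interpret M': Metric_space "carrier H" d' by (rule ms')
  have "finite (M'.mcball x r)" if "x \<in> carrier H" for x r
  proof (rule finite_subset)
    show "M'.mcball x r \<subseteq> \<phi> ` M.mcball (?\<psi> x) r"
    proof
      fix y assume "y \<in> M'.mcball x r"
      then have "y = \<phi> (?\<psi> y)" "?\<psi> y \<in> M.mcball (?\<psi> x) r"
        using \<psi> by (auto simp: d'_def)
      then show "y \<in> \<phi> ` M.mcball (?\<psi> x) r" by (rule image_eqI)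
    qed
    show "finite (\<phi> ` M.mcball (?\<psi> x) r)"
      using fin \<psi> that by simp
  qed
  moreover have "d' (g \<otimes>\<^bsub>H\<^esub> x) (g \<otimes>\<^bsub>H\<^esub> y) = d' x y" if "g \<in> carrier H" "x \<in> carrier H" "y \<in> carrier H" for g x y
    using that hom \<psi> by (simp add: d'_def hom_mult inv)
  ultimately have "proper_left_invariant_metric H d'"
    unfolding proper_left_invariant_metric_def using ms' by simp
  moreover have "asdim_le (carrier H) d' n"
    unfolding asdim_le_def
  proof (intro allI impI)
    fix r :: real assume "r > 0"
    then obtain \<U> :: "nat \<Rightarrow> 'a set set" and D where
      cov: "carrier G = (\<Union>i\<le>n. \<Union>(\<U> i))"
      and bd: "\<forall>i\<le>n. \<forall>U\<in>\<U> i. \<forall>x\<in>U. \<forall>y\<in>U. d x y \<le> D"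
      and sep: "\<forall>i\<le>n. \<forall>U\<in>\<U> i. \<forall>V\<in>\<U> i. U \<noteq> V \<longrightarrow> (\<forall>x\<in>U. \<forall>y\<in>V. d x y > r)"
      using n[unfolded asdim_le_def, THEN spec, THEN mp, OF \<open>r > 0\<close>] by (elim exE conjE) (rule that)
    have sub: "x \<in> carrier G" if "i \<le> n" "U \<in> \<U> i" "x \<in> U" for i U x
      unfolding cov using that by blast
    have "carrier H = (\<Union>i\<le>n. \<Union>((`) \<phi> ` \<U> i))"
      unfolding img[symmetric] cov by (simp add: image_UN image_Union)
    moreover have "d' x y \<le> D" if iU: "i \<le> n" "U \<in> (`) \<phi> ` \<U> i" and xy: "x \<in> U" "y \<in> U" for i U x y
    proof -
      obtain U' where U': "U' \<in> \<U> i" "U = \<phi> ` U'" using iU by blast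
      obtain x' where x': "x' \<in> U'" "x = \<phi> x'" using xy U' by blast
      obtain y' where y': "y' \<in> U'" "y = \<phi> y'" using xy U' by blast
      show ?thesis
        using bd iU(1) U' x' y' sub[OF iU(1) U'(1)] by (simp add: d'_def \<psi>\<phi>)
    qed
    moreover have "d' x y > r"
      if iU: "i \<le> n" "U \<in> (`) \<phi> ` \<U> i" "V \<in> (`) \<phi> ` \<U> i" "U \<noteq> V" and xy: "x \<in> U" "y \<in> V" for i U V x y
    proof -
      obtain U' where U': "U' \<in> \<U> i" "U = \<phi> ` U'" using iU by blast
      obtain V' where V': "V' \<in> \<U> i" "V = \<phi> ` V'" using iU by blast
      obtain x' where x': "x' \<in> U'" "x = \<phi> x'" using xy U' by blast
      obtain y' where y': "y' \<in> V'" "y = \<phi> y'" using xy V' by blast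
      have "U' \<noteq> V'" using iU(4) U' V' by blast
      then show ?thesis
        using sep iU(1) U' V' x' y' sub[OF iU(1) U'(1)] sub[OF iU(1) V'(1)] by (simp add: d'_def \<psi>\<phi>)
    qed
    ultimately show "\<exists>\<U> D. carrier H = (\<Union>i\<le>n. \<Union>(\<U> i)) \<and>
        (\<forall>i\<le>n. \<forall>U\<in>\<U> i. \<forall>x\<in>U. \<forall>y\<in>U. d' x y \<le> D) \<and>
        (\<forall>i\<le>n. \<forall>U\<in>\<U> i. \<forall>V\<in>\<U> i. U \<noteq> V \<longrightarrow> (\<forall>x\<in>U. \<forall>y\<in>V. d' x y > r))"
      by (intro exI[of _ "\<lambda>i. (`) \<phi> ` \<U> i"] exI[of _ D] conjI allI ballI impI)
  qed
  ultimately show ?thesis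
    unfolding asdim_finite_iff by (intro exI conjI)
qed

text \<open>The group is the union of the finite balls of integral radius about the unit.\<close>

lemma asdim_finite_countable:
  assumes G: "group G" and "asdim G < \<infinity>"
  shows "countable (carrier G)"
proof -
  interpret group G by fact
  obtain d n where d: "proper_left_invariant_metric G d" and "asdim_le (carrier G) d n"
    using assms(2) asdim_finite_iff by blast
  then interpret M: Metric_space "carrier G" d
    by (simp add: proper_left_invariant_metric_def)
  have "carrier G \<subseteq> (\<Union>k::nat. M.mcball \<one>\<^bsub>G\<^esub> (real k))"
  proof
    fix x assume "x \<in> carrier G"
    moreover obtain k :: nat where "d \<one>\<^bsub>G\<^esub> x \<le> real k"
      using real_arch_simple by blast
    ultimately show "x \<in> (\<Union>k::nat. M.mcball \<one>\<^bsub>G\<^esub> (real k))"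
      by auto
  qed
  moreover have "countable (M.mcball \<one>\<^bsub>G\<^esub> (real k))" for k
    using d by (simp add: proper_left_invariant_metric_def countable_finite)
  ultimately show ?thesis
    by (meson countable_UN countable_subset uncountable_def countableI_type)
qed

text \<open>This moves an abstract countable group to the type for which the assumptions on
  \<open>hd_rat\<close> and on centralizer quotients are stated.\<close>

lemma countable_group_iso_nat:
  assumes G: "group G" and "countable (carrier G)"
  obtains H :: "nat monoid" and \<phi> where "group H" "\<phi> \<in> iso G H"
proof -
  interpret group G by fact
  let ?\<phi> = "to_nat_on (carrier G)"
  have inj: "inj_on ?\<phi> (carrier G)"
    using assms(2) by (rule inj_on_to_nat_on)
  define H where "H = \<lparr>carrier = ?\<phi> ` carrier G,
    monoid.mult = (\<lambda>x y. ?\<phi> (inv_into (carrier G) ?\<phi> x \<otimes>\<^bsub>G\<^esub> inv_into (carrier G) ?\<phi> y)), one = ?\<phi> \<one>\<^bsub>G\<^esub>\<rparr>"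
  have H: "carrier H = ?\<phi> ` carrier G" "\<one>\<^bsub>H\<^esub> = ?\<phi> \<one>\<^bsub>G\<^esub>"
    "\<And>x y. x \<in> carrier G \<Longrightarrow> y \<in> carrier G \<Longrightarrow> ?\<phi> x \<otimes>\<^bsub>H\<^esub> ?\<phi> y = ?\<phi> (x \<otimes>\<^bsub>G\<^esub> y)"
    using inj by (simp_all add: H_def)
  have "group H"
  proof (rule groupI, goal_cases)
    case (5 x)
    then obtain a where "a \<in> carrier G" "x = ?\<phi> a" by (auto simp: H)
    then show ?case by (intro bexI[of _ "?\<phi> (inv\<^bsub>G\<^esub> a)"]) (auto simp: H)
  qed (auto simp: H m_assoc)
  moreover have "?\<phi> \<in> iso G H"
    using inj by (auto simp: iso_def hom_def bij_betw_def H)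
  ultimately show thesis by (rule that)
qed

section \<open>The quotient of a centralizer and its dependence on the group up to
  isomorphism\<close>

lemma subgroup_centralizer:
  fixes G (structure)
  assumes G: "group G" and g: "g \<in> carrier G"
  shows "subgroup (centralizer G g) G"
proof -
  interpret group G by fact
  show ?thesis
  proof (rule subgroupI)
    show "centralizer G g \<subseteq> carrier G" "centralizer G g \<noteq> {}"
      using g by (auto simp: centralizer_def)
    show "inv a \<in> centralizer G g" if "a \<in> centralizer G g" for a
    proof -
      have a: "a \<in> carrier G" "a \<otimes> g = g \<otimes> a" using that by (auto simp: centralizer_def)
      have "inv a \<otimes> g = inv a \<otimes> (g \<otimes> a) \<otimes> inv a"
        using a(1) g by (simp add: m_assoc)
      also have "\<dots> = inv a \<otimes> (a \<otimes> g) \<otimes> inv a" by (simp add: a(2))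
      also have "\<dots> = g \<otimes> inv a"
        using a(1) g by (simp flip: m_assoc)
      finally show ?thesis
        using a(1) by (simp add: centralizer_def)
    qed
    show "a \<otimes> b \<in> centralizer G g" if "a \<in> centralizer G g" "b \<in> centralizer G g" for a b
    proof -
      have a: "a \<in> carrier G" "a \<otimes> g = g \<otimes> a" and b: "b \<in> carrier G" "b \<otimes> g = g \<otimes> b"
        using that by (auto simp: centralizer_def)
      have "a \<otimes> b \<otimes> g = a \<otimes> g \<otimes> b"
        using a(1) b g by (simp add: m_assoc)
      also have "\<dots> = g \<otimes> (a \<otimes> b)"
        using a b(1) g by (simp add: m_assoc)
      finally show ?thesis
        using a(1) b(1) by (simp add: centralizer_def)
    qed
  qed
qed

lemma generate_commutes:
  assumes G: "group G" and g: "g \<in> carrier G" and h: "h \<in> centralizer G g" and x: "x \<in> generate G {g}"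
  shows "x \<otimes>\<^bsub>G\<^esub> h = h \<otimes>\<^bsub>G\<^esub> x"
proof -
  have "h \<in> carrier G" "g \<in> centralizer G h"
    using g h by (auto simp: centralizer_def)
  then have "generate G {g} \<subseteq> centralizer G h"
    using subgroup_centralizer[OF G] by (intro group.generate_subgroup_incl[OF G]) auto
  then show ?thesis
    using x by (auto simp: centralizer_def)
qed

lemma generate_normal_centralizer:
  fixes G (structure)
  assumes G: "group G" and g: "g \<in> carrier G"
  shows "generate G {g} \<lhd> G\<lparr>carrier := centralizer G g\<rparr>"
proof -
  interpret group G by fact
  have C: "subgroup (centralizer G g) G" by (rule subgroup_centralizer[OF G g])
  interpret C: group "G\<lparr>carrier := centralizer G g\<rparr>"
    by (rule subgroup.subgroup_is_group[OF C G])
  have "g \<in> centralizer G g" using g by (simp add: centralizer_def)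
  then have sub: "generate G {g} \<subseteq> centralizer G g"
    using C by (intro generate_subgroup_incl) auto
  show ?thesis
  proof (rule C.normal_invI)
    show "subgroup (generate G {g}) (G\<lparr>carrier := centralizer G g\<rparr>)"
      using g by (intro subgroup_incl generate_is_subgroup C sub) auto
    fix x h assume x: "x \<in> carrier (G\<lparr>carrier := centralizer G g\<rparr>)" and h: "h \<in> generate G {g}"
    have "x \<otimes> h \<otimes> inv x = h"
      using x sub h subgroup.subset[OF C] generate_commutes[OF G g _ h, of x]
      by (auto simp: m_assoc subset_iff simp flip: generate_commutes[OF G g _ h, of x])
    then show "x \<otimes>\<^bsub>G\<lparr>carrier := centralizer G g\<rparr>\<^esub> h \<otimes>\<^bsub>G\<lparr>carrier := centralizer G g\<rparr>\<^esub> inv\<^bsub>G\<lparr>carrier := centralizer G g\<rparr>\<^esub> x \<in> generate G {g}"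
      using x h m_inv_consistent[OF C] by simp
  qed
qed

lemma group_centralizer_quotient:
  assumes "group G" "g \<in> carrier G"
  shows "group (centralizer_quotient G g)"
  unfolding centralizer_quotient_def
  by (rule normal.factorgroup_is_group[OF generate_normal_centralizer[OF assms]])

lemma carrier_centralizer_quotient:
  "carrier (centralizer_quotient G g) = (\<lambda>a. generate G {g} #>\<^bsub>G\<^esub> a) ` centralizer G g"
  by (auto simp: centralizer_quotient_def FactGroup_def RCOSETS_def r_coset_def)

lemma mult_centralizer_quotient:
  "K \<otimes>\<^bsub>centralizer_quotient G g\<^esub> L = K <#>\<^bsub>G\<^esub> L"
  by (simp add: centralizer_quotient_def FactGroup_def set_mult_def)

text \<open>An isomorphism carries the centralizer and the cyclic subgroup of g onto those of its
  image, hence cosets to cosets. The induced map sends a coset to its image set, so its injectivity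
  is that of \<phi> on subsets of the carrier.\<close>

lemma centralizer_quotient_iso:
  assumes G: "group G" and H: "group H" and \<phi>: "\<phi> \<in> iso G H" and g: "g \<in> carrier G"
  shows "(`) \<phi> \<in> iso (centralizer_quotient G g) (centralizer_quotient H (\<phi> g))"
proof -
  interpret G: group G by fact
  interpret \<phi>: group_hom G H \<phi>
    using G H \<phi> by (simp add: group_hom_def group_hom_axioms_def iso_def)
  have inj: "inj_on \<phi> (carrier G)" and img: "\<phi> ` carrier G = carrier H"
    using \<phi> by (auto simp: iso_def bij_betw_def)
  have cent: "\<phi> ` centralizer G g = centralizer H (\<phi> g)"
  proof safe
    fix h assume "h \<in> centralizer G g"
    then show "\<phi> h \<in> centralizer H (\<phi> g)"
      using g by (auto simp: centralizer_def simp flip: \<phi>.hom_mult)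
  next
    fix y assume y: "y \<in> centralizer H (\<phi> g)"
    then obtain h where h: "h \<in> carrier G" "y = \<phi> h"
      unfolding img[symmetric] centralizer_def by auto
    then have "\<phi> (h \<otimes>\<^bsub>G\<^esub> g) = \<phi> (g \<otimes>\<^bsub>G\<^esub> h)"
      using y g by (simp add: centralizer_def)
    then have "h \<otimes>\<^bsub>G\<^esub> g = g \<otimes>\<^bsub>G\<^esub> h"
      using inj_onD[OF inj] h g by simp
    then show "y \<in> \<phi> ` centralizer G g"
      using h by (auto simp: centralizer_def)
  qed
  have gen: "\<phi> ` generate G {g} = generate H {\<phi> g}"
    using \<phi>.generate_img[of "{g}"] g by simp
  have gsub: "generate G {g} \<subseteq> carrier G"
    using g by (intro G.generate_incl) auto
  have csub: "centralizer G g \<subseteq> carrier G"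
    by (auto simp: centralizer_def)
  have coset: "\<phi> ` (generate G {g} #>\<^bsub>G\<^esub> a) = generate H {\<phi> g} #>\<^bsub>H\<^esub> \<phi> a" if "a \<in> carrier G" for a
    using that gsub unfolding gen[symmetric] r_coset_def by (force simp: subset_iff)
  have sub: "K \<subseteq> carrier G" if "K \<in> carrier (centralizer_quotient G g)" for K
    using that gsub csub by (auto simp: carrier_centralizer_quotient r_coset_def subset_iff)
  have mult: "\<phi> ` (K <#>\<^bsub>G\<^esub> L) = \<phi> ` K <#>\<^bsub>H\<^esub> \<phi> ` L" if "K \<subseteq> carrier G" "L \<subseteq> carrier G" for K L
    using that unfolding set_mult_def by (force simp: subset_iff)
  have carrier: "(`) \<phi> ` carrier (centralizer_quotient G g) = carrier (centralizer_quotient H (\<phi> g))"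
    using coset csub unfolding carrier_centralizer_quotient cent[symmetric] image_image
    by (intro image_cong) auto
  have "inj_on ((`) \<phi>) (carrier (centralizer_quotient G g))"
  proof (rule inj_onI)
    fix K L assume "K \<in> carrier (centralizer_quotient G g)" "L \<in> carrier (centralizer_quotient G g)" "\<phi> ` K = \<phi> ` L"
    then show "K = L"
      using inj_on_image_eq_iff[OF inj sub sub] by simp
  qed
  moreover have "(`) \<phi> \<in> hom (centralizer_quotient G g) (centralizer_quotient H (\<phi> g))"
  proof (rule homI)
    fix K L assume K: "K \<in> carrier (centralizer_quotient G g)"
    then show "\<phi> ` K \<in> carrier (centralizer_quotient H (\<phi> g))"
      unfolding carrier[symmetric] by (rule imageI)
    assume L: "L \<in> carrier (centralizer_quotient G g)"
    show "\<phi> ` (K \<otimes>\<^bsub>centralizer_quotient G g\<^esub> L) = \<phi> ` K \<otimes>\<^bsub>centralizer_quotient H (\<phi> g)\<^esub> \<phi> ` L"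
      unfolding mult_centralizer_quotient by (rule mult[OF sub[OF K] sub[OF L]])
  qed
  ultimately show ?thesis
    unfolding iso_def bij_betw_def using carrier by simp
qed

section \<open>The Euler cocycle and the inverse limit\<close>

definition euler_section :: "'a set \<Rightarrow> 'a" where
  "euler_section Z = (SOME z. z \<in> Z)"

locale infinite_order_element = group G for G (structure) +
  fixes g
  assumes g: "g \<in> carrier G" and ord_g: "ord g = 0"
begin

abbreviation Q where "Q \<equiv> centralizer_quotient G g"
abbreviation s where "s \<equiv> euler_section :: 'a set \<Rightarrow> 'a"
abbreviation u where "u \<equiv> euler_cocycle G g"

lemma group_Q: "group Q"
  by (rule group_centralizer_quotient[OF is_group g])

lemma centralizer_closed: "a \<in> centralizer G g \<Longrightarrow> a \<in> carrier G"
  by (simp add: centralizer_def)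

lemma generate_subset: "generate G {g} \<subseteq> centralizer G g"
  using subgroup_centralizer[OF is_group g] g
  by (intro generate_subgroup_incl) (auto simp: centralizer_def)

lemma generate_subgroup: "subgroup (generate G {g}) G"
  using g by (intro generate_is_subgroup) auto

lemma section_in: "K \<in> carrier Q \<Longrightarrow> s K \<in> K"
proof -
  assume "K \<in> carrier Q"
  then obtain a where a: "a \<in> carrier G" "K = generate G {g} #> a"
    using centralizer_closed unfolding carrier_centralizer_quotient by blast
  then have "a \<in> K"
    using rcos_self[OF _ generate_subgroup] by simp
  then show "s K \<in> K"
    unfolding euler_section_def by (rule someI)
qed

lemma coset_subset: "K \<in> carrier Q \<Longrightarrow> K \<subseteq> centralizer G g"
  using generate_subset subgroup.m_closed[OF subgroup_centralizer[OF is_group g]]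
  by (auto simp: carrier_centralizer_quotient r_coset_def)

lemma section_centralizer: "K \<in> carrier Q \<Longrightarrow> s K \<in> centralizer G g"
  using section_in coset_subset by blast

lemma section_closed: "K \<in> carrier Q \<Longrightarrow> s K \<in> carrier G"
  using section_centralizer centralizer_closed by blast

lemma pow_commutes: "x \<in> centralizer G g \<Longrightarrow> g [^] (k::int) \<otimes> x = x \<otimes> g [^] k"
  by (rule generate_commutes[OF is_group g]) (auto simp: generate_pow[OF g])

text \<open>Here infinite order is used; it makes the exponent in the description of
  \<open>euler_cocycle\<close> unique.\<close>

lemma pow_inj: "g [^] (k::int) = g [^] (l::int) \<longleftrightarrow> k = l"
  using int_pow_eq[OF g, of k l] ord_g by auto

lemma coset_pow:
  assumes "K \<in> carrier Q" "x \<in> K" "y \<in> K"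
  shows "\<exists>k::int. x = g [^] k \<otimes> y"
proof -
  obtain a where a: "a \<in> carrier G" "K = generate G {g} #> a"
    using assms(1) centralizer_closed unfolding carrier_centralizer_quotient by blast
  then obtain m n :: int where m: "x = g [^] m \<otimes> a" and n: "y = g [^] n \<otimes> a"
    using assms(2,3) by (auto simp: generate_pow[OF g] r_coset_def)
  have "g [^] (m - n) \<otimes> y = (g [^] (m - n) \<otimes> g [^] n) \<otimes> a"
    using a(1) g by (simp add: n m_assoc)
  also have "\<dots> = x"
    using g by (simp add: m flip: int_pow_mult)
  finally show ?thesis by metis
qed

text \<open>Both \<open>s K \<otimes> s L\<close> and the chosen representative lie in the coset K
  L, so they differ by a power of g, whose exponent is unique. This turns the description by
  \<open>THE\<close> into a usable equation.\<close>

lemma section_mult: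
  assumes K: "K \<in> carrier Q" and L: "L \<in> carrier Q"
  shows "s K \<otimes> s L = g [^] u K L \<otimes> s (K \<otimes>\<^bsub>Q\<^esub> L)"
proof -
  interpret Q: group Q by (rule group_Q)
  have KL: "K \<otimes>\<^bsub>Q\<^esub> L \<in> carrier Q" using K L by simp
  have "s K \<otimes> s L \<in> K \<otimes>\<^bsub>Q\<^esub> L"
    using section_in[OF K] section_in[OF L] by (auto simp: mult_centralizer_quotient set_mult_def)
  then obtain k :: int where k: "s K \<otimes> s L = g [^] k \<otimes> s (K \<otimes>\<^bsub>Q\<^esub> L)"
    using coset_pow[OF KL _ section_in[OF KL]] by blast
  have "u K L = (THE k. s K \<otimes> s L = g [^] k \<otimes> s (K \<otimes>\<^bsub>Q\<^esub> L))"
    by (simp add: euler_cocycle_def euler_section_def)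
  also have "\<dots> = k"
  proof (rule the_equality)
    fix l :: int assume "s K \<otimes> s L = g [^] l \<otimes> s (K \<otimes>\<^bsub>Q\<^esub> L)"
    then show "l = k"
      using k g section_closed[OF KL] by (simp add: pow_inj)
  qed (rule k)
  finally show ?thesis using k by simp
qed

text \<open>The product \<open>s K \<otimes> s L \<otimes> s M\<close> is expanded with both
  bracketings; comparing the exponents of g in front of the same representative gives the
  identity.\<close>

lemma euler_cocycle_identity:
  assumes K: "K \<in> carrier Q" and L: "L \<in> carrier Q" and M: "M \<in> carrier Q"
  shows "u K L + u (K \<otimes>\<^bsub>Q\<^esub> L) M = u L M + u K (L \<otimes>\<^bsub>Q\<^esub> M)"
proof -
  interpret Q: group Q by (rule group_Q)
  note c = section_closed section_mult
  let ?t = "s (K \<otimes>\<^bsub>Q\<^esub> L \<otimes>\<^bsub>Q\<^esub> M)"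
  have t: "?t \<in> carrier G" using K L M by (intro section_closed) simp
  have "s K \<otimes> s L \<otimes> s M = g [^] u K L \<otimes> (s (K \<otimes>\<^bsub>Q\<^esub> L) \<otimes> s M)"
    using K L M g by (simp add: c m_assoc)
  also have "\<dots> = g [^] (u K L + u (K \<otimes>\<^bsub>Q\<^esub> L) M) \<otimes> ?t"
    using K L M g t by (simp add: section_mult int_pow_mult m_assoc)
  finally have 1: "s K \<otimes> s L \<otimes> s M = g [^] (u K L + u (K \<otimes>\<^bsub>Q\<^esub> L) M) \<otimes> ?t" .
  have "s K \<otimes> (s L \<otimes> s M) = (s K \<otimes> g [^] u L M) \<otimes> s (L \<otimes>\<^bsub>Q\<^esub> M)"
    using K L M g by (simp add: section_mult[OF L M] m_assoc section_closed)
  \<comment> \<open>The power of g moves to the front because \<open>s K\<close> centralizes g; this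
    is where the extension being central enters.\<close>
  also have "\<dots> = g [^] u L M \<otimes> (s K \<otimes> s (L \<otimes>\<^bsub>Q\<^esub> M))"
    using K L M g by (simp add: pow_commutes[OF section_centralizer, symmetric] m_assoc section_closed)
  also have "\<dots> = g [^] (u L M + u K (L \<otimes>\<^bsub>Q\<^esub> M)) \<otimes> ?t"
    using K L M g t by (simp add: section_mult int_pow_mult m_assoc Q.m_assoc)
  finally have "s K \<otimes> s L \<otimes> s M = g [^] (u L M + u K (L \<otimes>\<^bsub>Q\<^esub> M)) \<otimes> ?t"
    using K L M by (simp add: m_assoc section_closed)
  with 1 show ?thesis
    using t g by (simp add: pow_inj)
qed

end

section \<open>Cap product with a 2-cocycle as a chain map\<close>

lemma bar_cap_eq_linext:
  "bar_cap u c = linext (\<lambda>xs. Poly_Mapping.single (drop 2 xs) (of_int (u (xs ! 0) (xs ! 1)))) c"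
  by (simp add: bar_cap_def linext_def mult.commute)

lemma bar_face_Cons_Cons:
  "0 < i \<Longrightarrow> bar_face Q (Suc (Suc i)) (a # b # ys) = a # b # bar_face Q i ys"
  by (cases i) (auto simp: bar_face_def)

text \<open>Faces 0, 1, 2 of \<open>a # b # c # zs\<close> all leave the tail \<open>zs\<close>
  after capping, with coefficients u(b, c), -u(ab, c) and u(a, bc); their sum is u(a, b) by the
  cocycle identity, matching face 0 of \<open>c # zs\<close>. Later faces keep a and b and match the
  remaining faces of \<open>c # zs\<close>.\<close>

lemma bar_cap_bar_bd:
  assumes cocycle: "\<And>a b c. a \<in> carrier Q \<Longrightarrow> b \<in> carrier Q \<Longrightarrow> c \<in> carrier Q \<Longrightarrow>
      u a b + u (a \<otimes>\<^bsub>Q\<^esub> b) c = u b c + u a (b \<otimes>\<^bsub>Q\<^esub> c)"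
    and c: "c \<in> tuple_chains Q (n + 3)"
  shows "bar_cap u (bar_bd Q c) = bar_bd Q (bar_cap u c)"
  unfolding bar_cap_eq_linext bar_bd_def linext_linext
proof (rule linext_cong_chains[OF c])
  let ?cap = "\<lambda>xs. Poly_Mapping.single (drop 2 xs) (complex_of_int (u (xs ! 0) (xs ! 1)))"
  fix xs assume len: "length xs = n + 3" and sub: "set xs \<subseteq> carrier Q"
  obtain a b c zs where xs: "xs = a # b # c # zs"
    using len by (auto simp: numeral_3_eq_3 length_Suc_conv)
  then have zs: "length zs = n" and abc: "a \<in> carrier Q" "b \<in> carrier Q" "c \<in> carrier Q"
    using len sub by auto
  \<comment> \<open>The faces of \<open>c # zs\<close> of positive index, with signs shifted by one;
    therefore S enters both sides with a minus sign.\<close>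
  define S where "S = (\<Sum>i\<le>n. Poly_Mapping.single (bar_face Q (Suc i) (c # zs)) ((-1 :: complex) ^ i))"
  have "linext ?cap (\<Sum>i\<le>length xs. Poly_Mapping.single (bar_face Q i xs) ((-1) ^ i)) =
      (\<Sum>i\<le>Suc (Suc (Suc n)). pscale ((-1) ^ i) (?cap (bar_face Q i xs)))"
    by (simp add: linext_sum xs zs del: sum.atMost_Suc)
  also have "\<dots> = ?cap (bar_face Q 0 xs) - ?cap (bar_face Q 1 xs) + ?cap (bar_face Q 2 xs) +
      (\<Sum>i\<le>n. pscale ((-1) ^ (i + 3)) (?cap (bar_face Q (Suc (Suc (Suc i))) xs)))"
    by (simp add: sum.atMost_Suc_shift pscale_uminus_left numeral_2_eq_2 numeral_3_eq_3 single_uminus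
        del: sum.atMost_Suc pscale_single)
  also have "?cap (bar_face Q 0 xs) = Poly_Mapping.single zs (of_int (u b c))"
    by (simp add: bar_face_def xs)
  also have "?cap (bar_face Q 1 xs) = Poly_Mapping.single zs (of_int (u (a \<otimes>\<^bsub>Q\<^esub> b) c))"
    by (simp add: bar_face_def xs)
  also have "?cap (bar_face Q 2 xs) = Poly_Mapping.single zs (of_int (u a (b \<otimes>\<^bsub>Q\<^esub> c)))"
    by (simp add: bar_face_def xs numeral_2_eq_2)
  also have "Poly_Mapping.single zs (of_int (u b c)) - Poly_Mapping.single zs (of_int (u (a \<otimes>\<^bsub>Q\<^esub> b) c)) +
      Poly_Mapping.single zs (of_int (u a (b \<otimes>\<^bsub>Q\<^esub> c))) = Poly_Mapping.single zs (complex_of_int (u a b))"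
  proof -
    have "complex_of_int (u a b) = of_int (u b c) - of_int (u (a \<otimes>\<^bsub>Q\<^esub> b) c) + of_int (u a (b \<otimes>\<^bsub>Q\<^esub> c))"
      using arg_cong[OF cocycle[OF abc], of complex_of_int] by (simp add: algebra_simps)
    then show ?thesis by (simp add: single_add single_diff)
  qed
  also have "(\<Sum>i\<le>n. pscale ((-1) ^ (i + 3)) (?cap (bar_face Q (Suc (Suc (Suc i))) xs))) =
      pscale (- of_int (u a b)) S"
    unfolding S_def pscale_sum
    by (rule sum.cong) (simp_all add: xs bar_face_Cons_Cons power_add mult.commute)
  finally have "linext ?cap (\<Sum>i\<le>length xs. Poly_Mapping.single (bar_face Q i xs) ((-1) ^ i)) =
      Poly_Mapping.single zs (of_int (u a b)) + pscale (- of_int (u a b)) S" .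
  moreover have "(\<Sum>i\<le>Suc n. Poly_Mapping.single (bar_face Q i (c # zs)) ((-1 :: complex) ^ i)) = basis zs - S"
    unfolding S_def by (simp add: sum.atMost_Suc_shift bar_face_def single_uminus sum_negf del: sum.atMost_Suc)
  ultimately show "linext ?cap (if xs = [] then 0 else \<Sum>i\<le>length xs. Poly_Mapping.single (bar_face Q i xs) ((-1) ^ i)) =
      linext (\<lambda>xs. if xs = [] then 0 else \<Sum>i\<le>length xs. Poly_Mapping.single (bar_face Q i xs) ((-1) ^ i)) (?cap xs)"
    by (simp add: xs zs pscale_diff_right pscale_uminus_left del: sum.atMost_Suc)
qed

lemma bar_cap_chains:
  assumes c: "c \<in> tuple_chains Q (n + 2)"
  shows "bar_cap u c \<in> tuple_chains Q n"
  unfolding bar_cap_eq_linext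
  by (rule tuple_chains_lext[OF c], rule tuple_chains_single) (auto dest: in_set_dropD)

section \<open>Zero classes, the Gysin map on them, and the inverse limit\<close>

lemma bar_boundaries_eq: "bar_boundaries Q n = bar_bd Q ` tuple_chains Q (Suc n)"
  by (simp add: bar_boundaries_def bar_boundary_eq_bar_bd bar_chains_eq_chains)

lemma bar_boundaries_diff:
  "a \<in> bar_boundaries Q n \<Longrightarrow> b \<in> bar_boundaries Q n \<Longrightarrow> a - b \<in> bar_boundaries Q n"
  unfolding bar_boundaries_eq by (auto simp flip: bar_bd_diff intro!: imageI tuple_chains_diff)

lemma bar_boundaries_zero [simp]: "0 \<in> bar_boundaries Q n"
  unfolding bar_boundaries_eq by (rule image_eqI[of _ _ 0]) auto

lemma bar_boundaries_add:
  "a \<in> bar_boundaries Q n \<Longrightarrow> b \<in> bar_boundaries Q n \<Longrightarrow> a + b \<in> bar_boundaries Q n"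
  using bar_boundaries_diff[of a Q n "0 - b"] bar_boundaries_diff[of 0 Q n b] by simp

lemma coset_bar_boundaries:
  assumes "b \<in> bar_boundaries Q n"
  shows "bar_boundaries Q n #>\<^bsub>bar_cycle_group Q n\<^esub> b = bar_boundaries Q n"
proof -
  have "x \<in> (\<Union>h\<in>bar_boundaries Q n. {h + b})" if "x \<in> bar_boundaries Q n" for x
    using bar_boundaries_diff[OF that assms] by (intro UN_I[of "x - b"]) auto
  then show ?thesis
    using bar_boundaries_add[OF _ assms] by (auto simp: r_coset_def bar_cycle_group_def)
qed

lemma one_group_homology: "\<one>\<^bsub>group_homology Q n\<^esub> = bar_boundaries Q n"
  by (simp add: group_homology_def FactGroup_def)

lemma mult_one_group_homology:
  "bar_boundaries Q n \<otimes>\<^bsub>group_homology Q n\<^esub> bar_boundaries Q n = bar_boundaries Q n"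
proof -
  have "x \<in> (\<Union>h\<in>bar_boundaries Q n. \<Union>k\<in>bar_boundaries Q n. {h + k})" if "x \<in> bar_boundaries Q n" for x
    using that by (intro UN_I[of x] UN_I[of 0]) auto
  then show ?thesis
    using bar_boundaries_add by (auto simp: group_homology_def FactGroup_def set_mult_def bar_cycle_group_def)
qed

lemma one_closed_group_homology: "bar_boundaries Q n \<in> carrier (group_homology Q n)"
  using coset_bar_boundaries[of 0 Q n]
  by (auto simp: group_homology_def FactGroup_def RCOSETS_def bar_cycle_group_def bar_chains_eq_chains
      bar_boundary_eq_bar_bd intro!: exI[of _ 0])

lemma group_homology_above:
  assumes "acyclic_above Q N" "n > N" "K \<in> carrier (group_homology Q n)"
  shows "K = bar_boundaries Q n"
proof -
  obtain z where z: "z \<in> tuple_chains Q n" "bar_bd Q z = 0" and K: "K = bar_boundaries Q n #>\<^bsub>bar_cycle_group Q n\<^esub> z"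
    using assms(3) by (auto simp: group_homology_def FactGroup_def RCOSETS_def bar_cycle_group_def
        bar_chains_eq_chains bar_boundary_eq_bar_bd)
  have "\<exists>v\<in>tuple_chains Q (Suc n). bar_bd Q v = z"
    using assms(1,2) z unfolding acyclic_above_def by simp
  then have "z \<in> bar_boundaries Q n"
    unfolding bar_boundaries_eq by auto
  then show ?thesis
    unfolding K by (rule coset_bar_boundaries)
qed

context infinite_order_element
begin

text \<open>S(0) = 0 for the map of cosets: every representative of the zero class is a boundary,
  capping sends it to a boundary, and the union over these representatives is not empty.\<close>

lemma gysin_one: "gysin G g n (bar_boundaries Q (n + 2)) = bar_boundaries Q n"
proof -
  have "bar_boundaries Q n #>\<^bsub>bar_cycle_group Q n\<^esub> bar_cap u z = bar_boundaries Q n"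
    if z: "z \<in> bar_boundaries Q (n + 2)" for z
  proof (rule coset_bar_boundaries)
    obtain c where c: "c \<in> tuple_chains Q (n + 3)" "z = bar_bd Q c"
      using z by (auto simp: bar_boundaries_eq numeral_3_eq_3)
    have "bar_cap u z = bar_bd Q (bar_cap u c)"
      unfolding c(2) by (rule bar_cap_bar_bd[OF euler_cocycle_identity c(1)])
    moreover have "bar_cap u c \<in> tuple_chains Q (Suc n)"
      by (rule bar_cap_chains) (use c(1) in \<open>simp add: numeral_3_eq_3\<close>)
    ultimately show "bar_cap u z \<in> bar_boundaries Q n"
      unfolding bar_boundaries_eq by blast
  qed
  moreover have "bar_boundaries Q (n + 2) \<noteq> {}"
    using bar_boundaries_zero[of Q "n + 2"] by (metis empty_iff)
  ultimately show ?thesis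
    by (simp add: gysin_def)
qed

text \<open>Each entry of a thread is an iterated Gysin image of an entry in degree above N, where
  only the zero class exists. Conversely, S(0) = 0 makes the zero thread an element of the
  limit.\<close>

lemma burghelea_T_trivial:
  assumes N: "acyclic_above Q N"
  shows "trivial_group (burghelea_T G g i)"
proof -
  let ?T = "burghelea_T G g i"
  have one: "\<one>\<^bsub>?T\<^esub> = (\<lambda>n. bar_boundaries Q (i + 2 * n))"
    by (simp add: burghelea_T_def one_group_homology)
  have mem: "x \<in> carrier ?T \<longleftrightarrow> (\<forall>n. x n \<in> carrier (group_homology Q (i + 2 * n))) \<and>
      (\<forall>n. gysin G g (i + 2 * n) (x (Suc n)) = x n)" for x
    by (simp add: burghelea_T_def)
  have gy: "gysin G g (i + 2 * k) (bar_boundaries Q (i + 2 * Suc k)) = bar_boundaries Q (i + 2 * k)" for k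
    using gysin_one[of "i + 2 * k"] by (simp add: algebra_simps)
  have carrier: "carrier ?T = {\<one>\<^bsub>?T\<^esub>}"
  proof (intro subset_antisym subsetI)
    fix x assume x: "x \<in> carrier ?T"
    have step: "gysin G g (i + 2 * k) (x (Suc k)) = x k" and H: "x k \<in> carrier (group_homology Q (i + 2 * k))" for k
      using x unfolding mem by blast+
    have "x n = bar_boundaries Q (i + 2 * n)" for n
    \<comment> \<open>Downward induction from the stage \<open>n + Suc N\<close>, whose homological
      degree \<open>i + 2 * (n + Suc N)\<close> exceeds N for every i and n.\<close>
    proof (rule inc_induct[of n "n + Suc N"])
      show "x (n + Suc N) = bar_boundaries Q (i + 2 * (n + Suc N))"
      proof (rule group_homology_above[OF N])
        show "N < i + 2 * (n + Suc N)" by simp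
      qed (rule H)
    next
      fix k assume "x (Suc k) = bar_boundaries Q (i + 2 * Suc k)"
      then show "x k = bar_boundaries Q (i + 2 * k)"
        using step[of k] gy[of k] by simp
    qed simp
    then show "x \<in> {\<one>\<^bsub>?T\<^esub>}"
      unfolding one by auto
  next
    fix x assume "x \<in> {\<one>\<^bsub>?T\<^esub>}"
    then show "x \<in> carrier ?T"
      unfolding mem one using gy one_closed_group_homology by blast
  qed
  have "\<one>\<^bsub>?T\<^esub> \<otimes>\<^bsub>?T\<^esub> \<one>\<^bsub>?T\<^esub> = \<one>\<^bsub>?T\<^esub>"
    unfolding one by (simp add: burghelea_T_def mult_one_group_homology)
  then have "group ?T"
    by (intro groupI) (simp_all add: carrier)
  with carrier show ?thesis
    by (simp add: trivial_group_def)
qed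

end

text \<open>The summand of a conjugacy class is formed with an arbitrarily chosen member, which must
  again have infinite order for its Euler cocycle to make sense.\<close>

lemma ord_conjugate:
  assumes "group G" and h: "h \<in> carrier G" and g: "g \<in> carrier G" and "group.ord G g = 0"
  shows "group.ord G (h \<otimes>\<^bsub>G\<^esub> g \<otimes>\<^bsub>G\<^esub> inv\<^bsub>G\<^esub> h) = 0"
proof -
  interpret group G by fact
  have pow: "(h \<otimes>\<^bsub>G\<^esub> g \<otimes>\<^bsub>G\<^esub> inv\<^bsub>G\<^esub> h) [^]\<^bsub>G\<^esub> n = h \<otimes>\<^bsub>G\<^esub> g [^]\<^bsub>G\<^esub> n \<otimes>\<^bsub>G\<^esub> inv\<^bsub>G\<^esub> h" for n :: nat
  proof (induction n)
    case (Suc n)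
    have "inv\<^bsub>G\<^esub> h \<otimes>\<^bsub>G\<^esub> (h \<otimes>\<^bsub>G\<^esub> (g \<otimes>\<^bsub>G\<^esub> inv\<^bsub>G\<^esub> h)) = g \<otimes>\<^bsub>G\<^esub> inv\<^bsub>G\<^esub> h"
      using h g by (simp flip: m_assoc)
    then show ?case
      using h g Suc by (simp add: m_assoc)
  qed (use h in simp)
  have "g [^]\<^bsub>G\<^esub> n = \<one>\<^bsub>G\<^esub>" if "h \<otimes>\<^bsub>G\<^esub> g [^]\<^bsub>G\<^esub> n \<otimes>\<^bsub>G\<^esub> inv\<^bsub>G\<^esub> h = \<one>\<^bsub>G\<^esub>" for n :: nat
  proof -
    have "h \<otimes>\<^bsub>G\<^esub> g [^]\<^bsub>G\<^esub> n = (h \<otimes>\<^bsub>G\<^esub> g [^]\<^bsub>G\<^esub> n \<otimes>\<^bsub>G\<^esub> inv\<^bsub>G\<^esub> h) \<otimes>\<^bsub>G\<^esub> h"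
      using h g by (simp add: m_assoc)
    also have "\<dots> = h" unfolding that using h by simp
    finally show ?thesis using h g by simp
  qed
  then show ?thesis
    using assms by (auto simp: ord_eq_0 pow)
qed

lemma trivial_sum_group:
  assumes "\<And>c. c \<in> I \<Longrightarrow> trivial_group (A c)"
  shows "trivial_group (sum_group I A)"
proof -
  have A: "group (A c)" "carrier (A c) = {\<one>\<^bsub>A c\<^esub>}" if "c \<in> I" for c
    using assms[OF that] by (auto simp: trivial_group_def)
  have grp: "group (sum_group I A)"
    by (rule sum_group) (rule A(1))
  have "carrier (sum_group I A) = {\<one>\<^bsub>sum_group I A\<^esub>}"
  proof (intro subset_antisym subsetI)
    fix x assume "x \<in> carrier (sum_group I A)"
    then have "x \<in> (\<Pi>\<^sub>E c\<in>I. carrier (A c))"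
      using A(1) by (simp add: carrier_sum_group)
    then have "x = (\<lambda>c\<in>I. \<one>\<^bsub>A c\<^esub>)"
      by (intro extensionalityI[of _ I]) (auto simp: PiE_iff A(2))
    then show "x \<in> {\<one>\<^bsub>sum_group I A\<^esub>}" by simp
  next
    fix x assume "x \<in> {\<one>\<^bsub>sum_group I A\<^esub>}"
    then show "x \<in> carrier (sum_group I A)"
      using monoid.one_closed[OF group.is_monoid[OF grp]] by (simp only: singleton_iff)
  qed
  with grp show ?thesis
    unfolding trivial_group_def by (rule conjI)
qed

text \<open>Two changes of type are made: G is copied to a group H on \<open>nat\<close>, and the
  centralizer quotients of H, whose elements are sets of numbers, are copied to \<open>nat\<close>
  once more before the bound on \<open>hd_rat\<close> is used. Acyclicity then travels back along
  both isomorphisms.\<close>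

theorem corollary3p20:
  fixes G :: "'a monoid"
  assumes hd_finite: "\<forall>H :: nat monoid. group H \<and> asdim H < \<infinity> \<longrightarrow> hd_rat H < \<infinity>"
    and quotient_finite: "\<forall>(H :: nat monoid) g. group H \<and> asdim H < \<infinity> \<and> g \<in> carrier H
          \<longrightarrow> asdim (centralizer_quotient H g) < \<infinity>"
    and "group G" and "asdim G < \<infinity>"
  shows "burghelea_conjecture G"
proof -
  note G = \<open>group G\<close>
  obtain H :: "nat monoid" and \<phi> where H: "group H" and \<phi>: "\<phi> \<in> iso G H"
    using countable_group_iso_nat[OF G asdim_finite_countable[OF G \<open>asdim G < \<infinity>\<close>]] .
  have asdimH: "asdim H < \<infinity>"
    by (rule asdim_finite_iso[OF G \<phi> \<open>asdim G < \<infinity>\<close>])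
  have acyclic: "\<exists>N. acyclic_above (centralizer_quotient G g) N" if g: "g \<in> carrier G" for g
  proof -
    let ?K = "centralizer_quotient H (\<phi> g)"
    have h: "\<phi> g \<in> carrier H"
      using \<phi> g by (auto simp: iso_def hom_def)
    have K: "group ?K"
      by (rule group_centralizer_quotient[OF H h])
    have asdimK: "asdim ?K < \<infinity>"
      using quotient_finite H asdimH h by blast
    obtain L :: "nat monoid" and \<psi> where L: "group L" and \<psi>: "\<psi> \<in> iso ?K L"
      using countable_group_iso_nat[OF K asdim_finite_countable[OF K asdimK]] .
    have "asdim L < \<infinity>"
      by (rule asdim_finite_iso[OF K \<psi> asdimK])
    then have "hd_rat L < \<infinity>"
      using hd_finite L by blast
    then obtain N where "acyclic_above L N"
      using finite_hd_rat_acyclic[OF L] by blast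
    then have "acyclic_above ?K N"
      by (rule acyclic_above_iso[OF \<psi> K])
    then have "acyclic_above (centralizer_quotient G g) N"
      by (rule acyclic_above_iso[OF centralizer_quotient_iso[OF G H \<phi> g] group_centralizer_quotient[OF G g]])
    then show ?thesis ..
  qed
  have "trivial_group (burghelea_T G (SOME g. g \<in> c) i)" if c: "c \<in> infinite_order_classes G" for c i
  proof -
    interpret group G by (rule G)
    obtain g0 where g0: "g0 \<in> carrier G" "ord g0 = 0" and cg: "c = conjugacy_class G g0"
      using c by (auto simp: infinite_order_classes_def)
    let ?g = "SOME g. g \<in> c"
    have "\<one>\<^bsub>G\<^esub> \<otimes>\<^bsub>G\<^esub> g0 \<otimes>\<^bsub>G\<^esub> inv\<^bsub>G\<^esub> \<one>\<^bsub>G\<^esub> \<in> c"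
      unfolding cg conjugacy_class_def by blast
    \<comment> \<open>The class contains the conjugate of \<open>g0\<close> by the unit, so the
      choice is from a nonempty set.\<close>
    then have "?g \<in> c" by (rule someI)
    then obtain h where "h \<in> carrier G" "?g = h \<otimes>\<^bsub>G\<^esub> g0 \<otimes>\<^bsub>G\<^esub> inv\<^bsub>G\<^esub> h"
      unfolding cg conjugacy_class_def by blast
    then have g: "?g \<in> carrier G" "ord ?g = 0"
      using ord_conjugate[OF G _ g0] g0 by simp_all
    interpret infinite_order_element G ?g
      by unfold_locales (rule g)+
    obtain N where "acyclic_above (centralizer_quotient G ?g) N"
      using acyclic[OF g(1)] by blast
    then show ?thesis
      by (rule burghelea_T_trivial)
  qed
  then show ?thesis
    unfolding burghelea_conjecture_def by (intro ballI trivial_sum_group)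
qed

end
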